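(* The monoid $\mathsf{fP}$ is regular if and only if one-way functions do not exist; and this holds if and only if $\mathsf{P}=\mathsf{NP}$.
   Context: Let $A=\{0,1\}$ and let $A^*$ be the set of all strings over $A$. "Function" means partial function; $\mathsf{Dom}(f)$ and $\mathsf{Im}(f)$ denote domain and image of $f$. A partial function $f:A^*\to A^*$ is polynomially balanced iff there exist polynomials $p,q$ such that for all $x\in\mathsf{Dom}(f)$: $|f(x)|\le p(|x|)$ and $|x|\le q(|f(x)|)$. $\mathsf{fP}$ is the set of all polynomially balanced partial functions $f:A^*\to A^*$ such that $x\in\mathsf{Dom}(f)\mapsto f(x)$ is computable by a deterministic polynomial-time Turing machine (a machine computing $f$ also serves as an acceptor of $\mathsf{Dom}(f)$, so $\mathsf{Dom}(f)\in\mathsf{P}$). $\mathsf{fP}$ is a monoid under composition of partial functions. A semigroup $S$ is regular iff for every $x\in S$ there is $x'\in S$ with $xx'x=x$. A partial function $f$ is one-way iff $f\in\mathsf{fP}$ but there is no deterministic polynomial-time algorithm which, on every input $y\in\mathsf{Im}(f)$, outputs some $x\in A^*$ with $f(x)=y$ (no requirement for $y\notin\mathsf{Im}(f)$). $\mathsf{P}$, $\mathsf{NP}$ are the classes of languages accepted by deterministic, respectively nondeterministic, polynomial-time Turing machines. *)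

theory Defs
  imports "HOL-Algebra.Group" "HOL-Computational_Algebra.Polynomial"
begin

text \<open>Strings over \<open>{0,1}\<close> are lists of booleans; partial functions are functions into an option
  type, with \<^const>\<open>dom\<close>, \<^const>\<open>ran\<close> and \<^const>\<open>map_comp\<close> as domain, image and composition.\<close>

type_synonym str = "bool list"

datatype symbol = Blank | Bit bool | Aux nat

datatype move = MoveLeft | Stay | MoveRight

text \<open>A tape is two-way infinite and is recorded relative to its head: \<open>t i\<close> is the symbol \<open>i\<close> cells
  to the right of the scanned cell, so that moving the head shifts the function.\<close>

type_synonym tape = "int \<Rightarrow> symbol"

definition string_tape :: "str \<Rightarrow> tape" where
  "string_tape w = (\<lambda>i. if 0 \<le> i \<and> i < int (length w) then Bit (w ! nat i) else Blank)"

definition move_head :: "move \<Rightarrow> tape \<Rightarrow> tape" where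
  "move_head m t = (case m of MoveLeft \<Rightarrow> (\<lambda>i. t (i - 1)) | Stay \<Rightarrow> t | MoveRight \<Rightarrow> (\<lambda>i. t (i + 1)))"

text \<open>An action \<open>(a, b, m)\<close> on a single tape is enabled if the scanned symbol is \<open>a\<close>; it overwrites it
  with \<open>b\<close> and then moves the head according to \<open>m\<close>.\<close>

type_synonym action = "symbol \<times> symbol \<times> move"

definition act :: "action \<Rightarrow> tape \<Rightarrow> tape" where
  "act = (\<lambda>(a, b, m) t. move_head m (t(0 := b)))"

text \<open>A transition consists of a state, one action for each tape, and a next state. Finiteness of the
  transition table makes the set of states and the tape alphabet in use finite as well.\<close>

record 'q tm =
  tapes :: nat
  start :: 'q
  accepting :: "'q set"
  transitions :: "('q \<times> action list \<times> 'q) set"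

definition turing_machine :: "'q tm \<Rightarrow> bool" where
  "turing_machine M \<longleftrightarrow> tapes M \<ge> 1 \<and> finite (accepting M) \<and> finite (transitions M) \<and>
     (\<forall>(q, as, q') \<in> transitions M. length as = tapes M)"

definition deterministic :: "'q tm \<Rightarrow> bool" where
  "deterministic M \<longleftrightarrow>
     (\<forall>(q1, as1, r1) \<in> transitions M. \<forall>(q2, as2, r2) \<in> transitions M.
        q1 = q2 \<and> map fst as1 = map fst as2 \<longrightarrow> as1 = as2 \<and> r1 = r2)"

type_synonym 'q config = "'q \<times> tape list"

definition initial :: "'q tm \<Rightarrow> str \<Rightarrow> 'q config" where
  "initial M x = (start M, string_tape x # replicate (tapes M - 1) (\<lambda>_. Blank))"

definition steps :: "'q tm \<Rightarrow> ('q config \<times> 'q config) set" where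
  "steps M = {((q, ts), (q', map2 act as ts)) | q ts as q'.
     (q, as, q') \<in> transitions M \<and> map fst as = map (\<lambda>t. t 0) ts}"

definition halting :: "'q tm \<Rightarrow> 'q config \<Rightarrow> bool" where
  "halting M c \<longleftrightarrow> (\<nexists>c'. (c, c') \<in> steps M)"

definition polynomial_time :: "'q tm \<Rightarrow> bool" where
  "polynomial_time M \<longleftrightarrow>
     (\<exists>p :: nat poly. \<forall>x n c. (initial M x, c) \<in> steps M ^^ n \<longrightarrow> n \<le> poly p (length x))"

definition accepting_result :: "'q tm \<Rightarrow> str \<Rightarrow> 'q config \<Rightarrow> bool" where
  "accepting_result M x c \<longleftrightarrow> (initial M x, c) \<in> (steps M)\<^sup>* \<and> halting M c \<and> fst c \<in> accepting M"

definition language :: "'q tm \<Rightarrow> str set" where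
  "language M = {x. \<exists>c. accepting_result M x c}"

text \<open>The result is left on the first tape, in the same format as the input: the head scans the first
  letter of the result (or a blank, if the result is empty) and the rest of the tape is blank. The other
  tapes may hold anything.\<close>

definition outputs :: "'q tm \<Rightarrow> str \<Rightarrow> str \<Rightarrow> bool" where
  "outputs M x y \<longleftrightarrow> (\<exists>c. accepting_result M x c \<and> hd (snd c) = string_tape y)"

text \<open>Natural numbers as states suffice, since only finitely many states occur in a machine.\<close>

definition NTM_poly :: "nat tm set" where
  "NTM_poly = {M. turing_machine M \<and> polynomial_time M}"

definition DTM_poly :: "nat tm set" where
  "DTM_poly = {M \<in> NTM_poly. deterministic M}"

definition class_P :: "str set set" where
  "class_P = language ` DTM_poly"

definition class_NP :: "str set set" where
  "class_NP = language ` NTM_poly"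

definition polynomially_balanced :: "(str \<rightharpoonup> str) \<Rightarrow> bool" where
  "polynomially_balanced f \<longleftrightarrow>
     (\<exists>p q :: nat poly. \<forall>x y. f x = Some y \<longrightarrow>
        length y \<le> poly p (length x) \<and> length x \<le> poly q (length y))"

definition computes :: "'q tm \<Rightarrow> (str \<rightharpoonup> str) \<Rightarrow> bool" where
  "computes M f \<longleftrightarrow> language M = dom f \<and> (\<forall>x y. f x = Some y \<longrightarrow> outputs M x y)"

definition fP :: "(str \<rightharpoonup> str) monoid" where
  "fP = \<lparr>carrier = {f. polynomially_balanced f \<and> (\<exists>M \<in> DTM_poly. computes M f)},
         monoid.mult = map_comp, one = Some\<rparr>"

definition regular :: "('a, 'b) monoid_scheme \<Rightarrow> bool" where
  "regular S \<longleftrightarrow> (\<forall>x \<in> carrier S. \<exists>x' \<in> carrier S. x \<otimes>\<^bsub>S\<^esub> x' \<otimes>\<^bsub>S\<^esub> x = x)"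

definition one_way :: "(str \<rightharpoonup> str) \<Rightarrow> bool" where
  "one_way f \<longleftrightarrow> f \<in> carrier fP \<and>
     \<not> (\<exists>M \<in> DTM_poly. \<forall>y \<in> ran f. \<exists>x. outputs M y x \<and> f x = Some y)"

end

theory Submission
  imports Defs
begin

text \<open>
The three statements are proved equivalent in a circle.

If \<open>fP\<close> is regular, an element \<open>g\<close> with \<open>f g f = f\<close> sends every \<open>y = f x\<close> to some \<open>g y\<close> with
\<open>f (g y) = y\<close>. The machine for \<open>g\<close> therefore inverts \<open>f\<close>, and no \<open>f\<close> is one-way
(\<open>no_one_way_if_regular\<close>).

If there are no one-way functions, let \<open>N\<close> be a nondeterministic machine that runs in polynomial time. The
partial function that sends a pair \<open>(x, w)\<close> to \<open>x\<close> whenever the choices recorded in \<open>w\<close> lead \<open>N\<close> from the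
input \<open>x\<close> to acceptance belongs to \<open>fP\<close>, because \<open>w\<close> is as long as the run up to a constant factor, and its image is
the language of \<open>N\<close> (\<open>language_as_range\<close>). Some machine \<open>M\<close> inverts it. On inputs outside the language \<open>M\<close> may
leave anything on its tapes, but a decision procedure only has to evaluate the function at whatever string \<open>M\<close> has
produced and to compare the value with \<open>x\<close> (\<open>P_eq_NP_if_no_one_way\<close>).

If P equals NP, let \<open>f\<close> be in \<open>fP\<close>. The set of pairs \<open>(y, u)\<close> such that \<open>u\<close> is a prefix of some
preimage of \<open>y\<close> is in NP: since \<open>f\<close> is balanced, a missing suffix of polynomial length can be guessed and
checked (\<open>extension_language_NP\<close>). By assumption some deterministic machine decides it, and asking that machine
repeatedly finds a preimage letter by letter. The function so computed is defined exactly on the image of \<open>f\<close>,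
inherits balancedness from \<open>f\<close>, and is an inner inverse of it (\<open>regular_if_P_eq_NP\<close>).

The machines are written as programs in a small imperative language over named tapes. The judgement
\<open>run c ts n S\<close> gives a time bound \<open>n\<close> and the exact set \<open>S\<close> of final stores; \<open>compile\<close> turns a program whose running
time is polynomially bounded into a Turing machine, a deterministic one if the program is deterministic. A given
deterministic machine becomes a subroutine (\<open>call\<close>) by keeping its state on a tape of its own.\<close>

section \<open>Polynomial bounds\<close>

definition poly_bounded :: "(nat \<Rightarrow> nat) \<Rightarrow> bool" where
  "poly_bounded T \<longleftrightarrow> (\<exists>p :: nat poly. \<forall>n. T n \<le> poly p n)"

lemma poly_bounded_poly [intro]: "poly_bounded (poly p)"
  by (auto simp: poly_bounded_def)

lemma poly_bounded_const [intro]: "poly_bounded (\<lambda>_. c)"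
  by (auto simp: poly_bounded_def intro: exI[of _ "[:c:]"])

lemma poly_bounded_id [intro]: "poly_bounded (\<lambda>n. n)"
  by (auto simp: poly_bounded_def intro: exI[of _ "[:0, 1:]"])

lemma poly_bounded_add [intro]:
  assumes "poly_bounded S" "poly_bounded T" shows "poly_bounded (\<lambda>n. S n + T n)"
proof -
  from assms obtain p q :: "nat poly" where "\<And>n. S n \<le> poly p n" "\<And>n. T n \<le> poly q n"
    by (auto simp: poly_bounded_def)
  then show ?thesis by (auto simp: poly_bounded_def intro!: exI[of _ "p + q"] add_mono)
qed

lemma poly_bounded_mult [intro]:
  assumes "poly_bounded S" "poly_bounded T" shows "poly_bounded (\<lambda>n. S n * T n)"
proof -
  from assms obtain p q :: "nat poly" where "\<And>n. S n \<le> poly p n" "\<And>n. T n \<le> poly q n"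
    by (auto simp: poly_bounded_def)
  then show ?thesis by (auto simp: poly_bounded_def intro!: exI[of _ "p * q"] mult_mono)
qed

lemma poly_bounded_power [intro]: "poly_bounded T \<Longrightarrow> poly_bounded (\<lambda>n. T n ^ k)"
  by (induction k) auto

lemma poly_mono_nat: "m \<le> n \<Longrightarrow> poly p m \<le> poly p (n :: nat)"
  by (induction p) (auto intro!: add_mono mult_mono)

lemma poly_bounded_comp [intro]:
  assumes "poly_bounded T" shows "poly_bounded (\<lambda>n. poly p (T n))"
proof -
  from assms obtain q :: "nat poly" where "\<And>n. T n \<le> poly q n"
    by (auto simp: poly_bounded_def)
  then have "poly p (T n) \<le> poly (pcompose p q) n" for n
    by (simp add: poly_pcompose poly_mono_nat)
  then show ?thesis by (auto simp: poly_bounded_def)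
qed

section \<open>Programs over named tapes\<close>

text \<open>\<open>Blk b j\<close> serves as the \<open>j\<close>-th tape of a machine that runs as a subroutine in block \<open>b\<close>. The current state of
that machine is the symbol scanned on \<open>State b\<close>, and \<open>Counter\<close> collects one mark for each of its steps. The tapes
\<open>Var n\<close> belong to the calling program; input and output are on \<open>Var 0\<close>.\<close>

datatype tape_name = Var nat | Blk nat nat | State nat | Counter

type_synonym store = "tape_name \<Rightarrow> tape"
type_synonym scan = "tape_name \<Rightarrow> symbol"
type_synonym update = "tape_name \<rightharpoonup> symbol \<times> move"

text \<open>\<open>Prim r\<close> performs one of the updates that \<open>r\<close> offers for the scanned symbols, and blocks if there is none. An
update leaves the tapes outside its domain alone. All other constructs are deterministic.\<close>

datatype com =
    Prim "scan \<Rightarrow> update set"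
  | Seq com com
  | Cond "scan \<Rightarrow> bool" com com
  | While "scan \<Rightarrow> bool" com

definition put :: "symbol \<times> move \<Rightarrow> tape \<Rightarrow> tape" where
  "put = (\<lambda>(b, m) t. move_head m (t(0 := b)))"

lemma put_scanned [simp]: "put (t 0, m) t = move_head m t"
  by (simp add: put_def)

lemma act_put: "act a = put (snd a)"
  by (cases a) (auto simp: act_def put_def)

definition upd :: "update \<Rightarrow> store \<Rightarrow> store" where
  "upd u ts = (\<lambda>i. case u i of None \<Rightarrow> ts i | Some a \<Rightarrow> put a (ts i))"

lemma upd_empty [simp]: "upd Map.empty ts = ts"
  by (simp add: upd_def)

lemma upd_update [simp]: "upd (u(i \<mapsto> a)) ts = (upd u ts)(i := put a (ts i))"
  by (auto simp: upd_def)

abbreviation scanned :: "store \<Rightarrow> scan" where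
  "scanned ts \<equiv> (\<lambda>i. ts i 0)"

text \<open>\<open>run c ts n S\<close> says that executions of \<open>c\<close> from \<open>ts\<close> make at most \<open>n\<close> steps, and that \<open>S\<close> consists of the stores
in which they end. Blocked executions contribute nothing, so \<open>S = {}\<close> means rejection. Since \<open>S\<close> is exact in both
directions, the same judgement covers acceptance by a nondeterministic program and, with a singleton \<open>S\<close>, the
result of a deterministic one. Every change of control costs one step because it becomes a transition of the
compiled machine.\<close>

inductive run :: "com \<Rightarrow> store \<Rightarrow> nat \<Rightarrow> store set \<Rightarrow> bool" where
  run_Prim: "run (Prim r) ts 1 ((\<lambda>u. upd u ts) ` r (scanned ts))"
| run_Seq: "run a ts n S \<Longrightarrow> (\<And>ts'. ts' \<in> S \<Longrightarrow> run b ts' m (S' ts')) \<Longrightarrow>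
    run (Seq a b) ts (n + m + 1) (\<Union>ts'\<in>S. S' ts')"
| run_Cond: "run (if g (scanned ts) then a else b) ts n S \<Longrightarrow> run (Cond g a b) ts (n + 1) S"
| run_While_False: "\<not> g (scanned ts) \<Longrightarrow> run (While g a) ts 1 {ts}"
| run_While_True: "g (scanned ts) \<Longrightarrow> run a ts n S \<Longrightarrow>
    (\<And>ts'. ts' \<in> S \<Longrightarrow> run (While g a) ts' m (S' ts')) \<Longrightarrow>
    run (While g a) ts (n + m + 1) (\<Union>ts'\<in>S. S' ts')"
| run_mono: "run a ts n S \<Longrightarrow> n \<le> m \<Longrightarrow> run a ts m S"

text \<open>The small-step semantics that the machine follows: its control state is the stack of commands still to be executed.\<close>

fun next_stacks :: "com list \<Rightarrow> scan \<Rightarrow> (update \<times> com list) set" where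
  "next_stacks [] s = {}"
| "next_stacks (Prim r # k) s = (\<lambda>u. (u, k)) ` r s"
| "next_stacks (Seq a b # k) s = {(Map.empty, a # b # k)}"
| "next_stacks (Cond g a b # k) s = {(Map.empty, (if g s then a else b) # k)}"
| "next_stacks (While g a # k) s = {(Map.empty, if g s then a # While g a # k else k)}"

definition stack_step :: "((com list \<times> store) \<times> (com list \<times> store)) set" where
  "stack_step = {((k, ts), (k', upd u ts)) | k ts u k'. (u, k') \<in> next_stacks k (scanned ts)}"

definition outcome :: "com list \<times> store \<Rightarrow> nat \<Rightarrow> store set \<Rightarrow> bool" where
  "outcome c n S \<longleftrightarrow> (\<forall>m c'. (c, c') \<in> stack_step ^^ m \<longrightarrow> m \<le> n) \<and>
     {ts'. (c, ([], ts')) \<in> stack_step\<^sup>*} = S"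

lemma outcome_done: "outcome ([], ts) 0 {ts}"
proof -
  have no: "(([], ts), c) \<notin> stack_step" for c
    by (auto simp: stack_step_def)
  have "m \<le> 0" if "(([], ts), c') \<in> stack_step ^^ m" for m c'
    using that no by (cases m) (auto elim: relpow_E2)
  moreover have "(([], ts), ([], ts')) \<in> stack_step\<^sup>* \<longleftrightarrow> ts' = ts" for ts'
    using no by (auto elim: converse_rtranclE)
  ultimately show ?thesis by (auto simp: outcome_def)
qed

lemma outcome_step:
  assumes "k \<noteq> []"
    and succ: "\<And>u k'. (u, k') \<in> next_stacks k (scanned ts) \<Longrightarrow> outcome (k', upd u ts) n (S u k')"
  shows "outcome (k, ts) (Suc n) (\<Union>(u, k') \<in> next_stacks k (scanned ts). S u k')"
proof -
  have step: "((k, ts), c) \<in> stack_step \<longleftrightarrow>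
      (\<exists>u k'. (u, k') \<in> next_stacks k (scanned ts) \<and> c = (k', upd u ts))" for c
    by (auto simp: stack_step_def)
  have "m \<le> Suc n" if m: "((k, ts), c') \<in> stack_step ^^ m" for m c'
  proof (cases m)
    case (Suc j)
    with m obtain c where "((k, ts), c) \<in> stack_step" and "(c, c') \<in> stack_step ^^ j"
      by (metis relpow_Suc_D2)
    moreover from this(1) step obtain u k' where
      "(u, k') \<in> next_stacks k (scanned ts)" "c = (k', upd u ts)" by auto
    ultimately have "j \<le> n" using succ[of u k'] unfolding outcome_def by blast
    with Suc show ?thesis by simp
  qed simp
  moreover have "((k, ts), ([], ts')) \<in> stack_step\<^sup>* \<longleftrightarrow>
      (\<exists>u k'. (u, k') \<in> next_stacks k (scanned ts) \<and> ts' \<in> S u k')" (is "?l \<longleftrightarrow> ?r") for ts'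
  proof
    assume ?l
    then obtain c where "((k, ts), c) \<in> stack_step" "(c, ([], ts')) \<in> stack_step\<^sup>*"
      using \<open>k \<noteq> []\<close> by (auto elim: converse_rtranclE)
    moreover from this(1) step obtain u k' where
      "(u, k') \<in> next_stacks k (scanned ts)" "c = (k', upd u ts)" by auto
    ultimately show ?r using succ[of u k'] unfolding outcome_def by blast
  next
    assume ?r
    then obtain u k' where u: "(u, k') \<in> next_stacks k (scanned ts)" and "ts' \<in> S u k'" by auto
    with succ[OF u] have "((k', upd u ts), ([], ts')) \<in> stack_step\<^sup>*"
      unfolding outcome_def by blast
    with u step show ?l by (blast intro: converse_rtrancl_into_rtrancl)
  qed
  ultimately show ?thesis unfolding outcome_def by blast
qed

lemma outcome_mono: "outcome c n S \<Longrightarrow> n \<le> m \<Longrightarrow> outcome c m S"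
  by (auto simp: outcome_def intro: order_trans)

lemma outcome_silent:
  assumes "k \<noteq> []" "next_stacks k (scanned ts) = {(Map.empty, k')}" "outcome (k', ts) n S"
  shows "outcome (k, ts) (Suc n) S"
  using outcome_step[OF assms(1), of ts n "\<lambda>_ _. S"] assms(2,3) by simp

text \<open>The statement speaks about an arbitrary remaining stack \<open>k\<close>, for this is the situation in which the parts of a
sequence or a loop are executed.\<close>

lemma run_outcome:
  assumes "run c ts n S" "\<And>ts'. ts' \<in> S \<Longrightarrow> outcome (k, ts') N (F ts')"
  shows "outcome (c # k, ts) (n + N) (\<Union>ts'\<in>S. F ts')"
  using assms
proof (induction arbitrary: k N F rule: run.induct)
  case (run_Prim r ts)
  have "outcome (Prim r # k, ts) (Suc N) (\<Union>(u, k')\<in>next_stacks (Prim r # k) (scanned ts). F (upd u ts))"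
    by (rule outcome_step) (use run_Prim in auto)
  then show ?case by (simp add: image_image)
next
  case (run_Seq a ts n S b m S')
  have "outcome (a # b # k, ts) (n + (m + N)) (\<Union>ts'\<in>S. \<Union>ts''\<in>S' ts'. F ts'')"
    by (rule run_Seq.IH(1), rule run_Seq.IH(2)) (use run_Seq.prems in blast)+
  then have "outcome (Seq a b # k, ts) (Suc (n + (m + N))) (\<Union>ts'\<in>S. \<Union>ts''\<in>S' ts'. F ts'')"
    by (intro outcome_silent[where k' = "a # b # k"]) auto
  then show ?case by (simp add: add_ac)
next
  case (run_Cond g ts a b n S)
  have "outcome ((if g (scanned ts) then a else b) # k, ts) (n + N) (\<Union>(F ` S))"
    by (rule run_Cond.IH) (use run_Cond in auto)
  then show ?case
    using outcome_silent[of "Cond g a b # k" ts "(if g (scanned ts) then a else b) # k"] by simp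
next
  case (run_While_False g ts a)
  have "outcome (k, ts) N (F ts)" using run_While_False by simp
  then show ?case
    using outcome_silent[of "While g a # k" ts k] run_While_False by simp
next
  case (run_While_True g ts a n S m S')
  have "outcome (a # While g a # k, ts) (n + (m + N)) (\<Union>ts'\<in>S. \<Union>ts''\<in>S' ts'. F ts'')"
    by (rule run_While_True.IH(1), rule run_While_True.IH(2)) (use run_While_True.prems in blast)+
  then have "outcome (While g a # k, ts) (Suc (n + (m + N))) (\<Union>ts'\<in>S. \<Union>ts''\<in>S' ts'. F ts'')"
    by (intro outcome_silent[where k' = "a # While g a # k"]) (use run_While_True in auto)
  then show ?case by (simp add: add_ac)
next
  case (run_mono a ts n S m)
  then show ?case by (meson add_le_mono1 outcome_mono)
qed

corollary run_sound: "run c ts n S \<Longrightarrow> outcome ([c], ts) n S"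
  using run_outcome[of c ts n S "[]" 0 "\<lambda>ts. {ts}"] outcome_done by simp

section \<open>Compilation to Turing machines\<close>

text \<open>Besides the symbols in \<open>A\<close>, scanned symbols may be written. This makes the notion monotone in \<open>A\<close>, so the
primitives of a program, each with finite sets of its own, have a common alphabet and a common set of tapes
(\<open>finitary_confined\<close>).\<close>

definition bounded_prim :: "symbol set \<Rightarrow> tape_name set \<Rightarrow> (scan \<Rightarrow> update set) \<Rightarrow> bool" where
  "bounded_prim A X r \<longleftrightarrow>
     (\<forall>s. \<forall>u \<in> r s. dom u \<subseteq> X \<and> (\<forall>i b m. u i = Some (b, m) \<longrightarrow> b \<in> A \<union> range s))"

fun confined :: "symbol set \<Rightarrow> tape_name set \<Rightarrow> com \<Rightarrow> bool" where
  "confined A X (Prim r) = bounded_prim A X r"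
| "confined A X (Seq a b) = (confined A X a \<and> confined A X b)"
| "confined A X (Cond g a b) = (confined A X a \<and> confined A X b)"
| "confined A X (While g a) = confined A X a"

fun finitary :: "com \<Rightarrow> bool" where
  "finitary (Prim r) = (\<exists>A X. finite A \<and> finite X \<and> bounded_prim A X r)"
| "finitary (Seq a b) = (finitary a \<and> finitary b)"
| "finitary (Cond g a b) = (finitary a \<and> finitary b)"
| "finitary (While g a) = finitary a"

fun det :: "com \<Rightarrow> bool" where
  "det (Prim r) = (\<forall>s. \<forall>u \<in> r s. \<forall>v \<in> r s. u = v)"
| "det (Seq a b) = (det a \<and> det b)"
| "det (Cond g a b) = (det a \<and> det b)"
| "det (While g a) = det a"

lemma confined_mono: "confined A X c \<Longrightarrow> A \<subseteq> A' \<Longrightarrow> X \<subseteq> X' \<Longrightarrow> confined A' X' c"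
proof (induction c)
  case (Prim r)
  then have "bounded_prim A X r" by simp
  with Prim(2,3) have "bounded_prim A' X' r"
    unfolding bounded_prim_def by (meson Un_mono order_refl subset_iff)
  then show ?case by simp
qed auto

lemma finitary_confined: "finitary c \<Longrightarrow> \<exists>A X. finite A \<and> finite X \<and> confined A X c"
proof (induction c)
  have two: "\<exists>A X. finite A \<and> finite X \<and> confined A X a \<and> confined A X b"
    if "\<exists>A X. finite A \<and> finite X \<and> confined A X a" "\<exists>A X. finite A \<and> finite X \<and> confined A X b" for a b
  proof -
    from that obtain A X A' X' where
      "finite A" "finite X" "confined A X a" "finite A'" "finite X'" "confined A' X' b" by auto
    then show ?thesis
      by (intro exI[of _ "A \<union> A'"] exI[of _ "X \<union> X'"]) (auto elim: confined_mono)
  qed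
  { case (Seq a b) then show ?case using two by simp
  next
    case (Cond g a b) then show ?case using two by simp }
qed auto

text \<open>The stacks that occur while \<open>c\<close> is executed on top of \<open>k\<close>, before \<open>k\<close> itself is reached. There are finitely many,
because a loop puts itself back on the stack unchanged; they become the states of the machine.\<close>

fun residuals :: "com \<Rightarrow> com list \<Rightarrow> com list set" where
  "residuals (Prim r) k = {Prim r # k}"
| "residuals (Seq a b) k = insert (Seq a b # k) (residuals a (b # k) \<union> residuals b k)"
| "residuals (Cond g a b) k = insert (Cond g a b # k) (residuals a k \<union> residuals b k)"
| "residuals (While g a) k = insert (While g a # k) (residuals a (While g a # k))"

lemma finite_residuals [simp]: "finite (residuals c k)"
  by (induction c arbitrary: k) auto

lemma residuals_self [simp]: "c # k \<in> residuals c k"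
  by (cases c) auto

lemma residuals_step:
  "k' \<in> residuals c k \<Longrightarrow> (u, k'') \<in> next_stacks k' s \<Longrightarrow> k'' \<in> insert k (residuals c k)"
proof (induction c arbitrary: k)
  case (Seq a b)
  then show ?case by (auto split: if_splits dest!: Seq.IH)
next
  case (Cond g a b)
  then show ?case by (auto split: if_splits dest!: Cond.IH)
next
  case (While g a)
  then show ?case by (auto split: if_splits dest!: While.IH)
qed auto

lemma confined_residuals:
  "confined A X c \<Longrightarrow> list_all (confined A X) k \<Longrightarrow> k' \<in> residuals c k \<Longrightarrow> list_all (confined A X) k'"
proof (induction c arbitrary: k)
  case (Seq a b)
  then show ?case using Seq.IH(1)[of "b # k"] Seq.IH(2)[of k] by auto
next
  case (Cond g a b)
  then show ?case using Cond.IH(1)[of k] Cond.IH(2)[of k] by auto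
next
  case (While g a)
  then show ?case using While.IH[of "While g a # k"] by auto
qed auto

lemma det_residuals:
  "det c \<Longrightarrow> list_all det k \<Longrightarrow> k' \<in> residuals c k \<Longrightarrow> list_all (det) k'"
proof (induction c arbitrary: k)
  case (Seq a b)
  then show ?case using Seq.IH(1)[of "b # k"] Seq.IH(2)[of k] by auto
next
  case (Cond g a b)
  then show ?case using Cond.IH(1)[of k] Cond.IH(2)[of k] by auto
next
  case (While g a)
  then show ?case using While.IH[of "While g a # k"] by auto
qed auto

lemma confined_next_stacks:
  assumes "list_all (confined A X) k" "(u, k') \<in> next_stacks k s"
  shows "dom u \<subseteq> X" "u i = Some (b, m) \<Longrightarrow> b \<in> A \<union> range s"
  using assms by (cases k; cases "hd k"; fastforce simp: bounded_prim_def)+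

lemma det_next_stacks:
  assumes "list_all det k" "(u, k') \<in> next_stacks k s" "(v, k'') \<in> next_stacks k s"
  shows "u = v \<and> k' = k''"
  using assms by (cases k; cases "hd k"; fastforce)

definition input :: "str \<Rightarrow> store" where
  "input x = (\<lambda>_ _. Blank)(Var 0 := string_tape x)"

text \<open>The parameter \<open>e\<close> numbers the residual stacks, \<open>A\<close> is the tape alphabet, and \<open>xs\<close> enumerates the tapes, the
input tape first.\<close>

locale assembly =
  fixes e :: "com list \<Rightarrow> nat" and A :: "symbol set" and xs :: "tape_name list" and c :: com
  assumes inj_e: "inj_on e (insert [] (residuals c []))"
    and finite_A: "finite A"
    and Blank_A: "Blank \<in> A"
    and Bit_A: "Bit b \<in> A"
    and distinct_xs: "distinct xs"
    and xs: "xs \<noteq> []" "hd xs = Var 0"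
    and confined_c: "confined A (set xs) c"
begin

text \<open>Tapes outside \<open>xs\<close> stay blank, so a scan is determined by what the machine sees of it (\<open>valid_scan_eqI\<close>). Hence a
table with rows for the valid scans only is complete, and it is deterministic if the program is.\<close>

definition valid_scan :: "scan set" where
  "valid_scan = {s. (\<forall>i. s i \<in> A) \<and> (\<forall>i. i \<notin> set xs \<longrightarrow> s i = Blank)}"

definition row :: "scan \<Rightarrow> update \<Rightarrow> action list" where
  "row s u = map (\<lambda>i. (s i, case u i of None \<Rightarrow> (s i, Stay) | Some a \<Rightarrow> a)) xs"

definition machine :: "nat tm" where
  "machine = \<lparr>tapes = length xs, start = e [c], accepting = {e []},
     transitions = {(e k, row s u, e k') | k s u k'.
       k \<in> residuals c [] \<and> s \<in> valid_scan \<and> (u, k') \<in> next_stacks k s}\<rparr>"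

definition tm_config :: "com list \<times> store \<Rightarrow> nat config" where
  "tm_config = (\<lambda>(k, ts). (e k, map ts xs))"

definition well_formed :: "(com list \<times> store) set" where
  "well_formed = {(k, ts). k \<in> insert [] (residuals c []) \<and> (\<forall>i j. ts i j \<in> A) \<and>
     (\<forall>i. i \<notin> set xs \<longrightarrow> ts i = (\<lambda>_. Blank))}"

lemma well_formed_valid_scan: "(k, ts) \<in> well_formed \<Longrightarrow> scanned ts \<in> valid_scan"
  by (auto simp: well_formed_def valid_scan_def)

lemma valid_scan_eqI:
  assumes "s \<in> valid_scan" "s' \<in> valid_scan" "map s xs = map s' xs" shows "s = s'"
proof
  fix i show "s i = s' i"
    using assms by (cases "i \<in> set xs") (auto simp: valid_scan_def)
qed

lemma map_fst_row [simp]: "map fst (row s u) = map s xs"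
  by (simp add: row_def)

lemma confined_residual: "k \<in> residuals c [] \<Longrightarrow> list_all (confined A (set xs)) k"
  using confined_residuals[OF confined_c, of "[]"] by simp

lemma next_update:
  assumes "k \<in> residuals c []" "(u, k') \<in> next_stacks k s"
  shows "dom u \<subseteq> set xs" "u i = Some (b, m) \<Longrightarrow> b \<in> A \<union> range s"
  using confined_next_stacks[OF confined_residual[OF assms(1)] assms(2)] by auto

lemma next_residual:
  assumes "k \<in> insert [] (residuals c [])" "(u, k') \<in> next_stacks k s"
  shows "k \<in> residuals c []" "k' \<in> insert [] (residuals c [])"
  using assms residuals_step[of k c "[]"] by auto

lemma put_in: "(\<And>j. t j \<in> A) \<Longrightarrow> b \<in> A \<Longrightarrow> put (b, m) t j \<in> A"
  by (cases m) (auto simp: put_def move_head_def)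

lemma stack_step_well_formed:
  assumes "x \<in> well_formed" "(x, y) \<in> stack_step" shows "y \<in> well_formed"
proof -
  from assms(2) obtain k ts u k' where
    xy: "x = (k, ts)" "y = (k', upd u ts)" and n: "(u, k') \<in> next_stacks k (scanned ts)"
    by (auto simp: stack_step_def)
  from assms(1) xy have g: "k \<in> insert [] (residuals c [])" "\<And>i j. ts i j \<in> A"
    "\<And>i. i \<notin> set xs \<Longrightarrow> ts i = (\<lambda>_. Blank)" by (auto simp: well_formed_def)
  note r = next_residual[OF g(1) n]
  note u = next_update[OF r(1) n]
  have "upd u ts i j \<in> A" for i j
  proof (cases "u i")
    case (Some a)
    obtain b m where "a = (b, m)" by force
    moreover have "b \<in> A" using u(2)[of i b m] Some \<open>a = (b, m)\<close> g(2) by auto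
    ultimately show ?thesis using Some g(2) by (simp add: upd_def put_in)
  qed (use g(2) in \<open>simp add: upd_def\<close>)
  moreover have "upd u ts i = (\<lambda>_. Blank)" if "i \<notin> set xs" for i
    using u(1) that g(3) by (auto simp: upd_def split: option.split)
  ultimately show ?thesis using r xy by (simp add: well_formed_def)
qed

lemma map2_act_row: "map2 act (row (scanned ts) u) (map ts xs) = map (upd u ts) xs"
proof -
  have "map2 act (row (scanned ts) u) (map ts xs) =
      map (\<lambda>i. act (ts i 0, case u i of None \<Rightarrow> (ts i 0, Stay) | Some a \<Rightarrow> a) (ts i)) xs"
    by (simp add: row_def zip_map_map zip_same_conv_map case_prod_unfold comp_def cong: option.case_cong)
  also have "\<dots> = map (upd u ts) xs"
    by (rule map_cong) (auto simp: upd_def act_put move_head_def split: option.split)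
  finally show ?thesis .
qed

text \<open>The map \<open>tm_config\<close> is a bisimulation between stack configurations and configurations of the machine.\<close>

lemma steps_machine:
  assumes "x \<in> well_formed"
  shows "(tm_config x, y) \<in> steps machine \<longleftrightarrow> (\<exists>x'. (x, x') \<in> stack_step \<and> y = tm_config x')"
proof -
  obtain k ts where x: "x = (k, ts)" by force
  note v = well_formed_valid_scan[OF assms[unfolded x]]
  have k: "k \<in> insert [] (residuals c [])" using assms x by (simp add: well_formed_def)
  show ?thesis
  proof
    assume "(tm_config x, y) \<in> steps machine"
    then obtain q' as where t: "(e k, as, q') \<in> transitions machine"
      and as: "map fst as = map (\<lambda>t. t 0) (map ts xs)" and y: "y = (q', map2 act as (map ts xs))"
      by (auto simp: steps_def tm_config_def x)
    from t obtain k1 s u k' where k1: "e k = e k1" "k1 \<in> residuals c []" and s: "s \<in> valid_scan"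
      and n: "(u, k') \<in> next_stacks k1 s" and eq: "as = row s u" "q' = e k'"
      by (auto simp: machine_def)
    have "k1 = k" using inj_e k k1 by (auto dest: inj_onD)
    moreover have "s = scanned ts"
      using as eq s v by (intro valid_scan_eqI) (auto simp: comp_def)
    ultimately show "\<exists>x'. (x, x') \<in> stack_step \<and> y = tm_config x'"
      using n y eq x by (auto simp: stack_step_def tm_config_def map2_act_row)
  next
    assume "\<exists>x'. (x, x') \<in> stack_step \<and> y = tm_config x'"
    then obtain u k' where n: "(u, k') \<in> next_stacks k (scanned ts)" and y: "y = tm_config (k', upd u ts)"
      by (auto simp: x stack_step_def)
    have "(e k, row (scanned ts) u, e k') \<in> transitions machine"
      using next_residual[OF k n] v n by (auto simp: machine_def)
    moreover have "map fst (row (scanned ts) u) = map (\<lambda>t. t 0) (map ts xs)"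
      by (simp add: comp_def)
    ultimately have "((e k, map ts xs), (e k', map2 act (row (scanned ts) u) (map ts xs))) \<in> steps machine"
      unfolding steps_def by blast
    then show "(tm_config x, y) \<in> steps machine"
      by (simp add: tm_config_def x y map2_act_row)
  qed
qed

lemma input_well_formed: "([c], input x) \<in> well_formed"
  using xs Blank_A Bit_A hd_in_set[OF xs(1)]
  by (auto simp: well_formed_def input_def string_tape_def)

lemma initial_machine: "initial machine x = tm_config ([c], input x)"
proof -
  obtain ys where ys: "xs = Var 0 # ys" using xs by (cases xs) auto
  then have "Var 0 \<notin> set ys" using distinct_xs by simp
  then have "map (input x) ys = map (\<lambda>_ _. Blank) ys"
    by (intro map_cong) (auto simp: input_def)
  then have "string_tape x # replicate (length xs - 1) (\<lambda>_. Blank) = map (input x) xs"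
    by (simp add: ys input_def map_replicate_const)
  then show ?thesis
    by (simp add: initial_def tm_config_def machine_def)
qed

lemma reachable_well_formed: "(([c], input x), z) \<in> stack_step ^^ n \<Longrightarrow> z \<in> well_formed"
proof (induction n arbitrary: z)
  case (Suc n)
  then obtain y where "(([c], input x), y) \<in> stack_step ^^ n" "(y, z) \<in> stack_step" by auto
  with Suc.IH stack_step_well_formed show ?case by blast
qed (use input_well_formed in auto)

lemma relpow_machine:
  "(initial machine x, y) \<in> steps machine ^^ n \<longleftrightarrow>
    (\<exists>x' \<in> well_formed. (([c], input x), x') \<in> stack_step ^^ n \<and> y = tm_config x')"
proof (induction n arbitrary: y)
  case 0
  show ?case using input_well_formed by (auto simp: initial_machine)
next
  case (Suc n)
  show ?case
  proof
    assume "(initial machine x, y) \<in> steps machine ^^ Suc n"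
    then obtain z where z: "(initial machine x, z) \<in> steps machine ^^ n" "(z, y) \<in> steps machine"
      by auto
    with Suc.IH obtain x' where x': "x' \<in> well_formed" "(([c], input x), x') \<in> stack_step ^^ n" "z = tm_config x'"
      by auto
    with z(2) steps_machine obtain x'' where "(x', x'') \<in> stack_step" "y = tm_config x''" by blast
    moreover have "x'' \<in> well_formed" using stack_step_well_formed x'(1) \<open>(x', x'') \<in> stack_step\<close> by blast
    moreover have "(([c], input x), x'') \<in> stack_step ^^ Suc n"
      using x'(2) \<open>(x', x'') \<in> stack_step\<close> by (rule relpow_Suc_I)
    ultimately show "\<exists>x' \<in> well_formed. (([c], input x), x') \<in> stack_step ^^ Suc n \<and> y = tm_config x'"
      by blast
  next
    assume "\<exists>x' \<in> well_formed. (([c], input x), x') \<in> stack_step ^^ Suc n \<and> y = tm_config x'"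
    then obtain x' z where z: "(([c], input x), z) \<in> stack_step ^^ n" "(z, x') \<in> stack_step"
      and y: "y = tm_config x'" by auto
    have "z \<in> well_formed" using reachable_well_formed[OF z(1)] .
    with z have "(initial machine x, tm_config z) \<in> steps machine ^^ n" using Suc.IH by blast
    moreover have "(tm_config z, y) \<in> steps machine"
      using steps_machine[OF \<open>z \<in> well_formed\<close>] z(2) y by blast
    ultimately show "(initial machine x, y) \<in> steps machine ^^ Suc n" by (rule relpow_Suc_I)
  qed
qed

lemma finite_row: "finite {row s u | k s u k'. k \<in> residuals c [] \<and> s \<in> valid_scan \<and> (u, k') \<in> next_stacks k s}"
proof (rule finite_subset)
  let ?B = "A \<times> A \<times> {MoveLeft, Stay, MoveRight}"
  show "finite {as. set as \<subseteq> ?B \<and> length as = length xs}"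
    using finite_A by (intro finite_lists_length_eq) auto
  show "{row s u | k s u k'. k \<in> residuals c [] \<and> s \<in> valid_scan \<and> (u, k') \<in> next_stacks k s}
      \<subseteq> {as. set as \<subseteq> ?B \<and> length as = length xs}"
  proof (clarsimp simp: row_def)
    fix k s u k' i
    assume a: "k \<in> residuals c []" "s \<in> valid_scan" "(u, k') \<in> next_stacks k s"
    then have s: "s j \<in> A" for j by (simp add: valid_scan_def)
    show "s i \<in> A \<and> (case u i of None \<Rightarrow> (s i, Stay) | Some a \<Rightarrow> a) \<in> A \<times> {MoveLeft, Stay, MoveRight}"
    proof (cases "u i")
      case (Some a')
      obtain b m where "a' = (b, m)" by force
      moreover have "b \<in> A" using next_update(2)[OF a(1,3), of i b m] Some \<open>a' = (b, m)\<close> s by auto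
      moreover have "m \<in> {MoveLeft, Stay, MoveRight}" by (cases m) auto
      ultimately show ?thesis using Some s by simp
    qed (use s in simp)
  qed
qed

lemma turing_machine_machine: "turing_machine machine"
proof -
  let ?T = "{row s u | k s u k'. k \<in> residuals c [] \<and> s \<in> valid_scan \<and> (u, k') \<in> next_stacks k s}"
  let ?E = "e ` insert [] (residuals c [])"
  have "transitions machine \<subseteq> ?E \<times> ?T \<times> ?E"
    using next_residual by (fastforce simp: machine_def)
  moreover have "finite (?E \<times> ?T \<times> ?E)" using finite_row by simp
  ultimately have "finite (transitions machine)" by (rule finite_subset)
  then show ?thesis
    using xs by (auto simp: turing_machine_def machine_def row_def Suc_le_eq)
qed

lemma deterministic_machine: "det c \<Longrightarrow> deterministic machine"
  unfolding deterministic_def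
proof (clarify)
  assume det: "det c"
  fix q as1 r1 as2 r2
  assume "(q, as1, r1) \<in> transitions machine" "(q, as2, r2) \<in> transitions machine"
    and eq: "map fst as1 = map fst as2"
  then obtain k1 s1 u1 k1' k2 s2 u2 k2' where
    k: "e k1 = e k2" "k1 \<in> residuals c []" "k2 \<in> residuals c []" and s: "s1 \<in> valid_scan" "s2 \<in> valid_scan"
    and n: "(u1, k1') \<in> next_stacks k1 s1" "(u2, k2') \<in> next_stacks k2 s2"
    and as: "as1 = row s1 u1" "as2 = row s2 u2" "r1 = e k1'" "r2 = e k2'"
    by (auto simp: machine_def)
  have "k1 = k2" using k inj_e by (auto dest: inj_onD)
  moreover have "s1 = s2" using valid_scan_eqI s eq as by simp
  moreover have "list_all det k1" using det_residuals[OF det, of "[]"] k by simp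
  ultimately show "as1 = as2 \<and> r1 = r2"
    using det_next_stacks[of k1 u1 k1' s1 u2 k2'] n as by simp
qed

lemma halting_machine:
  assumes "x \<in> well_formed"
  shows "halting machine (tm_config x) \<and> fst (tm_config x) \<in> accepting machine \<longleftrightarrow> fst x = []"
proof -
  obtain k ts where x: "x = (k, ts)" by force
  have k: "k \<in> insert [] (residuals c [])" using assms x by (simp add: well_formed_def)
  have "e k = e [] \<longleftrightarrow> k = []" using inj_onD[OF inj_e, of k "[]"] k by auto
  moreover have "halting machine (tm_config ([], ts))" if "k = []"
    using steps_machine[OF assms] that x by (auto simp: halting_def stack_step_def)
  ultimately show ?thesis by (auto simp: x tm_config_def machine_def)
qed

lemma accepting_result_machine:
  "accepting_result machine x y \<longleftrightarrow>
    (\<exists>ts. (([c], input x), ([], ts)) \<in> stack_step\<^sup>* \<and> y = tm_config ([], ts))" (is "?l \<longleftrightarrow> ?r")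
proof
  assume ?l
  then obtain n where "(initial machine x, y) \<in> steps machine ^^ n" and
    h: "halting machine y" "fst y \<in> accepting machine"
    by (auto simp: accepting_result_def rtrancl_is_UN_relpow)
  then obtain x' where x': "x' \<in> well_formed" "(([c], input x), x') \<in> stack_step ^^ n" "y = tm_config x'"
    by (auto simp: relpow_machine)
  then have "fst x' = []" using halting_machine[OF x'(1)] h by blast
  with x' show ?r by (cases x') (auto dest: relpow_imp_rtrancl)
next
  assume ?r
  then obtain ts n where n: "(([c], input x), ([], ts)) \<in> stack_step ^^ n" "y = tm_config ([], ts)"
    by (auto dest: rtrancl_imp_relpow)
  have g: "([], ts) \<in> well_formed" using reachable_well_formed[OF n(1)] .
  with n relpow_machine have "(initial machine x, y) \<in> steps machine ^^ n" by blast
  with halting_machine[OF g] n show ?l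
    by (auto simp: accepting_result_def dest: relpow_imp_rtrancl)
qed

lemma machine_outcome:
  assumes "outcome ([c], input x) n S"
  shows "(initial machine x, y) \<in> steps machine ^^ m \<Longrightarrow> m \<le> n"
    and "x \<in> language machine \<longleftrightarrow> S \<noteq> {}"
    and "outputs machine x w \<longleftrightarrow> (\<exists>ts \<in> S. ts (Var 0) = string_tape w)"
proof -
  have S: "S = {ts. (([c], input x), ([], ts)) \<in> stack_step\<^sup>*}"
    and n: "\<And>m c'. (([c], input x), c') \<in> stack_step ^^ m \<Longrightarrow> m \<le> n"
    using assms by (auto simp: outcome_def)
  show "(initial machine x, y) \<in> steps machine ^^ m \<Longrightarrow> m \<le> n"
    using n by (auto simp: relpow_machine)
  show "x \<in> language machine \<longleftrightarrow> S \<noteq> {}"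
    by (auto simp: language_def accepting_result_machine S simp del: split_paired_Ex)
  have "hd (snd (tm_config ([], ts))) = ts (Var 0)" for ts
    using xs by (simp add: tm_config_def hd_map)
  then show "outputs machine x w \<longleftrightarrow> (\<exists>ts \<in> S. ts (Var 0) = string_tape w)"
    by (auto simp: outputs_def accepting_result_machine S simp del: split_paired_Ex)
qed

end

text \<open>The final stores of the program are the accepting configurations of the machine: the empty stack is the only
accepting state, it has no successor, and a blocked execution halts in another state.\<close>

theorem compile:
  assumes "finitary c" and run: "\<And>x. run c (input x) (T (length x)) (S x)" and "poly_bounded T"
  obtains M where "M \<in> NTM_poly" "det c \<Longrightarrow> M \<in> DTM_poly" "language M = {x. S x \<noteq> {}}"
    "\<And>x y. outputs M x y \<longleftrightarrow> (\<exists>ts \<in> S x. ts (Var 0) = string_tape y)"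
proof -
  obtain A X where fin: "finite A" "finite X" and confined: "confined A X c"
    using finitary_confined[OF assms(1)] by auto
  obtain ys where ys: "set ys = X - {Var 0}" "distinct ys"
    using finite_distinct_list[of "X - {Var 0}"] fin by auto
  have "finite (insert [] (residuals c []))" by simp
  then obtain e :: "com list \<Rightarrow> nat" where e: "inj_on e (insert [] (residuals c []))"
    using finite_imp_inj_to_nat_seg by meson
  interpret assembly e "A \<union> {Blank, Bit True, Bit False}" "Var 0 # ys" c
  proof
    show "Bit b \<in> A \<union> {Blank, Bit True, Bit False}" for b by (cases b) auto
    show "confined (A \<union> {Blank, Bit True, Bit False}) (set (Var 0 # ys)) c"
      using confined by (rule confined_mono) (use ys in auto)
  qed (use e fin ys in auto)
  note out = machine_outcome[OF run_sound[OF run]]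
  from \<open>poly_bounded T\<close> obtain p :: "nat poly" where p: "\<And>n. T n \<le> poly p n"
    by (auto simp: poly_bounded_def)
  have "polynomial_time machine"
    unfolding polynomial_time_def using out(1) p by (meson order_trans)
  then have "machine \<in> NTM_poly" using turing_machine_machine by (simp add: NTM_poly_def)
  moreover from this have "det c \<Longrightarrow> machine \<in> DTM_poly"
    using deterministic_machine by (simp add: DTM_poly_def)
  moreover have "language machine = {x. S x \<noteq> {}}" using out(2) by auto
  ultimately show ?thesis using out(3) by (intro that)
qed

lemma compile_acceptor:
  assumes "finitary c" "poly_bounded T"
    and ex: "\<And>x. \<exists>S. run c (input x) (T (length x)) S \<and> (S \<noteq> {} \<longleftrightarrow> x \<in> L)"
  obtains M where "M \<in> NTM_poly" "det c \<Longrightarrow> M \<in> DTM_poly" "language M = L"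
proof -
  define S where "S x = (SOME S. run c (input x) (T (length x)) S \<and> (S \<noteq> {} \<longleftrightarrow> x \<in> L))" for x
  have S: "run c (input x) (T (length x)) (S x) \<and> (S x \<noteq> {} \<longleftrightarrow> x \<in> L)" for x
    unfolding S_def by (rule someI_ex[OF ex])
  show ?thesis
  proof (rule compile[OF assms(1) conjunct1[OF S] assms(2)])
    fix M
    assume M: "M \<in> NTM_poly" "det c \<Longrightarrow> M \<in> DTM_poly" "language M = {x. S x \<noteq> {}}"
    have "language M = L" unfolding M(3) using S by simp
    with M(1,2) that show ?thesis by simp
  qed
qed

lemma compile_function:
  assumes "finitary c" "det c" "poly_bounded T"
    and undefined: "\<And>x. f x = None \<Longrightarrow> run c (input x) (T (length x)) {}"
    and defined: "\<And>x y. f x = Some y \<Longrightarrow> \<exists>ts. ts (Var 0) = string_tape y \<and> run c (input x) (T (length x)) {ts}"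
  shows "\<exists>M \<in> DTM_poly. computes M f"
proof -
  define S where "S x = (case f x of None \<Rightarrow> {} | Some y \<Rightarrow>
    {SOME ts. ts (Var 0) = string_tape y \<and> run c (input x) (T (length x)) {ts}})" for x
  have S_Some: "\<exists>ts. S x = {ts} \<and> ts (Var 0) = string_tape y \<and> run c (input x) (T (length x)) {ts}"
    if "f x = Some y" for x y
    using someI_ex[OF defined[OF that]] that by (simp add: S_def)
  have S_None: "S x = {}" if "f x = None" for x using that by (simp add: S_def)
  have run: "run c (input x) (T (length x)) (S x)" for x
    using undefined[of x] S_None[of x] S_Some[of x] by (cases "f x") auto
  show ?thesis
  proof (rule compile[OF assms(1) run assms(3)])
    fix M
    assume M: "det c \<Longrightarrow> M \<in> DTM_poly" "language M = {x. S x \<noteq> {}}"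
      "\<And>x y. outputs M x y \<longleftrightarrow> (\<exists>ts \<in> S x. ts (Var 0) = string_tape y)"
    have "S x \<noteq> {} \<longleftrightarrow> f x \<noteq> None" for x
      using S_None[of x] S_Some[of x] by (cases "f x") auto
    then have "language M = dom f" unfolding M(2) dom_def by simp
    moreover have "outputs M x y" if "f x = Some y" for x y
      unfolding M(3) using S_Some[OF that] by auto
    ultimately have "computes M f" by (simp add: computes_def)
    with M(1)[OF assms(2)] show ?thesis by (rule bexI[rotated])
  qed
qed

section \<open>Tapes as zippers\<close>

text \<open>The list \<open>l\<close> holds the symbols to the left of the head, nearest first, and \<open>r\<close> those from the scanned cell onwards;
everything beyond is blank. Blanks at the far end of either list do not matter, which lets tapes that were erased
while being read return to the form \<open>zip_tape [] v\<close>.\<close>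

definition zip_tape :: "symbol list \<Rightarrow> symbol list \<Rightarrow> tape" where
  "zip_tape l r = (\<lambda>i. if 0 \<le> i then nth_default Blank r (nat i) else nth_default Blank l (nat (- i - 1)))"

lemma zip_tape_scan [simp]: "zip_tape l [] 0 = Blank" "zip_tape l (a # r) 0 = a"
  by (auto simp: zip_tape_def)

lemma zip_tape_Nil: "zip_tape [] [] = (\<lambda>_. Blank)"
  by (auto simp: zip_tape_def)

lemma zip_tape_Blank [simp]: "zip_tape [Blank] r = zip_tape [] r" "zip_tape l [Blank] = zip_tape l []"
  by (auto simp: zip_tape_def nth_default_Cons split: nat.split)

lemma zip_tape_snoc_Blank: "zip_tape l (r @ [Blank]) = zip_tape l r"
  by (rule ext) (auto simp: zip_tape_def nth_default_append nth_default_def)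

lemma string_tape_zip: "string_tape w = zip_tape [] (map Bit w)"
  by (rule ext) (auto simp: string_tape_def zip_tape_def nth_default_def)

lemma put_Stay [simp]: "put (b, Stay) (zip_tape l r) = zip_tape l (b # tl r)"
  by (rule ext, cases r)
    (auto simp: put_def move_head_def zip_tape_def nth_default_Cons split: nat.split)

text \<open>Symbols written by a rightward move become the nearest symbols on the left, so a program that reads a
string from left to right turns \<open>zip_tape l v\<close> into \<open>zip_tape (rev v @ l) []\<close>.\<close>

lemma put_Right [simp]: "put (b, MoveRight) (zip_tape l r) = zip_tape (b # l) (tl r)"
proof
  fix i :: int
  consider "i \<ge> 0" | "i = -1" | "i < -1" by linarith
  then show "put (b, MoveRight) (zip_tape l r) i = zip_tape (b # l) (tl r) i"
  proof cases
    case 1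
    then have "nat (i + 1) = Suc (nat i)" by simp
    then show ?thesis using 1
      by (cases r) (simp_all add: put_def move_head_def zip_tape_def)
  next
    case 3
    then have "nat (- i - 1) = Suc (nat (- (i + 1) - 1))" by simp
    then show ?thesis using 3
      by (simp add: put_def move_head_def zip_tape_def)
  qed (simp add: put_def move_head_def zip_tape_def)
qed

lemma put_Left_Cons [simp]: "put (b, MoveLeft) (zip_tape (a # l) r) = zip_tape l (a # b # tl r)"
proof
  fix i :: int
  consider "i < 0" | "i = 0" | "i = 1" | "i > 1" by linarith
  then show "put (b, MoveLeft) (zip_tape (a # l) r) i = zip_tape l (a # b # tl r) i"
  proof cases
    case 1
    then have "nat (- (i - 1) - 1) = Suc (nat (- i - 1))" by simp
    then show ?thesis using 1
      by (simp add: put_def move_head_def zip_tape_def)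
  next
    case 4
    then have "nat i = Suc (Suc (nat (i - 2)))" "nat (i - 1) = Suc (nat (i - 2))" by simp_all
    then show ?thesis using 4
      by (cases r) (simp_all add: put_def move_head_def zip_tape_def)
  qed (simp_all add: put_def move_head_def zip_tape_def)
qed

lemma put_Left_Nil [simp]: "put (b, MoveLeft) (zip_tape [] r) = zip_tape [] (Blank # b # tl r)"
  using put_Left_Cons[of b Blank "[]" r] by simp

lemma move_head_zip:
  "move_head MoveRight (zip_tape l (a # r)) = zip_tape (a # l) r"
  "move_head MoveLeft (zip_tape (a # l) r) = zip_tape l (a # r)"
  "move_head Stay t = t"
proof -
  show "move_head MoveRight (zip_tape l (a # r)) = zip_tape (a # l) r"
    using put_scanned[of "zip_tape l (a # r)" MoveRight] by simp
  show "move_head MoveLeft (zip_tape (a # l) r) = zip_tape l (a # r)"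
    using put_scanned[of "zip_tape (a # l) r" MoveLeft] zip_tape_snoc_Blank[of l "[a]"]
    by (cases r) simp_all
qed (simp add: move_head_def)

lemma move_Right_power: "(move_head MoveRight ^^ n) t = (\<lambda>i. t (i + int n))"
  by (induction n arbitrary: t) (auto simp: move_head_def funpow_swap1 algebra_simps)

lemma move_Left_power: "(move_head MoveLeft ^^ n) t = (\<lambda>i. t (i - int n))"
  by (induction n arbitrary: t) (auto simp: move_head_def funpow_swap1 algebra_simps)

lemma move_Right_zip: "(move_head MoveRight ^^ length v) (zip_tape l (v @ r)) = zip_tape (rev v @ l) r"
  by (induction v arbitrary: l) (auto simp: funpow_swap1 move_head_zip)

lemma move_Left_zip: "(move_head MoveLeft ^^ length v) (zip_tape (v @ l) r) = zip_tape l (rev v @ r)"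
  by (induction v arbitrary: r) (auto simp: funpow_swap1 move_head_zip)

section \<open>Elementary programs\<close>

text \<open>The rules of \<open>run\<close> are used mostly for steps with a single outcome, where no family of sets has to be guessed.\<close>

lemma run_then: "run a ts n {ts'} \<Longrightarrow> run b ts' m S \<Longrightarrow> run (Seq a b) ts (n + m + 1) S"
  using run_Seq[of a ts n "{ts'}" b m "\<lambda>_. S"] by simp

lemma run_result: "run a ts n {ts'} \<Longrightarrow> ts' = ts'' \<Longrightarrow> run a ts n {ts''}"
  by simp

lemma run_stuck: "run a ts n {} \<Longrightarrow> run (Seq a b) ts (n + m + 1) {}"
  using run_Seq[of a ts n "{}" b m "\<lambda>_. {}"] by simp

lemma run_loop:
  "g (scanned ts) \<Longrightarrow> run a ts n {ts'} \<Longrightarrow> run (While g a) ts' m S \<Longrightarrow> run (While g a) ts (n + m + 1) S"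
  using run_While_True[of g ts a n "{ts'}" m "\<lambda>_. S"] by simp

lemma run_loop_stuck: "g (scanned ts) \<Longrightarrow> run a ts n {} \<Longrightarrow> run (While g a) ts (n + m + 1) {}"
  using run_While_True[of g ts a n "{}" m "\<lambda>_. {}"] by simp

lemma run_exit: "\<not> g (scanned ts) \<Longrightarrow> run (While g a) ts (Suc n) {ts}"
  by (rule run_mono[OF run_While_False]) auto

lemma run_Prim_single: "r (scanned ts) = {u} \<Longrightarrow> ts' = upd u ts \<Longrightarrow> run (Prim r) ts 1 {ts'}"
  using run_Prim[of r ts] by simp

lemma run_Prim_stuck: "r (scanned ts) = {} \<Longrightarrow> run (Prim r) ts 1 {}"
  using run_Prim[of r ts] by simp

definition assertion :: "(scan \<Rightarrow> bool) \<Rightarrow> com" where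
  "assertion g = Prim (\<lambda>s. if g s then {Map.empty} else {})"

lemma run_assertion: "g (scanned ts) \<Longrightarrow> run (assertion g) ts 1 {ts}"
  unfolding assertion_def by (rule run_Prim_single) auto

lemma run_assertion_fails: "\<not> g (scanned ts) \<Longrightarrow> run (assertion g) ts 1 {}"
  unfolding assertion_def by (rule run_Prim_stuck) auto

lemma assertion_wf [simp]: "finitary (assertion g)" "det (assertion g)"
  by (auto simp: assertion_def bounded_prim_def)

definition local_step :: "tape_name set \<Rightarrow> (tape_name \<Rightarrow> symbol \<Rightarrow> symbol \<times> move) \<Rightarrow> com" where
  "local_step J f = Prim (\<lambda>s. {\<lambda>i. if i \<in> J then Some (f i (s i)) else None})"

lemma run_local_step: "run (local_step J f) ts 1 {override_on ts (\<lambda>i. put (f i (ts i 0)) (ts i)) J}"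
  unfolding local_step_def by (rule run_Prim_single) (auto simp: upd_def override_on_def)

lemma det_local_step [simp]: "det (local_step J f)"
  by (simp add: local_step_def)

lemma finitary_local_step:
  assumes "finite J" "finite A" "\<And>i a. fst (f i a) \<in> insert a A"
  shows "finitary (local_step J f)"
proof -
  have "bounded_prim A J (\<lambda>s. {\<lambda>i. if i \<in> J then Some (f i (s i)) else None})"
    unfolding bounded_prim_def
  proof (intro allI ballI conjI impI)
    fix s u i b m
    assume u: "u \<in> {\<lambda>i. if i \<in> J then Some (f i (s i)) else None}"
    then show "dom u \<subseteq> J" by (auto split: if_splits)
    assume "u i = Some (b, m)"
    with u have "fst (f i (s i)) = b" by (auto split: if_splits)
    with assms(3)[of i "s i"] show "b \<in> A \<union> range s" by auto
  qed
  then show ?thesis using assms by (auto simp: local_step_def)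
qed

definition shift :: "tape_name set \<Rightarrow> move \<Rightarrow> com" where
  "shift J m = local_step J (\<lambda>i a. (a, m))"

definition stamp :: "tape_name set \<Rightarrow> symbol \<Rightarrow> move \<Rightarrow> com" where
  "stamp J b m = local_step J (\<lambda>i a. (b, m))"

lemma run_shift: "run (shift J m) ts 1 {override_on ts (\<lambda>i. move_head m (ts i)) J}"
  using run_local_step[of J "\<lambda>i a. (a, m)" ts] by (simp add: shift_def)

lemma run_stamp: "run (stamp J b m) ts 1 {override_on ts (\<lambda>i. put (b, m) (ts i)) J}"
  using run_local_step[of J "\<lambda>i a. (b, m)" ts] by (simp add: stamp_def)

lemma shift_wf [simp]: "finite J \<Longrightarrow> finitary (shift J m)" "det (shift J m)"
  by (auto simp: shift_def intro: finitary_local_step[of _ "{}"])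

lemma stamp_wf [simp]: "finite J \<Longrightarrow> finitary (stamp J b m)" "det (stamp J b m)"
  by (auto simp: stamp_def intro: finitary_local_step[of _ "{b}"])

text \<open>All tapes in \<open>J\<close> undergo the same number of local changes, namely until the control tape \<open>c\<close> first scans a
blank. Closed forms for iterated moves then describe the result.\<close>

lemma run_sweep:
  assumes "c \<in> J" and "\<And>k. k < n \<Longrightarrow> ((\<lambda>t. put (f c (t 0)) t) ^^ k) (ts c) 0 \<noteq> Blank"
    and "((\<lambda>t. put (f c (t 0)) t) ^^ n) (ts c) 0 = Blank"
  shows "run (While (\<lambda>s. s c \<noteq> Blank) (local_step J f)) ts (2 * n + 1)
    {override_on ts (\<lambda>i. ((\<lambda>t. put (f i (t 0)) t) ^^ n) (ts i)) J}"
  using assms(2,3)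
proof (induction n arbitrary: ts)
  case 0
  then show ?case by (auto simp: override_on_def intro: run_exit)
next
  case (Suc n)
  let ?F = "\<lambda>i t. put (f i (t 0)) t"
  let ?ts = "override_on ts (\<lambda>i. ?F i (ts i)) J"
  have c: "?ts c = ?F c (ts c)" using \<open>c \<in> J\<close> by simp
  have "run (While (\<lambda>s. s c \<noteq> Blank) (local_step J f)) ?ts (2 * n + 1)
      {override_on ?ts (\<lambda>i. (?F i ^^ n) (?ts i)) J}"
  proof (rule Suc.IH)
    fix k assume "k < n"
    then show "(?F c ^^ k) (?ts c) 0 \<noteq> Blank"
      using Suc.prems(1)[of "Suc k"] by (simp add: c funpow_Suc_right del: funpow.simps)
  next
    show "(?F c ^^ n) (?ts c) 0 = Blank"
      using Suc.prems(2) by (simp add: c funpow_Suc_right del: funpow.simps)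
  qed
  moreover have "override_on ?ts (\<lambda>i. (?F i ^^ n) (?ts i)) J = override_on ts (\<lambda>i. (?F i ^^ Suc n) (ts i)) J"
    by (auto simp: override_on_def funpow_Suc_right simp del: funpow.simps)
  ultimately have "run (While (\<lambda>s. s c \<noteq> Blank) (local_step J f)) ?ts (2 * n + 1)
      {override_on ts (\<lambda>i. (?F i ^^ Suc n) (ts i)) J}" by simp
  from run_loop[OF _ run_local_step this] show ?case using Suc.prems(1)[of 0] by simp
qed

text \<open>The tapes in \<open>J\<close> carry the same string and move in parallel under the control of \<open>c\<close>. The head has to pass to the
blank in front of the string before it knows where the string begins.\<close>

definition rewind :: "tape_name \<Rightarrow> tape_name set \<Rightarrow> com" where
  "rewind c J = Seq (shift J MoveLeft)
     (Seq (While (\<lambda>s. s c \<noteq> Blank) (shift J MoveLeft)) (shift J MoveRight))"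

lemma rewind_wf [simp]: "finite J \<Longrightarrow> finitary (rewind c J)" "det (rewind c J)"
  by (auto simp: rewind_def)

lemma run_rewind:
  assumes "c \<in> J" and J: "\<And>j. j \<in> J \<Longrightarrow> ts j = zip_tape (rev (map Bit v)) []"
  shows "run (rewind c J) ts (2 * length v + 5) {override_on ts (\<lambda>_. zip_tape [] (map Bit v)) J}"
proof -
  let ?t = "zip_tape (rev (map Bit v)) []"
  let ?n = "length v"
  let ?ts1 = "override_on ts (\<lambda>i. move_head MoveLeft (ts i)) J"
  let ?ts2 = "override_on ?ts1 (\<lambda>i. (move_head MoveLeft ^^ ?n) (?ts1 i)) J"
  have [simp]: "?ts1 j = (move_head MoveLeft ^^ Suc 0) ?t" if "j \<in> J" for j using that J by simp
  have at: "((move_head MoveLeft ^^ k) (?ts1 c)) 0 = nth_default Blank (rev (map Bit v)) k" for k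
    using \<open>c \<in> J\<close> J[OF \<open>c \<in> J\<close>]
    by (simp add: move_Left_power) (simp add: move_head_def zip_tape_def)
  have "run (While (\<lambda>s. s c \<noteq> Blank) (shift J MoveLeft)) ?ts1 (2 * ?n + 1) {?ts2}"
    using run_sweep[of c J ?n "\<lambda>i a. (a, MoveLeft)" ?ts1] \<open>c \<in> J\<close> at
    by (simp add: shift_def nth_default_def rev_nth)
  moreover have "override_on ?ts2 (\<lambda>i. move_head MoveRight (?ts2 i)) J
      = override_on ts (\<lambda>_. zip_tape [] (map Bit v)) J"
  proof -
    have "move_head MoveRight ((move_head MoveLeft ^^ ?n) (move_head MoveLeft ?t))
        = (move_head MoveLeft ^^ length (rev (map Bit v))) ?t"
      by (simp add: move_Left_power) (simp add: move_head_def)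
    also have "\<dots> = zip_tape [] (map Bit v)"
      using move_Left_zip[of "rev (map Bit v)" "[]" "[]"] by simp
    finally show ?thesis using J by (auto simp: override_on_def)
  qed
  ultimately have "run (rewind c J) ts (1 + (2 * ?n + 1 + 1 + 1) + 1)
      {override_on ts (\<lambda>_. zip_tape [] (map Bit v)) J}"
    using run_then[OF run_shift[of J MoveLeft ts] run_then[OF _ run_shift[of J MoveRight ?ts2]]]
    unfolding rewind_def by metis
  then show ?thesis by (rule run_mono) simp
qed

fun is_bit :: "symbol \<Rightarrow> bool" where
  "is_bit (Bit _) = True"
| "is_bit _ = False"

text \<open>The maximal block of bits from the head rightwards. It is a meaningful string on any tape, including one left
behind by a machine whose result does not have the format of an output.\<close>

primrec bits_from :: "tape \<Rightarrow> str \<Rightarrow> bool" where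
  "bits_from t [] \<longleftrightarrow> \<not> is_bit (t 0)"
| "bits_from t (b # v) \<longleftrightarrow> t 0 = Bit b \<and> bits_from (move_head MoveRight t) v"

lemma bits_from_unique: "bits_from t v \<Longrightarrow> bits_from t w \<Longrightarrow> v = w"
proof (induction v arbitrary: t w)
  case Nil then show ?case by (cases w) auto
next
  case (Cons b v) then show ?case by (cases w) auto
qed

lemma bits_from_zip: "bits_from (zip_tape l (map Bit v)) v"
  by (induction v arbitrary: l) (auto simp: move_head_zip)

lemma bits_from_exists:
  assumes "\<And>i. i \<ge> int n \<Longrightarrow> t i = Blank" shows "\<exists>v. bits_from t v \<and> length v \<le> n"
  using assms
proof (induction n arbitrary: t)
  case 0
  then show ?case by (intro exI[of _ "[]"]) auto
next
  case (Suc n)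
  show ?case
  proof (cases "t 0")
    case (Bit b)
    have "\<exists>v. bits_from (move_head MoveRight t) v \<and> length v \<le> n"
      by (rule Suc.IH) (use Suc.prems in \<open>simp add: move_head_def\<close>)
    then obtain v where "bits_from (move_head MoveRight t) v" "length v \<le> n" by blast
    with Bit show ?thesis by (intro exI[of _ "b # v"]) auto
  qed (auto intro: exI[of _ "[]"])
qed

definition transfer :: "tape_name \<Rightarrow> tape_name set \<Rightarrow> com" where
  "transfer c J = Prim (\<lambda>s. {\<lambda>i. if i \<in> insert c J then Some (s c, MoveRight) else None})"

lemma transfer_wf [simp]: "finite J \<Longrightarrow> finitary (transfer c J)" "det (transfer c J)"
  by (auto simp: transfer_def bounded_prim_def intro!: exI[of _ "{}"] exI[of _ "insert c J"] split: if_splits)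

lemma run_transfer: "run (transfer c J) ts 1
    {\<lambda>i. if i \<in> insert c J then put (ts c 0, MoveRight) (ts i) else ts i}"
  unfolding transfer_def by (rule run_Prim_single) (auto simp: upd_def)

definition copy :: "tape_name \<Rightarrow> tape_name set \<Rightarrow> com" where
  "copy c J = While (\<lambda>s. is_bit (s c)) (transfer c J)"

lemma copy_wf [simp]: "finite J \<Longrightarrow> finitary (copy c J)" "det (copy c J)"
  by (auto simp: copy_def)

lemma run_copy:
  assumes "c \<notin> J" "bits_from (ts c) v" "\<And>j. j \<in> J \<Longrightarrow> ts j = zip_tape (l j) []"
  shows "run (copy c J) ts (2 * length v + 1)
    {override_on (ts(c := (move_head MoveRight ^^ length v) (ts c)))
       (\<lambda>j. zip_tape (rev (map Bit v) @ l j) []) J}"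
  using assms(2,3)
proof (induction v arbitrary: ts l)
  case Nil
  then have "override_on ts (\<lambda>j. zip_tape (l j) []) J = ts"
    by (auto simp: override_on_def)
  with Nil show ?case by (auto simp: copy_def intro: run_exit)
next
  case (Cons b v)
  let ?ts = "\<lambda>i. if i \<in> insert c J then put (ts c 0, MoveRight) (ts i) else ts i"
  have c: "?ts c = move_head MoveRight (ts c)" by simp
  have J: "?ts j = zip_tape (Bit b # l j) []" if "j \<in> J" for j
    using that Cons.prems by simp
  have "run (copy c J) ?ts (2 * length v + 1)
    {override_on (?ts(c := (move_head MoveRight ^^ length v) (?ts c)))
       (\<lambda>j. zip_tape (rev (map Bit v) @ Bit b # l j) []) J}"
    by (rule Cons.IH) (use Cons.prems c J in auto)
  moreover have "override_on (?ts(c := (move_head MoveRight ^^ length v) (?ts c)))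
       (\<lambda>j. zip_tape (rev (map Bit v) @ Bit b # l j) []) J =
     override_on (ts(c := (move_head MoveRight ^^ length (b # v)) (ts c)))
       (\<lambda>j. zip_tape (rev (map Bit (b # v)) @ l j) []) J"
    using \<open>c \<notin> J\<close> by (auto simp: override_on_def funpow_swap1)
  ultimately have rest: "run (copy c J) ?ts (2 * length v + 1)
     {override_on (ts(c := (move_head MoveRight ^^ length (b # v)) (ts c)))
       (\<lambda>j. zip_tape (rev (map Bit (b # v)) @ l j) []) J}" by simp
  have "run (copy c J) ts (1 + (2 * length v + 1) + 1)
     {override_on (ts(c := (move_head MoveRight ^^ length (b # v)) (ts c)))
       (\<lambda>j. zip_tape (rev (map Bit (b # v)) @ l j) []) J}"
    unfolding copy_def
    by (rule run_loop[OF _ run_transfer rest[unfolded copy_def]]) (use Cons.prems in simp)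
  then show ?case by (rule run_mono) simp
qed

lemma input_Var0: "input x (Var 0) = zip_tape [] (map Bit x)"
  by (simp add: input_def string_tape_zip)

lemma input_other: "i \<noteq> Var 0 \<Longrightarrow> input x i = zip_tape [] []"
  by (simp add: input_def zip_tape_Nil)

lemma run_copy_zip:
  assumes "c \<notin> J" "ts c = zip_tape l' (map Bit v)" "\<And>j. j \<in> J \<Longrightarrow> ts j = zip_tape (l j) []"
  shows "run (copy c J) ts (2 * length v + 1)
    {override_on (ts(c := zip_tape (rev (map Bit v) @ l') [])) (\<lambda>j. zip_tape (rev (map Bit v) @ l j) []) J}"
  using run_copy[of c J ts v l, OF assms(1) _ assms(3)] bits_from_zip[of l' v]
    move_Right_zip[of "map Bit v" l' "[]"] assms(2) by simp

lemma run_assert_then: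
  assumes "g (scanned ts) \<Longrightarrow> run b ts m S"
  shows "run (Seq (assertion g) b) ts (m + 2) (if g (scanned ts) then S else {})"
proof (cases "g (scanned ts)")
  case True
  show ?thesis
    using run_mono[OF run_then[OF run_assertion[of g ts, OF True] assms[OF True]], of "m + 2"] True by simp
next
  case False
  show ?thesis
    using run_mono[OF run_stuck[OF run_assertion_fails[of g ts, OF False], of b m], of "m + 2"] False by simp
qed

section \<open>Pairs of strings\<close>

text \<open>Each letter of \<open>y\<close> is preceded by the flag \<open>True\<close>, and \<open>False\<close> marks the end of \<open>y\<close>, so that a pair can be taken
apart in one pass and its length is linear in the lengths of its components.\<close>

definition pair :: "str \<Rightarrow> str \<Rightarrow> str" where
  "pair y u = concat (map (\<lambda>b. [True, b]) y) @ False # u"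

text \<open>The effect of the loop in \<open>split_pair\<close>: it returns the flagged letters together with the rest of the string, and
fails if the letter after a flag is missing. The string is a pair exactly if the loop succeeds and the rest is not empty.\<close>

fun header :: "str \<Rightarrow> (str \<times> str) option" where
  "header (True # b # w) = map_option (\<lambda>(y, u). (b # y, u)) (header w)"
| "header [True] = None"
| "header (False # w) = Some ([], False # w)"
| "header [] = Some ([], [])"

lemma header_pair: "header (pair y u) = Some (y, False # u)"
  by (induction y) (auto simp: pair_def)

lemma header_Some:
  "header w = Some (y, u) \<Longrightarrow> (\<exists>v. u = False # v \<and> w = pair y v) \<or> u = [] \<and> w = concat (map (\<lambda>b. [True, b]) y)"
proof (induction w arbitrary: y rule: header.induct)
  case (1 b w)
  then show ?case by (force simp: pair_def)
qed (auto simp: pair_def)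

lemma pair_inject: "pair y u = pair y' u' \<longleftrightarrow> y = y' \<and> u = u'"
  by (metis header_pair option.inject prod.inject list.inject)

lemma length_pair: "length (pair y u) = 2 * length y + 1 + length u"
  by (induction y) (auto simp: pair_def)

text \<open>The input is erased while it is read. What remains on \<open>Var 0\<close> is therefore the second component, with the head on
its first letter and blanks around it.\<close>

definition split_loop :: "tape_name set \<Rightarrow> com" where
  "split_loop J = While (\<lambda>s. s (Var 0) = Bit True)
     (Seq (stamp {Var 0} Blank MoveRight)
       (Prim (\<lambda>s. if is_bit (s (Var 0))
          then {\<lambda>i. if i = Var 0 then Some (Blank, MoveRight)
                    else if i \<in> J then Some (s (Var 0), MoveRight) else None}
          else {})))"

definition split_pair :: "tape_name set \<Rightarrow> com" where
  "split_pair J = Seq (split_loop J)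
     (Seq (assertion (\<lambda>s. s (Var 0) = Bit False)) (stamp {Var 0} Blank MoveRight))"

lemma split_pair_wf [simp]: "finite J \<Longrightarrow> finitary (split_pair J)" "det (split_pair J)"
  by (auto simp: split_pair_def split_loop_def bounded_prim_def
      intro!: exI[of _ "{Blank}"] exI[of _ "insert (Var 0) J"] split: if_splits)

lemma run_split_loop:
  assumes "Var 0 \<notin> J" "ts (Var 0) = zip_tape [] (map Bit w)" "\<And>j. j \<in> J \<Longrightarrow> ts j = zip_tape (l j) []"
  shows "run (split_loop J) ts (2 * length w + 4) (case header w of None \<Rightarrow> {} | Some (y, u) \<Rightarrow>
    {override_on (ts(Var 0 := zip_tape [] (map Bit u))) (\<lambda>j. zip_tape (rev (map Bit y) @ l j) []) J})"
  using assms(2,3)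
proof (induction w arbitrary: ts l rule: header.induct)
  case (1 b w)
  let ?ts1 = "override_on ts (\<lambda>i. put (Blank, MoveRight) (ts i)) {Var 0}"
  let ?u = "\<lambda>i. if i = Var 0 then Some (Blank, MoveRight)
                    else if i \<in> J then Some (Bit b, MoveRight) else None"
  let ?ts2 = "upd ?u ?ts1"
  have ts1: "?ts1 (Var 0) = zip_tape [] (Bit b # map Bit w)" using 1 by simp
  have ts2: "?ts2 (Var 0) = zip_tape [] (map Bit w)" using ts1 by (simp add: upd_def)
  have J: "?ts2 j = zip_tape (Bit b # l j) []" if "j \<in> J" for j
    using that 1 \<open>Var 0 \<notin> J\<close> by (auto simp: upd_def override_on_def)
  have body: "run (Seq (stamp {Var 0} Blank MoveRight)
       (Prim (\<lambda>s. if is_bit (s (Var 0))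
          then {\<lambda>i. if i = Var 0 then Some (Blank, MoveRight)
                    else if i \<in> J then Some (s (Var 0), MoveRight) else None}
          else {}))) ts (1 + 1 + 1) {?ts2}"
    by (rule run_then[OF run_stamp run_Prim_single]) (simp_all only: ts1 zip_tape_scan is_bit.simps if_True)
  have rest: "run (split_loop J) ?ts2 (2 * length w + 4) (case header w of None \<Rightarrow> {} | Some (y, u) \<Rightarrow>
    {override_on (?ts2(Var 0 := zip_tape [] (map Bit u))) (\<lambda>j. zip_tape (rev (map Bit y) @ Bit b # l j) []) J})"
    by (rule "1.IH") (use ts2 J in auto)
  have eq: "override_on (?ts2(Var 0 := zip_tape [] (map Bit u))) (\<lambda>j. zip_tape (rev (map Bit y) @ Bit b # l j) []) J
      = override_on (ts(Var 0 := zip_tape [] (map Bit u))) (\<lambda>j. zip_tape (rev (map Bit (b # y)) @ l j) []) J" for y u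
    by (auto simp: override_on_def upd_def)
  have "run (split_loop J) ts (1 + 1 + 1 + (2 * length w + 4) + 1) (case header w of None \<Rightarrow> {} | Some (y, u) \<Rightarrow>
    {override_on (?ts2(Var 0 := zip_tape [] (map Bit u))) (\<lambda>j. zip_tape (rev (map Bit y) @ Bit b # l j) []) J})"
    unfolding split_loop_def
    by (rule run_loop[OF _ body rest[unfolded split_loop_def]]) (use 1 in simp)
  also have "(case header w of None \<Rightarrow> {} | Some (y, u) \<Rightarrow>
    {override_on (?ts2(Var 0 := zip_tape [] (map Bit u))) (\<lambda>j. zip_tape (rev (map Bit y) @ Bit b # l j) []) J})
    = (case header (True # b # w) of None \<Rightarrow> {} | Some (y, u) \<Rightarrow>
    {override_on (ts(Var 0 := zip_tape [] (map Bit u))) (\<lambda>j. zip_tape (rev (map Bit y) @ l j) []) J})"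
    unfolding eq by (simp split: option.split)
  finally show ?case by (rule run_mono) simp
next
  case 2
  have "run (split_loop J) ts (1 + 1 + 1 + 0 + 1) {}"
    unfolding split_loop_def
    by (rule run_loop_stuck, use 2 in simp, rule run_then[OF run_stamp run_Prim_stuck], use 2 in simp)
  then show ?case by (simp, elim run_mono) simp
next
  case (3 w)
  then have "override_on ts (\<lambda>j. zip_tape (l j) []) J = ts" by (auto simp: override_on_def)
  moreover have "ts(Var 0 := zip_tape [] (Bit False # map Bit w)) = ts" using 3 by auto
  moreover have "run (split_loop J) ts (Suc (2 * length w + 5)) {ts}"
    unfolding split_loop_def by (rule run_exit) (use 3 in simp)
  ultimately show ?case by simp
next
  case 4
  then have "override_on ts (\<lambda>j. zip_tape (l j) []) J = ts" by (auto simp: override_on_def)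
  then show ?case using 4 by (auto simp: split_loop_def fun_upd_idem intro: run_exit[where n = 3, simplified])
qed

lemma run_split_pair:
  assumes "Var 0 \<notin> J" "ts (Var 0) = zip_tape [] (map Bit (pair y u))" "\<And>j. j \<in> J \<Longrightarrow> ts j = zip_tape (l j) []"
  shows "run (split_pair J) ts (2 * length (pair y u) + 8)
    {override_on (ts(Var 0 := zip_tape [] (map Bit u))) (\<lambda>j. zip_tape (rev (map Bit y) @ l j) []) J}"
proof -
  let ?ts1 = "override_on (ts(Var 0 := zip_tape [] (map Bit (False # u)))) (\<lambda>j. zip_tape (rev (map Bit y) @ l j) []) J"
  have 1: "run (split_loop J) ts (2 * length (pair y u) + 4) {?ts1}"
    using run_split_loop[of J ts "pair y u" l] assms by (simp add: header_pair)
  have V: "?ts1 (Var 0) = zip_tape [] (Bit False # map Bit u)" using assms(1) by simp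
  have "run (split_pair J) ts (2 * length (pair y u) + 4 + (1 + 1 + 1) + 1)
      {override_on ?ts1 (\<lambda>i. put (Blank, MoveRight) (?ts1 i)) {Var 0}}"
    unfolding split_pair_def
    by (rule run_then[OF 1 run_then[OF run_assertion run_stamp]]) (use V in simp)
  also have "override_on ?ts1 (\<lambda>i. put (Blank, MoveRight) (?ts1 i)) {Var 0} =
     override_on (ts(Var 0 := zip_tape [] (map Bit u))) (\<lambda>j. zip_tape (rev (map Bit y) @ l j) []) J"
    using assms(1) by (auto simp: override_on_def)
  finally show ?thesis by (simp add: add_ac)
qed

lemma run_split_pair_fails:
  assumes "Var 0 \<notin> J" "ts (Var 0) = zip_tape [] (map Bit w)" "\<And>j. j \<in> J \<Longrightarrow> ts j = zip_tape (l j) []"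
    and "\<nexists>y u. w = pair y u"
  shows "run (split_pair J) ts (2 * length w + 8) {}"
proof (cases "header w")
  case None
  have "run (split_pair J) ts (2 * length w + 4 + 3 + 1) {}"
    unfolding split_pair_def by (rule run_stuck) (use run_split_loop[of J ts w l] assms(1-3) None in simp)
  then show ?thesis by (rule run_mono) simp
next
  case (Some r)
  then obtain y where y: "header w = Some (y, [])" using assms(4) header_Some by (cases r) blast
  let ?ts1 = "override_on (ts(Var 0 := zip_tape [] (map Bit []))) (\<lambda>j. zip_tape (rev (map Bit y) @ l j) []) J"
  have 1: "run (split_loop J) ts (2 * length w + 4) {?ts1}"
    using run_split_loop[of J ts w l] assms(1-3) by (simp add: y)
  have "run (split_pair J) ts (2 * length w + 4 + (1 + 1 + 1) + 1) {}"
    unfolding split_pair_def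
    by (rule run_then[OF 1 run_stuck[OF run_assertion_fails]]) (use assms(1) in simp)
  then show ?thesis by (rule run_mono) simp
qed

section \<open>Comparing and erasing tapes\<close>

definition compare :: "tape_name \<Rightarrow> tape_name \<Rightarrow> com" where
  "compare c d = Seq (While (\<lambda>s. s c = s d \<and> s c \<noteq> Blank) (shift {c, d} MoveRight))
     (assertion (\<lambda>s. s c = Blank \<and> s d = Blank))"

lemma compare_wf [simp]: "finitary (compare c d)" "det (compare c d)"
  by (auto simp: compare_def)

lemma run_compare_loop:
  assumes "c \<noteq> d" "ts c = zip_tape l (map Bit v)" "ts d = zip_tape l' (map Bit w)"
  shows "\<exists>ts'. run (While (\<lambda>s. s c = s d \<and> s c \<noteq> Blank) (shift {c, d} MoveRight)) ts (2 * length v + 1) {ts'} \<and>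
    (ts' c 0 = Blank \<and> ts' d 0 = Blank \<longleftrightarrow> v = w)"
  using assms(2,3)
proof (induction v arbitrary: w l l' ts)
  case Nil
  then show ?case by (intro exI[of _ ts]) (cases w; auto intro: run_exit)
next
  case (Cons b v)
  show ?case
  proof (cases "\<exists>w'. w = b # w'")
    case True
    then obtain w' where w: "w = b # w'" by blast
    let ?ts = "override_on ts (\<lambda>i. move_head MoveRight (ts i)) {c, d}"
    have "?ts c = zip_tape (Bit b # l) (map Bit v)" "?ts d = zip_tape (Bit b # l') (map Bit w')"
      using Cons.prems w by (auto simp: move_head_zip)
    from Cons.IH[OF this] obtain ts' where
      r: "run (While (\<lambda>s. s c = s d \<and> s c \<noteq> Blank) (shift {c, d} MoveRight)) ?ts (2 * length v + 1) {ts'}"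
      and ts': "ts' c 0 = Blank \<and> ts' d 0 = Blank \<longleftrightarrow> v = w'" by blast
    have "run (While (\<lambda>s. s c = s d \<and> s c \<noteq> Blank) (shift {c, d} MoveRight)) ts (1 + (2 * length v + 1) + 1) {ts'}"
      by (rule run_loop[OF _ run_shift r]) (use Cons.prems w in simp)
    with ts' w show ?thesis by (intro exI[of _ ts']) auto
  next
    case False
    then have "ts c 0 \<noteq> ts d 0" using Cons.prems by (cases w) auto
    moreover have "ts c 0 \<noteq> Blank" "b # v \<noteq> w" using Cons.prems False by auto
    ultimately show ?thesis by (intro exI[of _ ts]) (auto intro: run_exit)
  qed
qed

text \<open>Comparison comes last in programs that decide a language, where it only matters whether some execution ends.\<close>

lemma run_compare:
  assumes "c \<noteq> d" "ts c = zip_tape l (map Bit v)" "ts d = zip_tape l' (map Bit w)"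
  shows "\<exists>S. run (compare c d) ts (2 * length v + 3) S \<and> (S \<noteq> {} \<longleftrightarrow> v = w)"
proof -
  from run_compare_loop[OF assms] obtain ts' where
    r: "run (While (\<lambda>s. s c = s d \<and> s c \<noteq> Blank) (shift {c, d} MoveRight)) ts (2 * length v + 1) {ts'}"
    and ts': "ts' c 0 = Blank \<and> ts' d 0 = Blank \<longleftrightarrow> v = w" by blast
  let ?S = "if v = w then {ts'} else {}"
  have "run (assertion (\<lambda>s. s c = Blank \<and> s d = Blank)) ts' 1 ?S"
    using ts' run_assertion[of "\<lambda>s. s c = Blank \<and> s d = Blank" ts']
      run_assertion_fails[of "\<lambda>s. s c = Blank \<and> s d = Blank" ts'] by auto
  from run_then[OF r this] have "run (compare c d) ts (2 * length v + 3) ?S"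
    by (simp add: compare_def eval_nat_numeral)
  then show ?thesis by (intro exI[of _ ?S]) simp
qed

lemma put_Blank_Right_power:
  "(put (Blank, MoveRight) ^^ k) t = (\<lambda>i. if - int k \<le> i \<and> i < 0 then Blank else t (i + int k))"
proof (induction k)
  case (Suc k)
  have "put (Blank, MoveRight) s = (\<lambda>i. if i = -1 then Blank else s (i + 1))" for s
    by (auto simp: put_def move_head_def)
  then show ?case unfolding funpow.simps o_apply Suc.IH by (auto simp: algebra_simps)
qed (rule ext, auto)

lemma put_Blank_Left_power:
  "(put (Blank, MoveLeft) ^^ k) t = (\<lambda>i. if 0 < i \<and> i \<le> int k then Blank else t (i - int k))"
proof (induction k)
  case (Suc k)
  have "put (Blank, MoveLeft) s = (\<lambda>i. if i = 1 then Blank else s (i - 1))" for s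
    by (auto simp: put_def move_head_def)
  then show ?case unfolding funpow.simps o_apply Suc.IH by (auto simp: algebra_simps)
qed (rule ext, auto)

text \<open>The marks on \<open>Counter\<close> measure a distance within which all non-blank cells of the tapes in \<open>J\<close> lie on either side
of their heads. The heads go this distance to the left and then sweep twice the distance plus one cell to the
right, writing blanks, while \<open>Counter\<close> is traversed to the right, to the left, and finally erased as well. The heads
need not return, as all positions on a blank tape are alike.\<close>

definition erase :: "tape_name set \<Rightarrow> com" where
  "erase J = Seq (shift {Counter} MoveLeft)
    (Seq (While (\<lambda>s. s Counter \<noteq> Blank) (local_step (insert Counter J) (\<lambda>i a. (a, MoveLeft))))
    (Seq (shift {Counter} MoveRight)
    (Seq (While (\<lambda>s. s Counter \<noteq> Blank)
            (local_step (insert Counter J) (\<lambda>i a. (if i = Counter then a else Blank, MoveRight))))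
    (Seq (local_step (insert Counter J) (\<lambda>i a. if i = Counter then (a, MoveLeft) else (Blank, MoveRight)))
         (While (\<lambda>s. s Counter \<noteq> Blank)
            (local_step (insert Counter J) (\<lambda>i a. (Blank, if i = Counter then MoveLeft else MoveRight))))))))"

lemma erase_wf [simp]: "finite J \<Longrightarrow> finitary (erase J)" "det (erase J)"
  by (auto simp: erase_def intro!: finitary_local_step[of _ "{Blank}"])

lemma run_erase:
  assumes "Counter \<notin> J" and C: "ts Counter = zip_tape l []" and l: "Blank \<notin> set l"
    and J: "\<And>j i. j \<in> J \<Longrightarrow> \<bar>i\<bar> > int (length l) \<Longrightarrow> ts j i = Blank"
  shows "run (erase J) ts (6 * length l + 14) {override_on ts (\<lambda>_. zip_tape [] []) (insert Counter J)}"
proof -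
  define n where "n = length l"
  define st where "st = (\<lambda>A B i. if i = Counter then A else if i \<in> J then B (ts i) else ts i)"
  define R where "R = put (Blank, MoveRight)"
  define T where "T = zip_tape l []"
  define T1 where "T1 = (\<lambda>i. T (i - 1))"
  \<comment> \<open>The tape Counter is T with the head just right of the marks, and T1 with the head one cell further left.\<close>
  have T_neg: "T (- int k - 1) = nth_default Blank l k" for k
    by (simp add: T_def zip_tape_def)
  have non: "nth_default Blank l k \<noteq> Blank" if "k < n" for k
    using that l by (auto simp: nth_default_def n_def) (metis nth_mem)
  have out: "nth_default Blank l k = Blank" if "k \<ge> n" for k
    using that by (simp add: nth_default_def n_def)
  have T2: "(\<lambda>i. T (i - int n)) = zip_tape [] (rev l)"
    using move_Left_zip[of l "[]" "[]"] by (simp add: move_Left_power T_def n_def)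
  have start: "ts = st T id" using C by (auto simp: st_def T_def)
  have 1: "run (shift {Counter} MoveLeft) (st T id) 1 {st T1 id}"
    by (rule run_result[OF run_shift])
      (auto simp: st_def override_on_def T_def T1_def move_head_def)
  have 2: "run (While (\<lambda>s. s Counter \<noteq> Blank) (local_step (insert Counter J) (\<lambda>i a. (a, MoveLeft))))
      (st T1 id) (2 * n + 1) {st (\<lambda>i. T1 (i - int n)) (\<lambda>t i. t (i - int n))}"
    by (rule run_result[OF run_sweep])
      (use non out T_neg in \<open>auto simp: st_def override_on_def T_def T1_def move_Left_power\<close>)
  have 3: "run (shift {Counter} MoveRight) (st (\<lambda>i. T1 (i - int n)) (\<lambda>t i. t (i - int n))) 1
      {st (zip_tape [] (rev l)) (\<lambda>t i. t (i - int n))}"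
    by (rule run_result[OF run_shift])
      (auto simp: st_def override_on_def T_def T1_def move_head_def T2[symmetric] algebra_simps)
  have 4: "run (While (\<lambda>s. s Counter \<noteq> Blank)
        (local_step (insert Counter J) (\<lambda>i a. (if i = Counter then a else Blank, MoveRight))))
      (st (zip_tape [] (rev l)) (\<lambda>t i. t (i - int n))) (2 * n + 1)
      {st T (\<lambda>t. (R ^^ n) (\<lambda>i. t (i - int n)))}"
  proof (rule run_result[OF run_sweep])
    fix k assume "k < n"
    then have "n - Suc k < n" by simp
    have "T (int k - int n) = nth_default Blank l (n - Suc k)"
      using T_neg[of "n - Suc k"] \<open>k < n\<close> by (simp add: of_nat_diff algebra_simps)
    with non[OF \<open>n - Suc k < n\<close>]
    show "((\<lambda>t. put (if Counter = Counter then t 0 else Blank, MoveRight) t) ^^ k)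
      (st (zip_tape [] (rev l)) (\<lambda>t i. t (i - int n)) Counter) 0 \<noteq> Blank"
      by (simp add: st_def move_Right_power T2[symmetric])
  qed (auto simp: st_def override_on_def R_def move_Right_power T2[symmetric], auto simp: T_def)
  have 5: "run (local_step (insert Counter J) (\<lambda>i a. if i = Counter then (a, MoveLeft) else (Blank, MoveRight)))
      (st T (\<lambda>t. (R ^^ n) (\<lambda>i. t (i - int n)))) 1 {st T1 (\<lambda>t. R ((R ^^ n) (\<lambda>i. t (i - int n))))}"
    by (rule run_result[OF run_local_step], rule ext)
      (auto simp: st_def override_on_def T1_def R_def, simp add: move_head_def)
  have 6: "run (While (\<lambda>s. s Counter \<noteq> Blank)
        (local_step (insert Counter J) (\<lambda>i a. (Blank, if i = Counter then MoveLeft else MoveRight))))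
      (st T1 (\<lambda>t. R ((R ^^ n) (\<lambda>i. t (i - int n))))) (2 * n + 1)
      {st ((put (Blank, MoveLeft) ^^ n) T1) (\<lambda>t. (R ^^ n) (R ((R ^^ n) (\<lambda>i. t (i - int n)))))}"
    by (rule run_result[OF run_sweep])
      (use non out T_neg in \<open>auto simp: st_def override_on_def T_def T1_def put_Blank_Left_power R_def\<close>)
  have end_C: "(put (Blank, MoveLeft) ^^ n) T1 = zip_tape [] []"
  proof
    fix i
    show "(put (Blank, MoveLeft) ^^ n) T1 i = zip_tape [] [] i"
      using T_neg[of "nat (int n - i)"] out[of "nat (int n - i)"]
      by (cases "i \<le> 0") (auto simp: put_Blank_Left_power T1_def T_def zip_tape_Nil, auto simp: zip_tape_def)
  qed
  have end_J: "(R ^^ n) (R ((R ^^ n) (\<lambda>i. ts j (i - int n)))) = zip_tape [] []" if "j \<in> J" for j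
  proof
    fix i :: int
    show "(R ^^ n) (R ((R ^^ n) (\<lambda>i. ts j (i - int n)))) i = zip_tape [] [] i"
      using put_Blank_Right_power[of 1]
      by (simp add: R_def put_Blank_Right_power zip_tape_Nil)
        (intro impI J[OF that, folded n_def]; arith)
  qed
  have finish: "st ((put (Blank, MoveLeft) ^^ n) T1) (\<lambda>t. (R ^^ n) (R ((R ^^ n) (\<lambda>i. t (i - int n)))))
      = override_on ts (\<lambda>_. zip_tape [] []) (insert Counter J)"
    using end_J by (auto simp: st_def override_on_def end_C)
  have "run (erase J) (st T id) (1 + (2 * n + 1 + (1 + (2 * n + 1 + (1 + (2 * n + 1) + 1) + 1) + 1) + 1) + 1)
      {st ((put (Blank, MoveLeft) ^^ n) T1) (\<lambda>t. (R ^^ n) (R ((R ^^ n) (\<lambda>i. t (i - int n)))))}"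
    unfolding erase_def by (intro run_then[OF 1] run_then[OF 2] run_then[OF 3] run_then[OF 4] run_then[OF 5] 6)
  then show ?thesis unfolding finish start[symmetric] by (rule run_mono) (simp add: n_def)
qed

section \<open>Deterministic machines as subroutines\<close>

lemma deterministicD:
  assumes "deterministic M" "(q, as1, r1) \<in> transitions M" "(q, as2, r2) \<in> transitions M"
    and "map fst as1 = map fst as2"
  shows "as1 = as2 \<and> r1 = r2"
  using assms(1)[unfolded deterministic_def, THEN bspec, OF assms(2), unfolded prod.case,
      THEN bspec, OF assms(3)] assms(4) by simp

lemma deterministic_step:
  assumes "deterministic M" "(c, c1) \<in> steps M" "(c, c2) \<in> steps M"
  shows "c1 = c2"
proof -
  from assms(2,3) obtain q ts as1 r1 as2 r2 where
    "c = (q, ts)" "c1 = (r1, map2 act as1 ts)" "c2 = (r2, map2 act as2 ts)"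
    "(q, as1, r1) \<in> transitions M" "(q, as2, r2) \<in> transitions M" "map fst as1 = map fst as2"
    by (auto simp: steps_def)
  moreover from this have "as1 = as2 \<and> r1 = r2"
    using deterministicD[OF assms(1)] by metis
  ultimately show ?thesis by simp
qed

lemma halting_unique:
  assumes "deterministic M" "(c, d) \<in> steps M ^^ m" "halting M d" "(c, d') \<in> steps M ^^ n" "halting M d'"
  shows "d = d'"
  using assms(2,4)
proof (induction m arbitrary: c n)
  case 0
  with assms(3) show ?case by (cases n) (auto simp: halting_def elim: relpow_E2)
next
  case (Suc m)
  then obtain c1 where c1: "(c, c1) \<in> steps M" "(c1, d) \<in> steps M ^^ m"
    by (metis relpow_Suc_D2)
  then have "n \<noteq> 0" using Suc.prems(2) assms(5) unfolding halting_def
    by (metis relpow_0_E)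
  then obtain k where n: "n = Suc k" by (cases n) auto
  with Suc.prems obtain c2 where "(c, c2) \<in> steps M" "(c2, d') \<in> steps M ^^ k"
    by (metis relpow_Suc_D2)
  with c1 deterministic_step[OF assms(1)] Suc.IH show ?case by blast
qed

definition final :: "'q tm \<Rightarrow> str \<Rightarrow> 'q config" where
  "final M x = (THE c. (initial M x, c) \<in> (steps M)\<^sup>* \<and> halting M c)"

lemma halting_exists:
  assumes "\<And>n c'. (c, c') \<in> steps M ^^ n \<Longrightarrow> n \<le> b"
  shows "\<exists>n c'. (c, c') \<in> steps M ^^ n \<and> halting M c' \<and> n \<le> b"
proof -
  let ?P = "\<lambda>n. \<exists>c'. (c, c') \<in> steps M ^^ n"
  have "?P 0" by auto
  moreover have "\<forall>n. ?P n \<longrightarrow> n \<le> b" using assms by blast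
  ultimately have P: "?P (Greatest ?P)" and max: "\<And>n. ?P n \<Longrightarrow> n \<le> Greatest ?P"
    using GreatestI_nat[of ?P 0 b] Greatest_le_nat[of ?P _ b] by simp_all
  from P obtain c' where c': "(c, c') \<in> steps M ^^ Greatest ?P" by blast
  have "halting M c'"
  proof (unfold halting_def, rule notI, elim exE)
    fix d assume "(c', d) \<in> steps M"
    from relpow_Suc_I[OF c' this] have "Suc (Greatest ?P) \<le> Greatest ?P" by (blast intro: max)
    then show False by simp
  qed
  with c' assms show ?thesis by blast
qed

definition halts_after :: "'q tm \<Rightarrow> str \<Rightarrow> nat \<Rightarrow> bool" where
  "halts_after M x m \<longleftrightarrow> (initial M x, final M x) \<in> steps M ^^ m \<and> halting M (final M x)"

lemma DTM_poly_halts: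
  assumes "M \<in> DTM_poly"
  obtains p :: "nat poly" where "\<And>x. \<exists>m \<le> poly p (length x). halts_after M x m"
proof -
  from assms obtain p :: "nat poly" where
    p: "\<And>x n c. (initial M x, c) \<in> steps M ^^ n \<Longrightarrow> n \<le> poly p (length x)"
    unfolding DTM_poly_def NTM_poly_def polynomial_time_def by blast
  have "\<exists>m \<le> poly p (length x). halts_after M x m" for x
  proof -
    obtain n c where c: "(initial M x, c) \<in> steps M ^^ n" "halting M c" "n \<le> poly p (length x)"
      using halting_exists[of "initial M x" M] p by blast
    have "final M x = c"
      unfolding final_def
    proof (rule the_equality)
      fix d assume d: "(initial M x, d) \<in> (steps M)\<^sup>* \<and> halting M d"
      then obtain k where "(initial M x, d) \<in> steps M ^^ k" by (blast dest: rtrancl_imp_relpow)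
      from halting_unique[OF _ this _ c(1,2)] d assms show "d = c" by (simp add: DTM_poly_def)
    qed (use c relpow_imp_rtrancl[OF c(1)] in simp)
    with c show ?thesis by (auto simp: halts_after_def)
  qed
  then show ?thesis by (rule that)
qed

lemma accepting_result_final:
  assumes "M \<in> DTM_poly"
  shows "accepting_result M x c \<longleftrightarrow> c = final M x \<and> fst c \<in> accepting M"
proof -
  from DTM_poly_halts[OF assms] obtain m where m: "(initial M x, final M x) \<in> steps M ^^ m"
    and h: "halting M (final M x)" unfolding halts_after_def by metis
  have "c = final M x" if c: "accepting_result M x c"
  proof -
    from c obtain k where "(initial M x, c) \<in> steps M ^^ k"
      unfolding accepting_result_def by (blast dest: rtrancl_imp_relpow)
    from halting_unique[OF _ this _ m h] c assms show ?thesis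
      by (simp add: accepting_result_def DTM_poly_def)
  qed
  with relpow_imp_rtrancl[OF m] h show ?thesis by (auto simp: accepting_result_def)
qed

lemma language_final: "M \<in> DTM_poly \<Longrightarrow> x \<in> language M \<longleftrightarrow> fst (final M x) \<in> accepting M"
  by (auto simp: language_def accepting_result_final)

lemma outputs_final:
  "M \<in> DTM_poly \<Longrightarrow> outputs M x y \<longleftrightarrow>
    fst (final M x) \<in> accepting M \<and> hd (snd (final M x)) = string_tape y"
  by (auto simp: outputs_def accepting_result_final)

lemma DTM_polyD: "M \<in> DTM_poly \<Longrightarrow> turing_machine M" "M \<in> DTM_poly \<Longrightarrow> deterministic M"
  by (auto simp: DTM_poly_def NTM_poly_def)

lemma tapes_pos: "M \<in> DTM_poly \<Longrightarrow> 0 < tapes M"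
  using DTM_polyD(1)[of M] by (auto simp: turing_machine_def)

text \<open>In one step the boundary of the non-blank region moves by at most one cell relative to the head. This is what
makes it possible to erase the tapes of a subroutine after counting its steps.\<close>

lemma tapes_invariant:
  assumes "turing_machine M" "(initial M x, c) \<in> steps M ^^ m"
  shows "length (snd c) = tapes M \<and>
    (\<forall>t \<in> set (snd c). \<forall>i. \<bar>i\<bar> > int (length x + m) \<longrightarrow> t i = Blank)"
  using assms(2)
proof (induction m arbitrary: c)
  case 0
  then show ?case using assms(1) by (auto simp: initial_def turing_machine_def string_tape_def)
next
  case (Suc m)
  then obtain d where d: "(initial M x, d) \<in> steps M ^^ m" "(d, c) \<in> steps M" by auto
  from d(2) obtain q ts as q' where dc: "d = (q, ts)" "c = (q', map2 act as ts)"
    and t: "(q, as, q') \<in> transitions M" by (auto simp: steps_def)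
  have len: "length as = tapes M" using t assms(1) by (auto simp: turing_machine_def)
  have IH: "length ts = tapes M" "\<And>t i. t \<in> set ts \<Longrightarrow> \<bar>i\<bar> > int (length x + m) \<Longrightarrow> t i = Blank"
    using Suc.IH[OF d(1)] dc by auto
  have "act a t i = Blank" if "t \<in> set ts" "\<bar>i\<bar> > int (length x + Suc m)" for a t i
  proof -
    obtain s b mv where "a = (s, b, mv)" by (cases a)
    then show ?thesis using that IH(2)[OF that(1)]
      by (cases mv) (auto simp: act_def move_head_def)
  qed
  then show ?case using len IH(1) dc by (auto dest!: set_zip_rightD)
qed

lemma final_tapes:
  assumes "M \<in> DTM_poly" "halts_after M x m"
  shows "length (snd (final M x)) = tapes M"
    and "t \<in> set (snd (final M x)) \<Longrightarrow> \<bar>i\<bar> > int (length x + m) \<Longrightarrow> t i = Blank"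
    and "hd (snd (final M x)) = snd (final M x) ! 0" "hd (snd (final M x)) \<in> set (snd (final M x))"
proof -
  show len: "length (snd (final M x)) = tapes M"
    and "t \<in> set (snd (final M x)) \<Longrightarrow> \<bar>i\<bar> > int (length x + m) \<Longrightarrow> t i = Blank"
    using tapes_invariant[of M x "final M x" m] DTM_polyD(1)[OF assms(1)] assms(2)
    by (auto simp: halts_after_def)
  have "snd (final M x) \<noteq> []" using len tapes_pos[OF assms(1)] by auto
  then show "hd (snd (final M x)) = snd (final M x) ! 0" "hd (snd (final M x)) \<in> set (snd (final M x))"
    by (simp_all add: hd_conv_nth)
qed

type_synonym transition = "nat \<times> action list \<times> nat"

definition enabled :: "nat tm \<Rightarrow> nat \<Rightarrow> scan \<Rightarrow> transition set" where
  "enabled M b s = {(q, as, q') \<in> transitions M. s (State b) = Aux q \<and>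
     map fst as = map (\<lambda>j. s (Blk b j)) [0..<tapes M]}"

definition effect :: "nat \<Rightarrow> transition \<Rightarrow> update" where
  "effect b = (\<lambda>(q, as, q') i. case i of
      Blk b' j \<Rightarrow> if b' = b \<and> j < length as then Some (snd (as ! j)) else None
    | State b' \<Rightarrow> if b' = b then Some (Aux q', Stay) else None
    | _ \<Rightarrow> None)"

definition load :: "nat \<Rightarrow> nat config \<Rightarrow> store \<Rightarrow> store" where
  "load b = (\<lambda>(q, tps) ts i. case i of
      Blk b' j \<Rightarrow> if b' = b \<and> j < length tps then tps ! j else ts i
    | State b' \<Rightarrow> if b' = b then zip_tape [] [Aux q] else ts i
    | _ \<Rightarrow> ts i)"

lemma load_simps [simp]:
  "load b c ts (Var n) = ts (Var n)"
  "load b c ts Counter = ts Counter"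
  "load b c ts (State b) = zip_tape [] [Aux (fst c)]"
  "b' \<noteq> b \<Longrightarrow> load b c ts (State b') = ts (State b')"
  "b' \<noteq> b \<Longrightarrow> load b c ts (Blk b' j) = ts (Blk b' j)"
  "j < length (snd c) \<Longrightarrow> load b c ts (Blk b j) = snd c ! j"
  "\<not> j < length (snd c) \<Longrightarrow> load b c ts (Blk b j) = ts (Blk b j)"
  by (auto simp: load_def split: prod.split)

lemma load_Var [simp]: "load b c (ts(Var n := t)) = (load b c ts)(Var n := t)"
  and load_Counter [simp]: "load b c (ts(Counter := t)) = (load b c ts)(Counter := t)"
  by (auto simp: load_def fun_eq_iff split: prod.split tape_name.split)

lemma enabled_load:
  assumes "length (snd c) = tapes M"
  shows "t \<in> enabled M b (scanned (load b c ts)) \<longleftrightarrow>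
    t \<in> transitions M \<and> fst t = fst c \<and> map fst (fst (snd t)) = map (\<lambda>t. t 0) (snd c)"
proof -
  have "map (\<lambda>j. load b c ts (Blk b j) 0) [0..<tapes M] = map (\<lambda>t. t 0) (snd c)"
    using assms by (intro nth_equalityI) auto
  then show ?thesis by (cases t) (auto simp: enabled_def)
qed

lemma steps_enabled:
  assumes "length (snd c) = tapes M"
  shows "(c, c') \<in> steps M \<longleftrightarrow> (\<exists>q as q'. (q, as, q') \<in> enabled M b (scanned (load b c ts)) \<and>
    c' = (q', map2 act as (snd c)))"
  unfolding steps_def enabled_load[OF assms] by (cases c) auto

lemma halting_enabled:
  assumes "length (snd c) = tapes M"
  shows "halting M c \<longleftrightarrow> enabled M b (scanned (load b c ts)) = {}"
  unfolding halting_def steps_enabled[OF assms, where b = b and ts = ts] by auto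

lemma upd_effect:
  assumes "length as = length (snd c)"
  shows "upd (effect b (q, as, q')) (load b c ts) = load b (q', map2 act as (snd c)) ts"
proof
  fix i
  show "upd (effect b (q, as, q')) (load b c ts) i = load b (q', map2 act as (snd c)) ts i"
    using assms by (cases i) (auto simp: upd_def effect_def load_def act_put split: prod.split)
qed

text \<open>The whole transition table is a single primitive: with the state on a tape, choosing an enabled transition depends on
scanned symbols only. The loop ends exactly when the machine halts.\<close>

definition simulate :: "nat tm \<Rightarrow> nat \<Rightarrow> com" where
  "simulate M b = While (\<lambda>s. enabled M b s \<noteq> {})
     (Prim (\<lambda>s. (\<lambda>t. (effect b t)(Counter \<mapsto> (Aux 0, MoveRight))) ` enabled M b s))"

lemma enabled_unique:
  assumes "deterministic M" "t \<in> enabled M b s" "t' \<in> enabled M b s" shows "t = t'"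
proof -
  obtain q as r q' as' r' where t: "t = (q, as, r)" "t' = (q', as', r')" by (cases t; cases t')
  with assms(2,3) have "q = q'" "map fst as = map fst as'" "(q, as, r) \<in> transitions M"
    "(q', as', r') \<in> transitions M" by (auto simp: enabled_def)
  with t show ?thesis using deterministicD[OF assms(1)] by metis
qed

lemma bounded_effect:
  assumes "turing_machine M" "t \<in> transitions M"
  shows "dom (effect b t) \<subseteq> insert (State b) (Blk b ` {..<tapes M})"
    and "effect b t i = Some (a, m) \<Longrightarrow> a \<in> (\<Union>(q, as, q') \<in> transitions M. insert (Aux q') (fst ` snd ` set as))"
proof -
  obtain q as q' where t: "t = (q, as, q')" by (cases t)
  then have "length as = tapes M" using assms by (auto simp: turing_machine_def)
  then show "dom (effect b t) \<subseteq> insert (State b) (Blk b ` {..<tapes M})"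
    by (auto simp: effect_def t split: tape_name.splits if_splits)
  assume e: "effect b t i = Some (a, m)"
  have "a \<in> insert (Aux q') (fst ` snd ` set as)"
  proof (cases i)
    case (Blk b' j)
    with e have "j < length as" "snd (as ! j) = (a, m)" by (auto simp: effect_def t split: if_splits)
    then show ?thesis by (force simp: image_iff dest: nth_mem)
  qed (use e in \<open>auto simp: effect_def t split: if_splits\<close>)
  with t assms(2) show "a \<in> (\<Union>(q, as, q') \<in> transitions M. insert (Aux q') (fst ` snd ` set as))"
    by (auto intro!: bexI[of _ t])
qed

lemma finite_written: "turing_machine M \<Longrightarrow>
  finite (\<Union>(q, as, q') \<in> transitions M. insert (Aux q') (fst ` snd ` set as))"
  by (auto simp: turing_machine_def)

lemma simulate_wf:
  assumes "turing_machine M"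
  shows "finitary (simulate M b)" "deterministic M \<Longrightarrow> det (simulate M b)"
proof -
  let ?A = "insert (Aux 0) (\<Union>(q, as, q') \<in> transitions M. insert (Aux q') (fst ` snd ` set as))"
  let ?X = "insert Counter (insert (State b) (Blk b ` {..<tapes M}))"
  have "bounded_prim ?A ?X (\<lambda>s. (\<lambda>t. (effect b t)(Counter \<mapsto> (Aux 0, MoveRight))) ` enabled M b s)"
    unfolding bounded_prim_def
  proof (intro allI ballI conjI impI)
    fix s u i a m
    assume "u \<in> (\<lambda>t. (effect b t)(Counter \<mapsto> (Aux 0, MoveRight))) ` enabled M b s"
    then obtain t where t: "t \<in> transitions M" and u: "u = (effect b t)(Counter \<mapsto> (Aux 0, MoveRight))"
      by (auto simp: enabled_def)
    show "dom u \<subseteq> ?X" using bounded_effect(1)[OF assms t, of b] by (auto simp: u)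
    assume "u i = Some (a, m)"
    then show "a \<in> ?A \<union> range s"
      using bounded_effect(2)[OF assms t, of b i a m] by (auto simp: u split: if_splits)
  qed
  moreover have "finite ?A" using finite_written[OF assms] by simp
  moreover have "finite ?X" by simp
  ultimately show "finitary (simulate M b)" unfolding simulate_def finitary.simps by blast
  assume det: "deterministic M"
  show "det (simulate M b)" by (auto simp: simulate_def dest: enabled_unique[OF det])
qed

lemma run_simulate:
  assumes "turing_machine M" "deterministic M" "(c, c') \<in> steps M ^^ m" "halting M c'"
    and "length (snd c) = tapes M" "ts Counter = zip_tape l []"
  shows "run (simulate M b) (load b c ts) (2 * m + 1)
    {load b c' (ts(Counter := zip_tape (replicate m (Aux 0) @ l) []))}"
  using assms(3,5,6)
proof (induction m arbitrary: c ts l)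
  case 0
  then have "c = c'" "enabled M b (scanned (load b c ts)) = {}"
    using halting_enabled[of c M b ts] assms(4) by auto
  moreover have "ts(Counter := zip_tape l []) = ts" using 0 by auto
  ultimately show ?case by (auto simp: simulate_def intro: run_exit simp del: load_Counter)
next
  case (Suc m)
  then obtain d where d: "(c, d) \<in> steps M" "(d, c') \<in> steps M ^^ m" by (metis relpow_Suc_D2)
  then obtain q as q' where t: "(q, as, q') \<in> enabled M b (scanned (load b c ts))"
    and d_eq: "d = (q', map2 act as (snd c))"
    using steps_enabled[OF Suc.prems(2)] by blast
  have uniq: "enabled M b (scanned (load b c ts)) = {(q, as, q')}"
    using enabled_unique[OF assms(2)] t by blast
  have len: "length as = length (snd c)"
    using t Suc.prems assms(1) by (auto simp: enabled_def turing_machine_def)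
  let ?ts = "ts(Counter := zip_tape (Aux 0 # l) [])"
  have eff: "upd ((effect b (q, as, q'))(Counter \<mapsto> (Aux 0, MoveRight))) (load b c ts) = load b d ?ts"
    using Suc.prems(3) by (simp add: upd_effect[OF len] d_eq)
  have step: "run (Prim (\<lambda>s. (\<lambda>t. (effect b t)(Counter \<mapsto> (Aux 0, MoveRight))) ` enabled M b s))
      (load b c ts) 1 {load b d ?ts}"
    by (rule run_Prim_single[OF _ eff[symmetric]]) (simp add: uniq)
  have "run (simulate M b) (load b d ?ts) (2 * m + 1)
    {load b c' (?ts(Counter := zip_tape (replicate m (Aux 0) @ Aux 0 # l) []))}"
    by (rule Suc.IH) (use d d_eq len Suc.prems in auto)
  also have "?ts(Counter := zip_tape (replicate m (Aux 0) @ Aux 0 # l) [])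
      = ts(Counter := zip_tape (replicate (Suc m) (Aux 0) @ l) [])"
    by (simp add: replicate_app_Cons_same)
  finally have rest: "run (simulate M b) (load b d ?ts) (2 * m + 1)
    {load b c' (ts(Counter := zip_tape (replicate (Suc m) (Aux 0) @ l) []))}" .
  have "run (simulate M b) (load b c ts) (1 + (2 * m + 1) + 1)
    {load b c' (ts(Counter := zip_tape (replicate (Suc m) (Aux 0) @ l) []))}"
    unfolding simulate_def by (rule run_loop[OF _ step rest[unfolded simulate_def]]) (use uniq in simp)
  then show ?case by (rule run_mono) simp
qed

definition call :: "nat tm \<Rightarrow> nat \<Rightarrow> com" where
  "call M b = Seq (stamp {State b} (Aux (start M)) Stay) (simulate M b)"

lemma call_wf [simp]:
  "turing_machine M \<Longrightarrow> finitary (call M b)" "turing_machine M \<Longrightarrow> deterministic M \<Longrightarrow> det (call M b)"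
  by (auto simp: call_def simulate_wf)

definition ready :: "nat tm \<Rightarrow> nat \<Rightarrow> str \<Rightarrow> store \<Rightarrow> bool" where
  "ready M b x ts \<longleftrightarrow> ts (Blk b 0) = zip_tape [] (map Bit x) \<and>
     (\<forall>j. 0 < j \<and> j < tapes M \<longrightarrow> ts (Blk b j) = zip_tape [] []) \<and> ts (State b) = zip_tape [] []"

lemma load_initial:
  assumes "turing_machine M" "ready M b x ts"
  shows "override_on ts (\<lambda>i. put (Aux (start M), Stay) (ts i)) {State b} = load b (initial M x) ts"
proof
  fix i
  have "length (snd (initial M x)) = tapes M" using assms by (auto simp: initial_def turing_machine_def)
  then show "override_on ts (\<lambda>i. put (Aux (start M), Stay) (ts i)) {State b} i = load b (initial M x) ts i"
    using assms by (cases i) (auto simp: ready_def override_on_def load_def initial_def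
        string_tape_zip zip_tape_Nil[symmetric] nth_Cons split: nat.split)
qed

lemma run_call:
  assumes "M \<in> DTM_poly" "halts_after M x m" "ready M b x ts" "ts Counter = zip_tape l []"
  shows "run (call M b) ts (2 * m + 3)
    {load b (final M x) (ts(Counter := zip_tape (replicate m (Aux 0) @ l) []))}"
proof -
  note M = DTM_polyD[OF assms(1)]
  have "length (snd (initial M x)) = tapes M" using M by (auto simp: initial_def turing_machine_def)
  with assms(2) have "run (simulate M b) (load b (initial M x) ts) (2 * m + 1)
      {load b (final M x) (ts(Counter := zip_tape (replicate m (Aux 0) @ l) []))}"
    unfolding halts_after_def by (intro run_simulate[where l = l, OF M]) (use assms(4) in simp_all)
  then have "run (call M b) ts (1 + (2 * m + 1) + 1)
      {load b (final M x) (ts(Counter := zip_tape (replicate m (Aux 0) @ l) []))}"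
    using load_initial[OF M(1) assms(3)] unfolding call_def by (intro run_then[OF run_stamp]) simp
  then show ?thesis by (rule run_mono) simp
qed

definition accepts :: "nat tm \<Rightarrow> nat \<Rightarrow> scan \<Rightarrow> bool" where
  "accepts M b s \<longleftrightarrow> (\<exists>q \<in> accepting M. s (State b) = Aux q)"

lemma accepts_load [simp]: "accepts M b (scanned (load b c ts)) \<longleftrightarrow> fst c \<in> accepting M"
  by (auto simp: accepts_def)

lemma computes_final:
  assumes "M \<in> DTM_poly" "computes M f"
  shows "fst (final M x) \<in> accepting M \<longleftrightarrow> f x \<noteq> None"
    and "f x = Some y \<Longrightarrow> hd (snd (final M x)) = string_tape y"
  using assms language_final[OF assms(1), of x] outputs_final[OF assms(1), of x]
  by (auto simp: computes_def)

section \<open>Languages in NP as images\<close>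

text \<open>Choices are written in unary: \<open>i\<close> letters \<open>True\<close> followed by \<open>False\<close> select the transition number \<open>i\<close>. The number
carried along counts the letters \<open>True\<close> read since the last selection; it has to be \<open>0\<close> at the end of a
complete code.\<close>

fun follow :: "transition list \<Rightarrow> nat \<Rightarrow> nat config \<Rightarrow> str \<Rightarrow> (nat \<times> nat config) option" where
  "follow trs i c [] = Some (i, c)"
| "follow trs i c (True # w) = (if Suc i < length trs then follow trs (Suc i) c w else None)"
| "follow trs i c (False # w) =
    (if i < length trs \<and> fst (trs ! i) = fst c \<and> map fst (fst (snd (trs ! i))) = map (\<lambda>t. t 0) (snd c)
     then follow trs 0 (snd (snd (trs ! i)), map2 act (fst (snd (trs ! i))) (snd c)) w else None)"

text \<open>A transition costs at most as many letters as the table has rows. Hence the choice string is at most as long as the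
run up to a constant factor, and the verified function below is balanced.\<close>

lemma follow_sound:
  shows "set trs \<subseteq> transitions M \<Longrightarrow> follow trs i c w = Some (0, c') \<Longrightarrow>
    \<exists>n. (c, c') \<in> steps M ^^ n \<and> length w + i \<le> length trs * n"
proof (induction trs i c w rule: follow.induct)
  case (1 trs i c)
  then show ?case by (intro exI[of _ 0]) auto
next
  case (2 trs i c w)
  then show ?case by (auto split: if_splits)
next
  case (3 trs i c w)
  let ?c = "(snd (snd (trs ! i)), map2 act (fst (snd (trs ! i))) (snd c))"
  from 3(3) have i: "i < length trs" and t: "fst (trs ! i) = fst c"
    "map fst (fst (snd (trs ! i))) = map (\<lambda>t. t 0) (snd c)" by (auto split: if_splits)
  with 3(1)[OF _ 3(2)] 3(3) obtain n where n: "(?c, c') \<in> steps M ^^ n" "length w + 0 \<le> length trs * n"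
    by (auto split: if_splits)
  have "trs ! i \<in> transitions M" using nth_mem[OF i] 3(2) by blast
  with t have "(c, ?c) \<in> steps M"
    unfolding steps_def by (cases c; cases "trs ! i") auto
  with n(1) have "(c, c') \<in> steps M ^^ Suc n" by (metis relpow_Suc_I2)
  moreover have "length (False # w) + i \<le> length trs * Suc n" using i n(2) by simp
  ultimately show ?case by blast
qed

lemma follow_True: "i + k < length trs \<Longrightarrow> follow trs i c (replicate k True @ w) = follow trs (i + k) c w"
  by (induction k arbitrary: i) auto

lemma follow_complete:
  assumes "transitions M \<subseteq> set trs"
  shows "(c, c') \<in> steps M ^^ n \<Longrightarrow> \<exists>w. follow trs 0 c w = Some (0, c')"
proof (induction n arbitrary: c)
  case 0
  then show ?case by (intro exI[of _ "[]"]) auto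
next
  case (Suc n)
  then obtain d where d: "(c, d) \<in> steps M" "(d, c') \<in> steps M ^^ n" by (metis relpow_Suc_D2)
  from d(1) obtain q ts as q' where t: "c = (q, ts)" "d = (q', map2 act as ts)"
    "(q, as, q') \<in> transitions M" "map fst as = map (\<lambda>t. t 0) ts" by (auto simp: steps_def)
  from t(3) assms have "(q, as, q') \<in> set trs" by blast
  then obtain i where i: "i < length trs" "trs ! i = (q, as, q')" by (auto simp: in_set_conv_nth)
  from Suc.IH[OF d(2)] obtain w where w: "follow trs 0 d w = Some (0, c')" by blast
  have "follow trs 0 c (replicate i True @ False # w) = Some (0, c')"
    using i t w by (simp add: follow_True[of 0, simplified])
  then show ?case by blast
qed

text \<open>Simulates \<open>M\<close> in block \<open>0\<close> along the choice string on \<open>Var 0\<close>, which is erased on the way; \<open>Var 2\<close> holds the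
number carried along by \<open>follow\<close>.\<close>

definition guide :: "nat tm \<Rightarrow> transition list \<Rightarrow> com" where
  "guide M trs = While (\<lambda>s. s (Var 0) \<noteq> Blank) (Prim (\<lambda>s.
     {u. \<exists>i. s (Var 2) = Aux i \<and>
        (s (Var 0) = Bit True \<and> Suc i < length trs \<and>
           u = [Var 0 \<mapsto> (Blank, MoveRight), Var 2 \<mapsto> (Aux (Suc i), Stay)] \<or>
         s (Var 0) = Bit False \<and> i < length trs \<and> trs ! i \<in> enabled M 0 s \<and>
           u = (effect 0 (trs ! i))(Var 0 \<mapsto> (Blank, MoveRight), Var 2 \<mapsto> (Aux 0, Stay)))}))"

lemma enabled_transitions: "t \<in> enabled M b s \<Longrightarrow> t \<in> transitions M"
  by (auto simp: enabled_def)

lemma guide_wf: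
  assumes "turing_machine M"
  shows "finitary (guide M trs)" "det (guide M trs)"
proof -
  let ?A = "insert Blank (Aux ` {..length trs} \<union>
    (\<Union>(q, as, q') \<in> transitions M. insert (Aux q') (fst ` snd ` set as)))"
  let ?X = "{Var 0, Var 2} \<union> insert (State 0) (Blk 0 ` {..<tapes M})"
  let ?r = "\<lambda>s. {u. \<exists>i. s (Var 2) = Aux i \<and>
        (s (Var 0) = Bit True \<and> Suc i < length trs \<and>
           u = [Var 0 \<mapsto> (Blank, MoveRight), Var 2 \<mapsto> (Aux (Suc i), Stay)] \<or>
         s (Var 0) = Bit False \<and> i < length trs \<and> trs ! i \<in> enabled M 0 s \<and>
           u = (effect 0 (trs ! i))(Var 0 \<mapsto> (Blank, MoveRight), Var 2 \<mapsto> (Aux 0, Stay)))}"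
  have "bounded_prim ?A ?X ?r"
    unfolding bounded_prim_def
  proof (intro allI ballI)
    fix s u assume "u \<in> ?r s"
    then obtain i where "Suc i < length trs \<and>
           u = [Var 0 \<mapsto> (Blank, MoveRight), Var 2 \<mapsto> (Aux (Suc i), Stay)] \<or>
         trs ! i \<in> transitions M \<and>
           u = (effect 0 (trs ! i))(Var 0 \<mapsto> (Blank, MoveRight), Var 2 \<mapsto> (Aux 0, Stay))" (is "?a \<or> ?b")
      unfolding mem_Collect_eq using enabled_transitions by fast
    then show "dom u \<subseteq> ?X \<and> (\<forall>j b m. u j = Some (b, m) \<longrightarrow> b \<in> ?A \<union> range s)"
    proof
      assume ?a then show ?thesis by (auto split: if_splits)
    next
      assume b: ?b
      note e = bounded_effect[OF assms conjunct1[OF b], where b = 0]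
      show ?thesis
      proof (intro conjI allI impI)
        show "dom u \<subseteq> ?X" using b e(1) by auto
        fix j a m assume "u j = Some (a, m)"
        then show "a \<in> ?A \<union> range s" using b e(2)[of j a m] by (auto split: if_splits)
      qed
    qed
  qed
  moreover have "finite ?A" using finite_written[OF assms] by simp
  moreover have "finite ?X" by simp
  ultimately show "finitary (guide M trs)" unfolding guide_def finitary.simps by blast
  show "det (guide M trs)" by (auto simp: guide_def)
qed

lemma run_guide:
  assumes "turing_machine M" "set trs \<subseteq> transitions M"
    and "length (snd c) = tapes M" "ts (Var 0) = zip_tape [] (map Bit w)" "ts (Var 2) = zip_tape [] [Aux i]"
  shows "run (guide M trs) (load 0 c ts) (2 * length w + 1)
    (case follow trs i c w of None \<Rightarrow> {}
     | Some (i', c') \<Rightarrow> {load 0 c' (ts(Var 0 := zip_tape [] [], Var 2 := zip_tape [] [Aux i']))})"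
  using assms(2-5)
proof (induction trs i c w arbitrary: ts rule: follow.induct)
  case (1 trs i c)
  then have "ts(Var 0 := zip_tape [] [], Var 2 := zip_tape [] [Aux i]) = ts" by auto
  then show ?case using 1 by (auto simp: guide_def intro: run_exit simp del: load_Var)
next
  case (2 trs i c w)
  show ?case
  proof (cases "Suc i < length trs")
    case True
    let ?ts = "ts(Var 0 := zip_tape [] (map Bit w), Var 2 := zip_tape [] [Aux (Suc i)])"
    have eq: "?ts(Var 0 := t, Var 2 := t') = ts(Var 0 := t, Var 2 := t')" for t t'
      by auto
    have rest: "run (guide M trs) (load 0 c ?ts) (2 * length w + 1)
      (case follow trs (Suc i) c w of None \<Rightarrow> {}
       | Some (i', c') \<Rightarrow> {load 0 c' (?ts(Var 0 := zip_tape [] [], Var 2 := zip_tape [] [Aux i']))})"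
      by (rule 2(1)) (use 2 True in auto)
    have "run (guide M trs) (load 0 c ts) (1 + (2 * length w + 1) + 1)
      (case follow trs (Suc i) c w of None \<Rightarrow> {}
       | Some (i', c') \<Rightarrow> {load 0 c' (?ts(Var 0 := zip_tape [] [], Var 2 := zip_tape [] [Aux i']))})"
      unfolding guide_def
      by (rule run_loop[OF _ _ rest[unfolded guide_def]],
          use 2 in simp, rule run_Prim_single[where u = "[Var 0 \<mapsto> (Blank, MoveRight), Var 2 \<mapsto> (Aux (Suc i), Stay)]"])
        (use 2 True in auto)
    then have "run (guide M trs) (load 0 c ts) (2 * length (True # w) + 1)
      (case follow trs (Suc i) c w of None \<Rightarrow> {}
       | Some (i', c') \<Rightarrow> {load 0 c' (ts(Var 0 := zip_tape [] [], Var 2 := zip_tape [] [Aux i']))})"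
      unfolding eq by (rule run_mono) simp
    then show ?thesis using True by (simp split: option.split)
  next
    case False
    have "run (guide M trs) (load 0 c ts) (1 + 0 + 1) {}"
      unfolding guide_def
      by (rule run_loop_stuck, use 2 in simp, rule run_Prim_stuck) (use 2 False in auto)
    then have "run (guide M trs) (load 0 c ts) (2 * length (True # w) + 1) {}" by (rule run_mono) simp
    then show ?thesis using False by simp
  qed
next
  case (3 trs i c w)
  let ?t = "trs ! i"
  let ?c = "(snd (snd ?t), map2 act (fst (snd ?t)) (snd c))"
  let ?ok = "i < length trs \<and> fst ?t = fst c \<and> map fst (fst (snd ?t)) = map (\<lambda>t. t 0) (snd c)"
  have en: "i < length trs \<and> ?t \<in> enabled M 0 (scanned (load 0 c ts)) \<longleftrightarrow> ?ok"
    using 3 by (auto simp: enabled_load dest: nth_mem)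
  show ?case
  proof (cases ?ok)
    case True
    have len: "length (fst (snd ?t)) = length (snd c)" using True by (metis length_map)
    let ?ts = "ts(Var 0 := zip_tape [] (map Bit w), Var 2 := zip_tape [] [Aux 0])"
    have eq: "?ts(Var 0 := t, Var 2 := t') = ts(Var 0 := t, Var 2 := t')" for t t'
      by auto
    have rest: "run (guide M trs) (load 0 ?c ?ts) (2 * length w + 1)
      (case follow trs 0 ?c w of None \<Rightarrow> {}
       | Some (i', c') \<Rightarrow> {load 0 c' (?ts(Var 0 := zip_tape [] [], Var 2 := zip_tape [] [Aux i']))})"
      by (rule 3(1)) (use 3 True len in auto)
    let ?u = "(effect 0 ?t)(Var 0 \<mapsto> (Blank, MoveRight), Var 2 \<mapsto> (Aux 0, Stay))"
    have upd: "load 0 ?c ?ts = upd ?u (load 0 c ts)"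
      using upd_effect[OF len, of 0 "fst ?t" "snd (snd ?t)" ts] 3 by simp
    have "run (guide M trs) (load 0 c ts) (1 + (2 * length w + 1) + 1)
      (case follow trs 0 ?c w of None \<Rightarrow> {}
       | Some (i', c') \<Rightarrow> {load 0 c' (?ts(Var 0 := zip_tape [] [], Var 2 := zip_tape [] [Aux i']))})"
      unfolding guide_def
      by (rule run_loop[OF _ _ rest[unfolded guide_def]],
          use 3 in simp, rule run_Prim_single[where u = ?u, OF _ upd]) (use 3 True en in auto)
    then have "run (guide M trs) (load 0 c ts) (2 * length (False # w) + 1)
      (case follow trs 0 ?c w of None \<Rightarrow> {}
       | Some (i', c') \<Rightarrow> {load 0 c' (ts(Var 0 := zip_tape [] [], Var 2 := zip_tape [] [Aux i']))})"
      unfolding eq by (rule run_mono) simp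
    then show ?thesis using True by (simp split: option.split)
  next
    case False
    have "run (guide M trs) (load 0 c ts) (1 + 0 + 1) {}"
      unfolding guide_def
      by (rule run_loop_stuck, use 3 in simp, rule run_Prim_stuck) (use 3 False en in auto)
    then have "run (guide M trs) (load 0 c ts) (2 * length (False # w) + 1) {}" by (rule run_mono) simp
    then show ?thesis unfolding follow.simps if_not_P[OF False] by simp
  qed
qed

definition leads_to_acceptance :: "nat tm \<Rightarrow> transition list \<Rightarrow> str \<Rightarrow> str \<Rightarrow> bool" where
  "leads_to_acceptance M trs x w \<longleftrightarrow>
     (\<exists>c. follow trs 0 (initial M x) w = Some (0, c) \<and> halting M c \<and> fst c \<in> accepting M)"

text \<open>A program that maps a pair \<open>(x, w)\<close> to \<open>x\<close> if \<open>w\<close> leads \<open>M\<close> from \<open>x\<close> to acceptance, and blocks otherwise. Splitting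
the pair puts \<open>x\<close> on the input tape of the simulated machine and on \<open>Var 1\<close>, from where it is output in the end.\<close>

definition verifier :: "nat tm \<Rightarrow> transition list \<Rightarrow> com" where
  "verifier M trs =
    Seq (split_pair {Var 1, Blk 0 0})
   (Seq (rewind (Var 1) {Var 1, Blk 0 0})
   (Seq (stamp {State 0} (Aux (start M)) Stay)
   (Seq (stamp {Var 2} (Aux 0) Stay)
   (Seq (guide M trs)
   (Seq (assertion (\<lambda>s. s (Var 2) = Aux 0 \<and> enabled M 0 s = {} \<and> accepts M 0 s))
   (Seq (copy (Var 1) {Var 0})
        (rewind (Var 0) {Var 0})))))))"

lemma verifier_wf: "turing_machine M \<Longrightarrow> finitary (verifier M trs)" "turing_machine M \<Longrightarrow> det (verifier M trs)"
  by (auto simp: verifier_def guide_wf)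

lemma run_verifier_pair:
  assumes M: "turing_machine M" "set trs \<subseteq> transitions M" and z: "z = pair x w"
  shows "\<exists>ts. ts (Var 0) = string_tape x \<and>
    run (verifier M trs) (input z) (10 * length z + 40) (if leads_to_acceptance M trs x w then {ts} else {})"
proof -
  define ts1 where "ts1 = override_on ((input z)(Var 0 := zip_tape [] (map Bit w)))
    (\<lambda>_. zip_tape (rev (map Bit x)) []) {Var 1, Blk 0 0}"
  have 1: "run (split_pair {Var 1, Blk 0 0}) (input z) (2 * length z + 8) {ts1}"
    unfolding z ts1_def
    by (rule run_result[OF run_split_pair[where l = "\<lambda>_. []"]]) (auto simp: input_Var0 input_other)
  define ts2 where "ts2 = override_on ts1 (\<lambda>_. zip_tape [] (map Bit x)) {Var 1, Blk 0 0}"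
  have 2: "run (rewind (Var 1) {Var 1, Blk 0 0}) ts1 (2 * length x + 5) {ts2}"
    unfolding ts2_def by (rule run_rewind) (auto simp: ts1_def)
  have "ready M 0 x ts2" by (auto simp: ready_def ts2_def ts1_def input_other override_on_def)
  then have 3: "run (stamp {State 0} (Aux (start M)) Stay) ts2 1 {load 0 (initial M x) ts2}"
    using load_initial[OF M(1)] run_stamp by metis
  define ts4 where "ts4 = ts2(Var 2 := zip_tape [] [Aux 0])"
  have 4: "run (stamp {Var 2} (Aux 0) Stay) (load 0 (initial M x) ts2) 1 {load 0 (initial M x) ts4}"
  proof (rule run_result[OF run_stamp], rule ext)
    have "ts2 (Var 2) = zip_tape [] []" by (simp add: ts2_def ts1_def input_other)
    then show "override_on (load 0 (initial M x) ts2)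
        (\<lambda>i. put (Aux 0, Stay) (load 0 (initial M x) ts2 i)) {Var 2} i = load 0 (initial M x) ts4 i" for i
      by (simp add: ts4_def override_on_def)
  qed
  have len: "length (snd (initial M x)) = tapes M"
    using M by (auto simp: initial_def turing_machine_def)
  have "ts4 (Var 0) = zip_tape [] (map Bit w)" "ts4 (Var 2) = zip_tape [] [Aux 0]"
    by (auto simp: ts4_def ts2_def ts1_def)
  note 5 = run_guide[OF M len this]
  define ts8 where "ts8 = (\<lambda>c. override_on ((load 0 c ts2)(Var 1 := zip_tape (rev (map Bit x)) [],
      Var 2 := zip_tape [] [Aux 0])) (\<lambda>_. zip_tape [] (map Bit x)) {Var 0})"
  let ?tail = "Seq (assertion (\<lambda>s. s (Var 2) = Aux 0 \<and> enabled M 0 s = {} \<and> accepts M 0 s))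
   (Seq (copy (Var 1) {Var 0}) (rewind (Var 0) {Var 0}))"
  let ?g = "\<lambda>s. s (Var 2) = Aux 0 \<and> enabled M 0 s = {} \<and> accepts M 0 s"
  have tail: "run ?tail (load 0 c (ts4(Var 0 := zip_tape [] [], Var 2 := zip_tape [] [Aux i]))) (4 * length x + 9)
      (if i = 0 \<and> halting M c \<and> fst c \<in> accepting M then {ts8 c} else {})"
    if lc: "length (snd c) = tapes M" for i c
  proof -
    let ?ts = "load 0 c (ts4(Var 0 := zip_tape [] [], Var 2 := zip_tape [] [Aux i]))"
    let ?ts6 = "override_on (?ts(Var 1 := zip_tape (rev (map Bit x)) [])) (\<lambda>_. zip_tape (rev (map Bit x)) []) {Var 0}"
    let ?ts7 = "override_on ?ts6 (\<lambda>_. zip_tape [] (map Bit x)) {Var 0}"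
    have t1: "?ts (Var 1) = zip_tape [] (map Bit x)" by (simp add: ts4_def ts2_def)
    have "run (copy (Var 1) {Var 0}) ?ts (2 * length x + 1) {?ts6}"
      by (rule run_result[OF run_copy_zip[where l = "\<lambda>_. []" and l' = "[]"]])
        (use t1 in \<open>simp_all only: append_Nil2 load_simps fun_upd_apply singleton_iff, simp_all\<close>)
    moreover have "run (rewind (Var 0) {Var 0}) ?ts6 (2 * length x + 5) {?ts7}"
      by (rule run_rewind) auto
    ultimately have "run (Seq (copy (Var 1) {Var 0}) (rewind (Var 0) {Var 0})) ?ts
        (2 * length x + 1 + (2 * length x + 5) + 1) {?ts7}" by (rule run_then)
    then have r: "run ?tail ?ts (2 * length x + 1 + (2 * length x + 5) + 1 + 2) (if ?g (scanned ?ts) then {?ts7} else {})"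
      by (rule run_assert_then)
    have g: "?g (scanned ?ts) \<longleftrightarrow> i = 0 \<and> halting M c \<and> fst c \<in> accepting M"
      unfolding accepts_load halting_enabled[OF lc, where b = 0 and
          ts = "ts4(Var 0 := zip_tape [] [], Var 2 := zip_tape [] [Aux i])"] by auto
    have "?ts7 = ts8 c" if "i = 0"
      by (rule ext) (auto simp: ts8_def ts4_def override_on_def that)
    then have "(if ?g (scanned ?ts) then {?ts7} else {}) =
        (if i = 0 \<and> halting M c \<and> fst c \<in> accepting M then {ts8 c} else {})" unfolding g by auto
    with r show ?thesis by (simp add: add_ac)
  qed
  have follow_len: "length (snd c') = tapes M" if "follow trs 0 (initial M x) w = Some (i, c')" for i c'
  proof -
    have "follow trs j c v = Some (i, c') \<Longrightarrow> length (snd c) = tapes M \<Longrightarrow> length (snd c') = tapes M" for j c v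
      by (induction trs j c v rule: follow.induct) (auto split: if_splits dest: map_eq_imp_length_eq)
    with that len show ?thesis by blast
  qed
  let ?acc = "leads_to_acceptance M trs x w"
  have "\<exists>ts. ts (Var 0) = string_tape x \<and> run (Seq (guide M trs) ?tail) (load 0 (initial M x) ts4)
      (2 * length w + 1 + (4 * length x + 9) + 1) (if ?acc then {ts} else {})"
  proof (cases "follow trs 0 (initial M x) w")
    case None
    then have "run (guide M trs) (load 0 (initial M x) ts4) (2 * length w + 1) {}" using 5 by simp
    from run_stuck[OF this] have "run (Seq (guide M trs) ?tail) (load 0 (initial M x) ts4)
      (2 * length w + 1 + (4 * length x + 9) + 1) {}" .
    moreover have "\<not> ?acc" using None by (simp add: leads_to_acceptance_def)
    ultimately show ?thesis by auto
  next
    case (Some ic)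
    obtain i c where ic: "follow trs 0 (initial M x) w = Some (i, c)" using Some by (cases ic) auto
    have acc: "?acc \<longleftrightarrow> i = 0 \<and> halting M c \<and> fst c \<in> accepting M"
      by (auto simp: leads_to_acceptance_def ic)
    have "run (guide M trs) (load 0 (initial M x) ts4) (2 * length w + 1)
        {load 0 c (ts4(Var 0 := zip_tape [] [], Var 2 := zip_tape [] [Aux i]))}" using 5 ic by simp
    from run_then[OF this tail[OF follow_len[OF ic]]]
    have "run (Seq (guide M trs) ?tail) (load 0 (initial M x) ts4)
      (2 * length w + 1 + (4 * length x + 9) + 1) (if ?acc then {ts8 c} else {})" unfolding acc .
    moreover have "ts8 c (Var 0) = string_tape x" by (simp add: ts8_def string_tape_zip)
    ultimately show ?thesis by blast
  qed
  then obtain ts where ts: "ts (Var 0) = string_tape x" and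
    r: "run (Seq (guide M trs) ?tail) (load 0 (initial M x) ts4)
      (2 * length w + 1 + (4 * length x + 9) + 1) (if ?acc then {ts} else {})" by blast
  have "run (verifier M trs) (input z) (2 * length z + 8 + (2 * length x + 5 + (1 + (1 +
      (2 * length w + 1 + (4 * length x + 9) + 1) + 1) + 1) + 1) + 1) (if ?acc then {ts} else {})"
    unfolding verifier_def by (intro run_then[OF 1] run_then[OF 2] run_then[OF 3] run_then[OF 4] r)
  then have "run (verifier M trs) (input z) (10 * length z + 40) (if ?acc then {ts} else {})"
    by (rule run_mono) (simp add: z length_pair)
  with ts show ?thesis by blast
qed

definition verified :: "nat tm \<Rightarrow> transition list \<Rightarrow> str \<rightharpoonup> str" where
  "verified M trs z = (if \<exists>x w. z = pair x w \<and> leads_to_acceptance M trs x w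
     then Some (THE x. \<exists>w. z = pair x w) else None)"

lemma verified_Some: "verified M trs z = Some x \<longleftrightarrow> (\<exists>w. z = pair x w \<and> leads_to_acceptance M trs x w)"
proof -
  have "(THE y. \<exists>w. pair x w = pair y w) = x" for x w by (auto simp: pair_inject)
  then show ?thesis by (auto simp: verified_def pair_inject)
qed

text \<open>The image of the verified function consists of the inputs for which some choice string leads to acceptance.\<close>

theorem language_as_range:
  assumes "M \<in> NTM_poly"
  obtains f where "f \<in> carrier fP" "ran f = language M"
proof -
  have M: "turing_machine M" using assms by (simp add: NTM_poly_def)
  then obtain trs where trs: "set trs = transitions M"
    using finite_list[of "transitions M"] unfolding turing_machine_def by blast
  obtain p :: "nat poly" where p: "\<And>x n c. (initial M x, c) \<in> steps M ^^ n \<Longrightarrow> n \<le> poly p (length x)"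
    using assms unfolding NTM_poly_def polynomial_time_def by blast
  let ?f = "verified M trs"
  have "x \<in> ran ?f \<longleftrightarrow> x \<in> language M" for x
  proof
    assume "x \<in> ran ?f"
    then obtain w c where c: "follow trs 0 (initial M x) w = Some (0, c)" "halting M c" "fst c \<in> accepting M"
      by (auto simp: ran_def verified_Some leads_to_acceptance_def)
    from follow_sound[OF _ c(1), of M] trs obtain n where "(initial M x, c) \<in> steps M ^^ n" by auto
    with c(2,3) have "accepting_result M x c"
      unfolding accepting_result_def by (simp add: relpow_imp_rtrancl)
    then show "x \<in> language M" unfolding language_def by blast
  next
    assume "x \<in> language M"
    then obtain c where c: "(initial M x, c) \<in> (steps M)\<^sup>*" "halting M c" "fst c \<in> accepting M"
      unfolding language_def accepting_result_def mem_Collect_eq by (elim exE conjE)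
    from rtrancl_imp_relpow[OF c(1)] obtain n where "(initial M x, c) \<in> steps M ^^ n" ..
    from follow_complete[OF _ this, of trs] trs obtain w where "follow trs 0 (initial M x) w = Some (0, c)"
      by auto
    with c have "leads_to_acceptance M trs x w" by (auto simp: leads_to_acceptance_def)
    then have "?f (pair x w) = Some x" by (auto simp: verified_Some)
    then show "x \<in> ran ?f" by (rule ranI)
  qed
  then have ran: "ran ?f = language M" by blast
  have balanced: "polynomially_balanced ?f"
    unfolding polynomially_balanced_def
  proof (intro exI allI impI)
    fix z x assume "?f z = Some x"
    then obtain w c where z: "z = pair x w" and f: "follow trs 0 (initial M x) w = Some (0, c)"
      by (auto simp: verified_Some leads_to_acceptance_def)
    from follow_sound[OF _ f, of M] trs obtain n where n: "(initial M x, c) \<in> steps M ^^ n"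
      "length w \<le> length trs * n" by auto
    with p[OF n(1)] have "length w \<le> length trs * poly p (length x)" by (meson mult_le_mono2 order_trans)
    then show "length x \<le> poly [:0, 1:] (length z) \<and>
        length z \<le> poly ([:1, 2:] + smult (length trs) p) (length x)"
      by (simp add: z length_pair)
  qed
  have "\<exists>V \<in> DTM_poly. computes V ?f"
  proof (rule compile_function[OF verifier_wf[OF M]])
    show "poly_bounded (\<lambda>n. 10 * n + 40)"
      by (intro poly_bounded_add poly_bounded_mult poly_bounded_const poly_bounded_id)
    fix z x assume "?f z = Some x"
    then obtain w where "z = pair x w" "leads_to_acceptance M trs x w" by (auto simp: verified_Some)
    with run_verifier_pair[OF M _ this(1), of trs] trs
    show "\<exists>ts. ts (Var 0) = string_tape x \<and> run (verifier M trs) (input z) (10 * length z + 40) {ts}"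
      by simp
  next
    fix z assume None: "?f z = None"
    show "run (verifier M trs) (input z) (10 * length z + 40) {}"
    proof (cases "\<exists>x w. z = pair x w")
      case True
      then obtain x w where z: "z = pair x w" by blast
      with None have "\<not> leads_to_acceptance M trs x w" using verified_Some[of M trs z x] by auto
      with run_verifier_pair[OF M _ z, of trs] trs show ?thesis by auto
    next
      case False
      have "run (split_pair {Var 1, Blk 0 0}) (input z) (2 * length z + 8) {}"
        by (rule run_split_pair_fails[where l = "\<lambda>_. []"]) (use False in \<open>auto simp: input_Var0 input_other\<close>)
      from run_stuck[OF this] have "run (verifier M trs) (input z) (2 * length z + 8 + 0 + 1) {}"
        unfolding verifier_def .
      then show ?thesis by (rule run_mono) simp
    qed
  qed
  with balanced have "?f \<in> carrier fP" by (simp add: fP_def)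
  from that[OF this ran] show ?thesis .
qed

section \<open>Inverting functions decides NP\<close>

text \<open>Tests whether the string on tape \<open>c\<close> is the value of the function computed by \<open>F\<close> at the string just written on
the first tape of block \<open>b\<close>. An accepting run of \<open>F\<close> leaves nothing but the value on this tape, so a
comparison from the head rightwards is enough.\<close>

definition evaluates_to :: "nat tm \<Rightarrow> nat \<Rightarrow> tape_name \<Rightarrow> com" where
  "evaluates_to F b c =
    Seq (rewind (Blk b 0) {Blk b 0})
   (Seq (call F b)
   (Seq (assertion (accepts F b)) (compare c (Blk b 0))))"

lemma evaluates_to_wf [simp]:
  "F \<in> DTM_poly \<Longrightarrow> finitary (evaluates_to F b c)" "F \<in> DTM_poly \<Longrightarrow> det (evaluates_to F b c)"
  by (simp_all add: evaluates_to_def DTM_polyD)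

lemma run_evaluates_to:
  assumes F: "F \<in> DTM_poly" "computes F f" and m: "halts_after F z m"
    and ts: "ts (Blk b 0) = zip_tape (rev (map Bit z)) []" "\<And>j. 0 < j \<Longrightarrow> ts (Blk b j) = zip_tape [] []"
      "ts (State b) = zip_tape [] []" "ts Counter = zip_tape l []" "ts (Var n) = zip_tape [] (map Bit x)"
  shows "\<exists>S. run (evaluates_to F b (Var n)) ts (2 * length z + 2 * m + 2 * length x + 15) S \<and>
    (S \<noteq> {} \<longleftrightarrow> f z = Some x)"
proof -
  define ts1 where "ts1 = override_on ts (\<lambda>_. zip_tape [] (map Bit z)) {Blk b 0}"
  have 1: "run (rewind (Blk b 0) {Blk b 0}) ts (2 * length z + 5) {ts1}"
    unfolding ts1_def by (rule run_rewind) (use ts(1) in auto)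
  define ts2 where "ts2 = load b (final F z) (ts1(Counter := zip_tape (replicate m (Aux 0) @ l) []))"
  have "ready F b z ts1" using ts by (auto simp: ready_def ts1_def override_on_def)
  moreover have "ts1 Counter = zip_tape l []" using ts by (simp add: ts1_def)
  ultimately have 2: "run (call F b) ts1 (2 * m + 3) {ts2}"
    unfolding ts2_def by (rule run_call[OF F(1) m])
  have x: "ts2 (Var n) = zip_tape [] (map Bit x)"
    using ts by (simp add: ts2_def ts1_def)
  have out: "ts2 (Blk b 0) = hd (snd (final F z))"
    using final_tapes(1,3)[OF F(1) m] tapes_pos[OF F(1)] by (simp add: ts2_def)
  have acc: "accepts F b (scanned ts2) \<longleftrightarrow> f z \<noteq> None"
    unfolding ts2_def accepts_load using computes_final(1)[OF F] .
  have "\<exists>S. run (compare (Var n) (Blk b 0)) ts2 (2 * length x + 3) S \<and> (S \<noteq> {} \<longleftrightarrow> f z = Some x)" if "f z \<noteq> None"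
  proof -
    from that obtain y where y: "f z = Some y" by blast
    have "ts2 (Blk b 0) = zip_tape [] (map Bit y)"
      using out computes_final(2)[OF F y] by (simp add: string_tape_zip)
    from run_compare[OF _ x this] show ?thesis using y by auto
  qed
  then obtain S where S: "f z \<noteq> None \<Longrightarrow> run (compare (Var n) (Blk b 0)) ts2 (2 * length x + 3) S"
    "f z \<noteq> None \<Longrightarrow> S \<noteq> {} \<longleftrightarrow> f z = Some x" by blast
  let ?S = "if accepts F b (scanned ts2) then S else {}"
  have "run (Seq (assertion (accepts F b)) (compare (Var n) (Blk b 0))) ts2 (2 * length x + 3 + 2) ?S"
    by (rule run_assert_then) (use S(1) acc in simp)
  then have "run (evaluates_to F b (Var n)) ts (2 * length z + 5 + (2 * m + 3 + (2 * length x + 3 + 2) + 1) + 1) ?S"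
    unfolding evaluates_to_def by (intro run_then[OF 1] run_then[OF 2])
  then have "run (evaluates_to F b (Var n)) ts (2 * length z + 2 * m + 2 * length x + 15) ?S"
    by (rule run_mono) simp
  moreover have "?S \<noteq> {} \<longleftrightarrow> f z = Some x" using acc S(2) by auto
  ultimately show ?thesis by blast
qed

text \<open>The result of \<open>M\<close> may be arbitrary when \<open>x\<close> has no preimage. Copying only a block of bits to a fresh tape gives
\<open>F\<close> a proper input, on which its time bound applies.\<close>

definition check_inverse :: "nat tm \<Rightarrow> nat tm \<Rightarrow> com" where
  "check_inverse M F =
    Seq (copy (Var 0) {Blk 0 0})
   (Seq (rewind (Var 0) {Var 0, Blk 0 0})
   (Seq (call M 0)
   (Seq (assertion (accepts M 0))
   (Seq (copy (Blk 0 0) {Blk 1 0})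
        (evaluates_to F 1 (Var 0))))))"

lemma check_inverse_wf:
  assumes "M \<in> DTM_poly" "F \<in> DTM_poly"
  shows "finitary (check_inverse M F)" "det (check_inverse M F)"
  using assms by (simp_all add: check_inverse_def DTM_polyD)

lemma decidable_inverse_check:
  assumes M: "M \<in> DTM_poly" and F: "F \<in> DTM_poly" "computes F f"
  shows "\<exists>D \<in> DTM_poly. language D = {x. fst (final M x) \<in> accepting M \<and>
    (\<exists>z. bits_from (hd (snd (final M x))) z \<and> f z = Some x)}"
proof -
  let ?L = "{x. fst (final M x) \<in> accepting M \<and> (\<exists>z. bits_from (hd (snd (final M x))) z \<and> f z = Some x)}"
  obtain p :: "nat poly" where p: "\<And>x. \<exists>m \<le> poly p (length x). halts_after M x m"
    using DTM_poly_halts[OF M] by blast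
  obtain q :: "nat poly" where q: "\<And>z. \<exists>k \<le> poly q (length z). halts_after F z k"
    using DTM_poly_halts[OF F(1)] by blast
  \<comment> \<open>bounds the number of cells from the head of M rightwards that can hold a bit\<close>
  define K where "K = (\<lambda>n. n + poly p n + 1)"
  define T where "T = (\<lambda>n. 6 * n + 2 * poly p n + 4 * K n + 2 * poly q (K n) + 40)"
  have T: "poly_bounded T"
    unfolding T_def K_def by (intro poly_bounded_add poly_bounded_mult poly_bounded_comp
        poly_bounded_const poly_bounded_id poly_bounded_poly)
  have "\<exists>S. run (check_inverse M F) (input x) (T (length x)) S \<and> (S \<noteq> {} \<longleftrightarrow> x \<in> ?L)" for x
  proof -
    let ?n = "length x"
    from p[of x] obtain m where m: "m \<le> poly p ?n" and halts: "halts_after M x m" by blast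
    note len = final_tapes(1)[OF M halts] and blank = final_tapes(2)[OF M halts]
      and hd = final_tapes(3,4)[OF M halts]
    obtain z where z: "bits_from (hd (snd (final M x))) z" "length z \<le> K ?n"
      using bits_from_exists[of "?n + m + 1" "hd (snd (final M x))"] blank[OF hd(2)] m
      by (fastforce simp: K_def)
    define ts1 where "ts1 = override_on ((input x)(Var 0 := zip_tape (rev (map Bit x)) []))
      (\<lambda>_. zip_tape (rev (map Bit x)) []) {Blk 0 0}"
    have 1: "run (copy (Var 0) {Blk 0 0}) (input x) (2 * ?n + 1) {ts1}"
      by (rule run_result[OF run_copy_zip[where l = "\<lambda>_. []" and l' = "[]"]])
        (auto simp: ts1_def input_Var0 input_other)
    define ts2 where "ts2 = override_on ts1 (\<lambda>_. zip_tape [] (map Bit x)) {Var 0, Blk 0 0}"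
    have 2: "run (rewind (Var 0) {Var 0, Blk 0 0}) ts1 (2 * ?n + 5) {ts2}"
      unfolding ts2_def by (rule run_rewind) (auto simp: ts1_def)
    define ts3 where "ts3 = load 0 (final M x) (ts2(Counter := zip_tape (replicate m (Aux 0) @ []) []))"
    have "ready M 0 x ts2" "ts2 Counter = zip_tape [] []"
      by (auto simp: ready_def ts2_def ts1_def input_other override_on_def)
    from run_call[OF M halts this] have 3: "run (call M 0) ts2 (2 * m + 3) {ts3}" unfolding ts3_def .
    define ts4 where "ts4 = override_on (ts3(Blk 0 0 := (move_head MoveRight ^^ length z) (ts3 (Blk 0 0))))
      (\<lambda>_. zip_tape (rev (map Bit z)) []) {Blk 1 0}"
    have ts3_Blk: "ts3 (Blk 0 0) = hd (snd (final M x))" using hd(1) len tapes_pos[OF M] by (simp add: ts3_def)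
    have ts3_other: "ts3 (Blk 1 j) = zip_tape [] []" "ts3 (State 1) = zip_tape [] []" for j
      by (simp_all add: ts3_def ts2_def ts1_def input_other)
    have 4: "run (copy (Blk 0 0) {Blk 1 0}) ts3 (2 * length z + 1) {ts4}"
      by (rule run_result[OF run_copy[where l = "\<lambda>_. []"]])
        (use z(1) ts3_Blk ts3_other in \<open>simp_all add: ts4_def\<close>)
    from q[of z] obtain k where k: "k \<le> poly q (length z)" "halts_after F z k" by blast
    have "\<exists>S. run (evaluates_to F 1 (Var 0)) ts4 (2 * length z + 2 * k + 2 * ?n + 15) S \<and>
      (S \<noteq> {} \<longleftrightarrow> f z = Some x)"
    proof (rule run_evaluates_to[OF F k(2)])
      show "ts4 Counter = zip_tape (replicate m (Aux 0) @ []) []" by (simp add: ts4_def ts3_def)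
      show "ts4 (Var 0) = zip_tape [] (map Bit x)" by (simp add: ts4_def ts3_def ts2_def)
    qed (use ts3_other in \<open>simp_all add: ts4_def\<close>)
    then obtain S where S: "run (evaluates_to F 1 (Var 0)) ts4 (2 * length z + 2 * k + 2 * ?n + 15) S"
      "S \<noteq> {} \<longleftrightarrow> f z = Some x" by blast
    let ?S = "if accepts M 0 (scanned ts3) then S else {}"
    have "run (check_inverse M F) (input x) (2 * ?n + 1 + (2 * ?n + 5 + (2 * m + 3 +
      (2 * length z + 1 + (2 * length z + 2 * k + 2 * ?n + 15) + 1 + 2) + 1) + 1) + 1) ?S"
      unfolding check_inverse_def
      by (intro run_then[OF 1] run_then[OF 2] run_then[OF 3] run_assert_then run_then[OF 4] S(1))
    moreover have "k \<le> poly q (K ?n)" using k(1) poly_mono_nat[OF z(2), of q] by simp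
    ultimately have "run (check_inverse M F) (input x) (T ?n) ?S"
      by (elim run_mono) (use m z(2) in \<open>simp add: T_def\<close>)
    moreover have "accepts M 0 (scanned ts3) \<longleftrightarrow> fst (final M x) \<in> accepting M"
      unfolding ts3_def by (rule accepts_load)
    then have "?S \<noteq> {} \<longleftrightarrow> fst (final M x) \<in> accepting M \<and> f z = Some x" using S(2) by auto
    then have "?S \<noteq> {} \<longleftrightarrow> x \<in> ?L" using bits_from_unique[OF z(1)] z(1) by blast
    ultimately show ?thesis by blast
  qed
  then show ?thesis
  proof (rule compile_acceptor[OF check_inverse_wf(1)[OF M F(1)] T])
    fix D
    assume D: "det (check_inverse M F) \<Longrightarrow> D \<in> DTM_poly" "language D = ?L"
    show ?thesis
      by (rule bexI[of _ D], rule D(2), rule D(1)[OF check_inverse_wf(2)[OF M F(1)]])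
  qed
qed

text \<open>An inverter for a function with image \<open>L\<close> yields a preimage for every element of \<open>L\<close>. Conversely every \<open>x\<close>
that passes the final comparison is in the image, whatever the inverter did.\<close>

theorem P_eq_NP_if_no_one_way:
  assumes "\<nexists>f. one_way f" shows "class_P = class_NP"
proof
  show "class_P \<subseteq> class_NP" by (auto simp: class_P_def class_NP_def DTM_poly_def)
  show "class_NP \<subseteq> class_P"
  proof
    fix L assume "L \<in> class_NP"
    then obtain N where "N \<in> NTM_poly" "L = language N" by (auto simp: class_NP_def)
    then obtain f where f: "f \<in> carrier fP" "ran f = L" using language_as_range by metis
    with assms obtain M where M: "M \<in> DTM_poly" "\<And>y. y \<in> L \<Longrightarrow> \<exists>x. outputs M y x \<and> f x = Some y"
      unfolding one_way_def by metis
    from f obtain F where F: "F \<in> DTM_poly" "computes F f" by (auto simp: fP_def)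
    from decidable_inverse_check[OF M(1) F] obtain D where D: "D \<in> DTM_poly"
      "language D = {x. fst (final M x) \<in> accepting M \<and> (\<exists>z. bits_from (hd (snd (final M x))) z \<and> f z = Some x)}"
      by blast
    have "x \<in> language D \<longleftrightarrow> x \<in> L" for x
    proof
      assume "x \<in> language D"
      then have "x \<in> ran f" unfolding D(2) by (auto simp: ran_def)
      then show "x \<in> L" using f by simp
    next
      assume "x \<in> L"
      from M(2)[OF this] obtain z where z: "outputs M x z" "f z = Some x" by blast
      then have "bits_from (hd (snd (final M x))) z" "fst (final M x) \<in> accepting M"
        by (auto simp: outputs_final[OF M(1)] string_tape_zip bits_from_zip)
      with z(2) show "x \<in> language D" unfolding D(2) by blast
    qed
    then have "language D = L" by blast
    with D(1) show "L \<in> class_P" by (auto simp: class_P_def)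
  qed
qed

theorem no_one_way_if_regular:
  assumes "regular fP" shows "\<nexists>f. one_way f"
proof
  assume "\<exists>f. one_way f"
  then obtain f where f: "one_way f" ..
  then have "f \<in> carrier fP" by (simp add: one_way_def)
  with assms obtain g where g: "g \<in> carrier fP" "f \<circ>\<^sub>m g \<circ>\<^sub>m f = f"
    by (auto simp: regular_def fP_def)
  then obtain M where M: "M \<in> DTM_poly" "computes M g" by (auto simp: fP_def)
  have "\<exists>x. outputs M y x \<and> f x = Some y" if y: "y \<in> ran f" for y
  proof -
    from y obtain x where "f x = Some y" by (auto simp: ran_def)
    then have "(f \<circ>\<^sub>m g) y = Some y" using fun_cong[OF g(2), of x] by (simp add: map_comp_def)
    then obtain x' where "g y = Some x'" "f x' = Some y" by (auto simp: map_comp_def split: option.splits)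
    with M(2) show ?thesis by (auto simp: computes_def)
  qed
  with M(1) have "\<exists>M \<in> DTM_poly. \<forall>y \<in> ran f. \<exists>x. outputs M y x \<and> f x = Some y"
    by (intro bexI[of _ M] ballI)
  with f show False by (simp add: one_way_def)
qed

section \<open>Guessing a suffix\<close>

text \<open>The effect of guessing is described relative to the previous content of the tape, so that the outcomes of several
guesses compose (\<open>extensions_extensions\<close>).\<close>

abbreviation write_bits :: "str \<Rightarrow> tape \<Rightarrow> tape" where
  "write_bits v t \<equiv> fold (\<lambda>b. put (Bit b, MoveRight)) v t"

lemma write_bits_zip: "write_bits v (zip_tape l []) = zip_tape (rev (map Bit v) @ l) []"
  by (induction v arbitrary: l) auto

definition extensions :: "store \<Rightarrow> nat \<Rightarrow> store set" where
  "extensions ts n = {ts(Blk 0 0 := write_bits v (ts (Blk 0 0))) | v. length v \<le> n}"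

lemma extensions_0: "extensions ts 0 = {ts}"
  by (auto simp: extensions_def)

lemma extensions_other: "ts' \<in> extensions ts n \<Longrightarrow> i \<noteq> Blk 0 0 \<Longrightarrow> ts' i = ts i"
  by (auto simp: extensions_def)

lemma extensions_extensions:
  assumes "i \<noteq> Blk 0 0"
  shows "(\<Union>ts' \<in> extensions ts m. extensions (ts'(i := t)) n) = extensions (ts(i := t)) (m + n)"
proof (intro equalityI subsetI)
  fix s assume "s \<in> (\<Union>ts' \<in> extensions ts m. extensions (ts'(i := t)) n)"
  then obtain v w where v: "length v \<le> m" "length w \<le> n" and
    s: "s = (ts(Blk 0 0 := write_bits v (ts (Blk 0 0))))(i := t, Blk 0 0 := write_bits w (write_bits v (ts (Blk 0 0))))"
    using assms by (auto simp: extensions_def)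
  have "s = (ts(i := t))(Blk 0 0 := write_bits (v @ w) ((ts(i := t)) (Blk 0 0)))"
    using assms by (auto simp: s)
  moreover have "length (v @ w) \<le> m + n" using v by simp
  ultimately show "s \<in> extensions (ts(i := t)) (m + n)" unfolding extensions_def by blast
next
  fix s assume "s \<in> extensions (ts(i := t)) (m + n)"
  then obtain v where v: "length v \<le> m + n" and
    s: "s = (ts(i := t))(Blk 0 0 := write_bits v (ts (Blk 0 0)))" using assms by (auto simp: extensions_def)
  let ?s = "ts(Blk 0 0 := write_bits (take m v) (ts (Blk 0 0)))"
  have "?s \<in> extensions ts m" unfolding extensions_def by auto
  moreover have "write_bits v t = write_bits (drop m v) (write_bits (take m v) t)" for t
    using fold_append[of "\<lambda>b. put (Bit b, MoveRight)" "take m v" "drop m v"] by simp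
  then have "s = (?s(i := t))(Blk 0 0 := write_bits (drop m v) ((?s(i := t)) (Blk 0 0)))"
    using assms by (auto simp: s)
  moreover have "length (drop m v) \<le> n" using v by simp
  ultimately show "s \<in> (\<Union>ts' \<in> extensions ts m. extensions (ts'(i := t)) n)"
    unfolding extensions_def[of _ n] by blast
qed

definition guess_bit :: com where
  "guess_bit = Prim (\<lambda>_. {Map.empty, [Blk 0 0 \<mapsto> (Bit True, MoveRight)], [Blk 0 0 \<mapsto> (Bit False, MoveRight)]})"

lemma guess_bit_wf [simp]: "finitary guess_bit"
  by (auto simp: guess_bit_def bounded_prim_def intro!: exI[of _ "range Bit"] exI[of _ "{Blk 0 0}"] split: if_splits)

lemma run_guess_bit: "run guess_bit ts 1 (extensions ts 1)"
proof -
  have "extensions ts 1 = (\<lambda>u. upd u ts) `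
      {Map.empty, [Blk 0 0 \<mapsto> (Bit True, MoveRight)], [Blk 0 0 \<mapsto> (Bit False, MoveRight)]}"
  proof (intro equalityI subsetI)
    fix s assume "s \<in> extensions ts 1"
    then obtain v where "length v \<le> 1" "s = ts(Blk 0 0 := write_bits v (ts (Blk 0 0)))"
      by (auto simp: extensions_def)
    moreover from this(1) have "v = [] \<or> v = [True] \<or> v = [False]"
      by (cases v) auto
    ultimately show "s \<in> (\<lambda>u. upd u ts) `
      {Map.empty, [Blk 0 0 \<mapsto> (Bit True, MoveRight)], [Blk 0 0 \<mapsto> (Bit False, MoveRight)]}" by auto
  next
    fix s assume "s \<in> (\<lambda>u. upd u ts) `
      {Map.empty, [Blk 0 0 \<mapsto> (Bit True, MoveRight)], [Blk 0 0 \<mapsto> (Bit False, MoveRight)]}"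
    then have "s = ts(Blk 0 0 := write_bits [] (ts (Blk 0 0))) \<or> s = ts(Blk 0 0 := write_bits [True] (ts (Blk 0 0)))
      \<or> s = ts(Blk 0 0 := write_bits [False] (ts (Blk 0 0)))" by auto
    moreover have "length [] \<le> 1" "length [True] \<le> 1" "length [False] \<le> 1" by simp_all
    ultimately show "s \<in> extensions ts 1" unfolding extensions_def by blast
  qed
  then show ?thesis
    using run_Prim[of "\<lambda>_. {Map.empty, [Blk 0 0 \<mapsto> (Bit True, MoveRight)], [Blk 0 0 \<mapsto> (Bit False, MoveRight)]}" ts]
    unfolding guess_bit_def by (simp only:)
qed

definition clock :: "nat \<Rightarrow> tape_name" where
  "clock k = Var (k + 2)"

text \<open>The clock tapes all hold the string \<open>y\<close>. On level \<open>d + 1\<close> the guesses of level \<open>d\<close> are made twice outright and once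
for each letter of \<open>y\<close>, which allows up to \<open>(length y + 2) ^ d\<close> bits on level \<open>d\<close>. Every polynomial is dominated by
such a power (\<open>poly_le_power\<close>), so nested loops bound the guesses without any arithmetic on tapes.\<close>

fun guess :: "nat \<Rightarrow> com" where
  "guess 0 = guess_bit"
| "guess (Suc d) = Seq (guess d) (Seq (guess d)
     (Seq (While (\<lambda>s. s (clock d) \<noteq> Blank) (Seq (guess d) (shift {clock d} MoveRight)))
        (rewind (clock d) {clock d})))"

fun guess_time :: "nat \<Rightarrow> nat \<Rightarrow> nat" where
  "guess_time 0 n = 1"
| "guess_time (Suc d) n = (n + 2) * guess_time d n + 5 * n + 9"

lemma guess_wf [simp]: "finitary (guess d)"
  by (induction d) auto

lemma poly_bounded_guess_time: "poly_bounded (guess_time d)"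
proof (induction d)
  case 0
  have "guess_time 0 = (\<lambda>_. 1)" by auto
  then show ?case by auto
next
  case (Suc d)
  have "guess_time (Suc d) = (\<lambda>n. (n + 2) * guess_time d n + 5 * n + 9)" by auto
  with Suc show ?case
    by (auto intro!: poly_bounded_add poly_bounded_mult poly_bounded_const poly_bounded_id)
qed

text \<open>The body may rely on the tapes in \<open>J\<close> being unchanged; these are the clocks of the inner loops.\<close>

lemma run_guess_loop:
  assumes c: "c \<noteq> Blk 0 0"
    and body: "\<And>ts. (\<And>j. j \<in> J \<Longrightarrow> ts j = ts0 j) \<Longrightarrow> run a ts n (extensions ts k)"
    and J: "c \<notin> J" "Blk 0 0 \<notin> J"
  shows "ts c = zip_tape l (map Bit v) \<Longrightarrow> (\<And>j. j \<in> J \<Longrightarrow> ts j = ts0 j) \<Longrightarrow>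
    run (While (\<lambda>s. s c \<noteq> Blank) (Seq a (shift {c} MoveRight))) ts ((n + 3) * length v + 1)
      (extensions (ts(c := zip_tape (rev (map Bit v) @ l) [])) (length v * k))"
proof (induction v arbitrary: ts l)
  case Nil
  then have "ts(c := zip_tape l []) = ts" by auto
  then show ?case using Nil by (auto simp: extensions_0 intro: run_exit)
next
  case (Cons b v)
  let ?W = "While (\<lambda>s. s c \<noteq> Blank) (Seq a (shift {c} MoveRight))"
  let ?t1 = "zip_tape (Bit b # l) (map Bit v)"
  let ?t2 = "zip_tape (rev (map Bit (b # v)) @ l) []"
  have "run (shift {c} MoveRight) ts' 1 {ts'(c := ?t1)}" if "ts' \<in> extensions ts k" for ts'
  proof (rule run_result[OF run_shift])
    have "ts' c = zip_tape l (Bit b # map Bit v)" using extensions_other[OF that c] Cons.prems by simp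
    then show "override_on ts' (\<lambda>i. move_head MoveRight (ts' i)) {c} = ts'(c := ?t1)"
      by (auto simp: override_on_def move_head_zip)
  qed
  then have b: "run (Seq a (shift {c} MoveRight)) ts (n + 1 + 1) (\<Union>ts' \<in> extensions ts k. {ts'(c := ?t1)})"
    using body[of ts] Cons.prems(2) by (intro run_Seq) auto
  have rest: "run ?W ts'' ((n + 3) * length v + 1) (extensions (ts''(c := ?t2)) (length v * k))"
    if "ts'' \<in> (\<Union>ts' \<in> extensions ts k. {ts'(c := ?t1)})" for ts''
  proof -
    from that obtain ts' where ts': "ts' \<in> extensions ts k" "ts'' = ts'(c := ?t1)" by blast
    have "run ?W ts'' ((n + 3) * length v + 1) (extensions (ts''(c := zip_tape (rev (map Bit v) @ Bit b # l) [])) (length v * k))"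
    proof (rule Cons.IH)
      show "ts'' c = ?t1" by (simp add: ts')
      fix j assume "j \<in> J"
      then show "ts'' j = ts0 j" using J extensions_other[OF ts'(1), of j] Cons.prems(2)[of j]
        by (auto simp: ts'(2))
    qed
    then show ?thesis by simp
  qed
  have "run ?W ts (n + 1 + 1 + ((n + 3) * length v + 1) + 1)
      (\<Union>ts'' \<in> (\<Union>ts' \<in> extensions ts k. {ts'(c := ?t1)}). extensions (ts''(c := ?t2)) (length v * k))"
    by (rule run_While_True[OF _ b rest]) (use Cons.prems in simp)
  also have "(\<Union>ts'' \<in> (\<Union>ts' \<in> extensions ts k. {ts'(c := ?t1)}). extensions (ts''(c := ?t2)) (length v * k))
      = (\<Union>ts' \<in> extensions ts k. extensions (ts'(c := ?t2)) (length v * k))" by simp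
  also have "\<dots> = extensions (ts(c := ?t2)) (k + length v * k)" by (rule extensions_extensions[OF c])
  also have "k + length v * k = length (b # v) * k" by simp
  finally show ?case by (rule run_mono) simp
qed

lemma run_guess:
  "(\<And>k. k < d \<Longrightarrow> ts (clock k) = zip_tape [] (map Bit y)) \<Longrightarrow>
    run (guess d) ts (guess_time d (length y)) (extensions ts ((length y + 2) ^ d))"
proof (induction d arbitrary: ts)
  case 0
  then show ?case using run_guess_bit by simp
next
  case (Suc d)
  let ?n = "length y" and ?c = "clock d"
  let ?N = "(?n + 2) ^ d" and ?G = "guess_time d ?n"
  have c: "?c \<noteq> Blk 0 0" by (simp add: clock_def)
  let ?J = "clock ` {..<d}"
  have J: "?c \<notin> ?J" "Blk 0 0 \<notin> ?J" by (auto simp: clock_def)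
  have body: "run (guess d) ts' ?G (extensions ts' ?N)" if "\<And>j. j \<in> ?J \<Longrightarrow> ts' j = ts j" for ts'
    by (rule Suc.IH) (use that Suc.prems in auto)
  let ?W = "While (\<lambda>s. s ?c \<noteq> Blank) (Seq (guess d) (shift {?c} MoveRight))"
  let ?t = "zip_tape (rev (map Bit y)) []"
  have loop: "run ?W ts' ((?G + 3) * ?n + 1) (extensions (ts'(?c := ?t)) (?n * ?N))"
    if ts': "\<And>j. j \<noteq> Blk 0 0 \<Longrightarrow> ts' j = ts j" for ts'
  proof -
    have "ts' ?c = zip_tape [] (map Bit y)" using ts'[OF c] Suc.prems by simp
    moreover have "ts' j = ts j" if "j \<in> ?J" for j using that by (intro ts') (auto simp: clock_def)
    ultimately show ?thesis
      using run_guess_loop[of ?c ?J ts "guess d" ?G ?N ts' "[]" y, OF c body J] by simp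
  qed
  have restart: "run (rewind ?c {?c}) ts' (2 * ?n + 5) {ts'(?c := zip_tape [] (map Bit y))}"
    if "ts' ?c = ?t" for ts'
    by (rule run_result[OF run_rewind]) (use that in \<open>auto simp: override_on_def\<close>)
  have tail: "run (Seq ?W (rewind ?c {?c})) ts' ((?G + 3) * ?n + 1 + (2 * ?n + 5) + 1) (extensions ts' (?n * ?N))"
    if ts': "\<And>j. j \<noteq> Blk 0 0 \<Longrightarrow> ts' j = ts j" for ts'
  proof -
    have "run (Seq ?W (rewind ?c {?c})) ts' ((?G + 3) * ?n + 1 + (2 * ?n + 5) + 1)
        (\<Union>s \<in> extensions (ts'(?c := ?t)) (?n * ?N). {s(?c := zip_tape [] (map Bit y))})"
      by (rule run_Seq[OF loop[OF ts']], assumption, rule restart) (use extensions_other[OF _ c] in simp)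
    also have "(\<Union>s \<in> extensions (ts'(?c := ?t)) (?n * ?N). {s(?c := zip_tape [] (map Bit y))})
        = (\<Union>s \<in> extensions (ts'(?c := ?t)) (?n * ?N). extensions (s(?c := zip_tape [] (map Bit y))) 0)"
      by (simp add: extensions_0)
    also have "\<dots> = extensions (ts'(?c := ?t, ?c := zip_tape [] (map Bit y))) (?n * ?N + 0)"
      by (rule extensions_extensions[OF c])
    also have "ts'(?c := ?t, ?c := zip_tape [] (map Bit y)) = ts'"
      using ts'[OF c] Suc.prems by auto
    finally show ?thesis by simp
  qed
  have ext2: "(\<Union>ts' \<in> extensions s m. extensions ts' k) = extensions s (m + k)" for s m k
  proof -
    have "(\<Union>ts' \<in> extensions s m. extensions ts' k) = (\<Union>ts' \<in> extensions s m. extensions (ts'(?c := s ?c)) k)"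
      using extensions_other[OF _ c] by (auto simp: fun_upd_idem)
    also have "\<dots> = extensions (s(?c := s ?c)) (m + k)" by (rule extensions_extensions[OF c])
    finally show ?thesis by simp
  qed
  have second: "run (Seq (guess d) (Seq ?W (rewind ?c {?c}))) ts'
      (?G + ((?G + 3) * ?n + 1 + (2 * ?n + 5) + 1) + 1) (extensions ts' (?N + ?n * ?N))"
    if ts': "\<And>j. j \<noteq> Blk 0 0 \<Longrightarrow> ts' j = ts j" for ts'
    unfolding ext2[symmetric]
  proof (rule run_Seq)
    show "run (guess d) ts' ?G (extensions ts' ?N)" by (rule body, rule ts') (auto simp: clock_def)
    fix s assume "s \<in> extensions ts' ?N"
    then show "run (Seq ?W (rewind ?c {?c})) s ((?G + 3) * ?n + 1 + (2 * ?n + 5) + 1) (extensions s (?n * ?N))"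
      by (intro tail) (use extensions_other ts' in auto)
  qed
  have "run (guess (Suc d)) ts (?G + (?G + ((?G + 3) * ?n + 1 + (2 * ?n + 5) + 1) + 1) + 1)
      (extensions ts (?N + (?N + ?n * ?N)))"
    unfolding guess.simps ext2[symmetric, of ts ?N "?N + ?n * ?N"]
  proof (rule run_Seq)
    show "run (guess d) ts ?G (extensions ts ?N)" by (rule body) simp
    fix s assume "s \<in> extensions ts ?N"
    then show "run (Seq (guess d) (Seq ?W (rewind ?c {?c}))) s
      (?G + ((?G + 3) * ?n + 1 + (2 * ?n + 5) + 1) + 1) (extensions s (?N + ?n * ?N))"
      by (intro second) (use extensions_other in auto)
  qed
  also have "?N + (?N + ?n * ?N) = (?n + 2) ^ Suc d" by simp
  finally show ?case by (rule run_mono) (simp add: algebra_simps)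
qed

lemma poly_le_power: "\<exists>d. \<forall>n. poly q n \<le> (n + 2 :: nat) ^ d"
proof (induction q)
  case 0
  then show ?case by auto
next
  case (pCons a q)
  then obtain d where d: "\<And>n. poly q n \<le> (n + 2) ^ d" by blast
  let ?e = "max a d"
  have "poly (pCons a q) n \<le> (n + 2) ^ Suc ?e" for n
  proof -
    have "a \<le> 2 ^ a" by (simp add: less_imp_le)
    also have "\<dots> \<le> (n + 2) ^ a" by (rule power_mono) auto
    also have "\<dots> \<le> (n + 2) ^ ?e" by (rule power_increasing) auto
    finally have a: "a \<le> (n + 2) ^ ?e" .
    have "poly q n \<le> (n + 2) ^ d" by (rule d)
    also have "\<dots> \<le> (n + 2) ^ ?e" by (rule power_increasing) auto
    finally have "poly q n \<le> (n + 2) ^ ?e" .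
    then have "poly (pCons a q) n \<le> (n + 2) ^ ?e + n * (n + 2) ^ ?e" using a by (simp add: add_mono)
    also have "\<dots> \<le> (n + 2) ^ Suc ?e" by simp
    finally show ?thesis .
  qed
  then show ?case by blast
qed

text \<open>Only emptiness of the outcome of the second program is known, so its outcome for each intermediate store has to
be chosen.\<close>

lemma run_Seq_ex:
  assumes "run a ts n S" "\<And>ts'. ts' \<in> S \<Longrightarrow> \<exists>S'. run b ts' m S' \<and> (S' \<noteq> {} \<longleftrightarrow> P ts')"
  shows "\<exists>S'. run (Seq a b) ts (n + m + 1) S' \<and> (S' \<noteq> {} \<longleftrightarrow> (\<exists>ts' \<in> S. P ts'))"
proof -
  from assms(2) have "\<forall>ts' \<in> S. \<exists>S'. run b ts' m S' \<and> (S' \<noteq> {} \<longleftrightarrow> P ts')" by blast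
  from bchoice[OF this] obtain S' where S': "\<And>ts'. ts' \<in> S \<Longrightarrow> run b ts' m (S' ts') \<and> (S' ts' \<noteq> {} \<longleftrightarrow> P ts')"
    by blast
  from run_Seq[OF assms(1), of b m S'] S' have "run (Seq a b) ts (n + m + 1) (\<Union>ts' \<in> S. S' ts')" by blast
  moreover have "(\<Union>ts' \<in> S. S' ts') \<noteq> {} \<longleftrightarrow> (\<exists>ts' \<in> S. P ts')" using S' by auto
  ultimately show ?thesis by blast
qed

lemma zip_tape_left_inject:
  assumes "zip_tape (rev (map Bit v)) [] = zip_tape (rev (map Bit w)) []" shows "v = w"
proof -
  have nth: "nth_default Blank (rev (map Bit v)) k = nth_default Blank (rev (map Bit w)) k" for k
    using fun_cong[OF assms, of "- int k - 1"] by (simp add: zip_tape_def)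
  have "length v = length w"
    using nth[of "length v"] nth[of "length w"] by (auto simp: nth_default_def rev_nth split: if_splits)
  then have "rev (map Bit v) = rev (map Bit w)"
  proof (intro nth_equalityI)
    fix i assume "i < length (rev (map Bit v))"
    with \<open>length v = length w\<close> nth[of i] show "rev (map Bit v) ! i = rev (map Bit w) ! i"
      by (simp add: nth_default_def)
  qed simp
  then show ?thesis by (simp add: inj_map_eq_map inj_def)
qed

section \<open>Prefixes of preimages form a language in NP\<close>

definition extension_language :: "(str \<rightharpoonup> str) \<Rightarrow> str set" where
  "extension_language f = {pair y u | y u. \<exists>v. f (u @ v) = Some y}"

text \<open>For an input pair \<open>(y, u)\<close>, the string \<open>u\<close> is copied to the input tape of \<open>F\<close>, a suffix \<open>v\<close> is guessed behind it, and
the value at \<open>u @ v\<close> is compared with \<open>y\<close>, which is on \<open>Var 1\<close> and on the clock tapes.\<close>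

definition search_extension :: "nat tm \<Rightarrow> nat \<Rightarrow> com" where
  "search_extension F d =
    Seq (split_pair (insert (Var 1) (clock ` {..<d})))
   (Seq (rewind (Var 1) (insert (Var 1) (clock ` {..<d})))
   (Seq (copy (Var 0) {Blk 0 0})
   (Seq (guess d)
        (evaluates_to F 0 (Var 1)))))"

lemma search_extension_wf: "F \<in> DTM_poly \<Longrightarrow> finitary (search_extension F d)"
  by (simp add: search_extension_def)

text \<open>Balancedness bounds the preimages of \<open>y\<close>, hence the suffixes to be guessed, by a polynomial in the length of \<open>y\<close>.\<close>

theorem extension_language_NP:
  assumes "f \<in> carrier fP" shows "extension_language f \<in> class_NP"
proof -
  from assms obtain F where F: "F \<in> DTM_poly" "computes F f" by (auto simp: fP_def)
  obtain r :: "nat poly" where r: "\<And>x y. f x = Some y \<Longrightarrow> length x \<le> poly r (length y)"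
    using assms unfolding fP_def polynomially_balanced_def by auto
  obtain d where d: "\<And>n. poly r n \<le> (n + 2) ^ d" using poly_le_power by blast
  obtain q :: "nat poly" where q: "\<And>z. \<exists>k \<le> poly q (length z). halts_after F z k"
    using DTM_poly_halts[OF F(1)] by blast
  define K where "K = (\<lambda>n :: nat. n + (n + 2) ^ d)"
  define T where "T = (\<lambda>n. 8 * n + guess_time d n + 2 * K n + 2 * poly q (K n) + 50)"
  let ?J = "insert (Var 1) (clock ` {..<d})"
  have "poly_bounded K"
    unfolding K_def by (intro poly_bounded_add poly_bounded_power poly_bounded_const poly_bounded_id)
  then have T: "poly_bounded T"
    unfolding T_def by (intro poly_bounded_add poly_bounded_mult poly_bounded_comp
        poly_bounded_const poly_bounded_id poly_bounded_guess_time)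
  have guess_time_mono: "guess_time k m \<le> guess_time k n" if "m \<le> n" for k m n
    using that by (induction k) (auto intro!: add_mono mult_mono)
  have "\<exists>S. run (search_extension F d) (input w) (T (length w)) S \<and> (S \<noteq> {} \<longleftrightarrow> w \<in> extension_language f)" for w
  proof (cases "\<exists>y u. w = pair y u")
    case False
    have "run (split_pair ?J) (input w) (2 * length w + 8) {}"
      by (rule run_split_pair_fails[where l = "\<lambda>_. []"])
        (use False in \<open>auto simp: clock_def input_Var0 input_other\<close>)
    from run_stuck[OF this] have "run (search_extension F d) (input w) (2 * length w + 8 + 0 + 1) {}"
      unfolding search_extension_def .
    then have "run (search_extension F d) (input w) (T (length w)) {}" by (rule run_mono) (simp add: T_def)
    moreover have "w \<notin> extension_language f" using False by (auto simp: extension_language_def)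
    ultimately show ?thesis by blast
  next
    case True
    then obtain y u where w: "w = pair y u" by blast
    let ?n = "length w" and ?N = "(length y + 2) ^ d"
    define ts1 where "ts1 = override_on ((input w)(Var 0 := zip_tape [] (map Bit u)))
      (\<lambda>_. zip_tape (rev (map Bit y)) []) ?J"
    have 1: "run (split_pair ?J) (input w) (2 * length w + 8) {ts1}"
      unfolding w ts1_def
      by (rule run_result[OF run_split_pair[where l = "\<lambda>_. []"]])
        (auto simp: clock_def input_Var0 input_other)
    define ts2 where "ts2 = override_on ts1 (\<lambda>_. zip_tape [] (map Bit y)) ?J"
    have 2: "run (rewind (Var 1) ?J) ts1 (2 * length y + 5) {ts2}"
      unfolding ts2_def by (rule run_rewind) (auto simp: ts1_def)
    have ts2_Var0: "ts2 (Var 0) = zip_tape [] (map Bit u)"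
      by (auto simp: ts2_def ts1_def clock_def override_on_def)
    have ts2_blank: "ts2 (Blk b j) = zip_tape [] []" "ts2 (State b) = zip_tape [] []" "ts2 Counter = zip_tape [] []" for b j
      by (auto simp: ts2_def ts1_def clock_def override_on_def input_other)
    have ts2_y: "ts2 (Var 1) = zip_tape [] (map Bit y)" "k < d \<Longrightarrow> ts2 (clock k) = zip_tape [] (map Bit y)" for k
      by (auto simp: ts2_def)
    define ts3 where "ts3 = override_on (ts2(Var 0 := zip_tape (rev (map Bit u)) []))
      (\<lambda>_. zip_tape (rev (map Bit u)) []) {Blk 0 0}"
    have 3: "run (copy (Var 0) {Blk 0 0}) ts2 (2 * length u + 1) {ts3}"
      by (rule run_result[OF run_copy_zip[where l = "\<lambda>_. []" and l' = "[]"]])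
        (use ts2_Var0 ts2_blank in \<open>auto simp: ts3_def\<close>)
    have "ts3 (clock k) = zip_tape [] (map Bit y)" if "k < d" for k
      using ts2_y(2)[OF that] by (simp add: ts3_def clock_def)
    then have 4: "run (guess d) ts3 (guess_time d (length y)) (extensions ts3 ?N)" by (rule run_guess)
    let ?t = "2 * K ?n + 2 * poly q (K ?n) + 2 * length y + 15"
    let ?s = "\<lambda>v. ts3(Blk 0 0 := write_bits v (ts3 (Blk 0 0)))"
    have run_v: "\<exists>S. run (evaluates_to F 0 (Var 1)) (?s v) ?t S \<and> (S \<noteq> {} \<longleftrightarrow> f (u @ v) = Some y)"
      if v: "length v \<le> ?N" for v
    proof -
      have "?s v (Blk 0 0) = zip_tape (rev (map Bit (u @ v))) []"
        by (simp add: ts3_def write_bits_zip)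
      moreover have "?s v (Blk 0 j) = zip_tape [] []" if "0 < j" for j
        using that ts2_blank by (simp add: ts3_def)
      moreover obtain k where k: "k \<le> poly q (length (u @ v))" "halts_after F (u @ v) k" using q by blast
      ultimately obtain S where S: "run (evaluates_to F 0 (Var 1)) (?s v)
        (2 * length (u @ v) + 2 * k + 2 * length y + 15) S" "S \<noteq> {} \<longleftrightarrow> f (u @ v) = Some y"
        using run_evaluates_to[OF F k(2), of "?s v" 0 "[]" 1 y] ts2_blank ts2_y by (auto simp: ts3_def)
      have K: "length (u @ v) \<le> K ?n"
      proof -
        have "?N \<le> (?n + 2) ^ d" by (rule power_mono) (auto simp: w length_pair)
        with v show ?thesis by (simp add: K_def w length_pair)
      qed
      have "run (evaluates_to F 0 (Var 1)) (?s v) ?t S"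
        by (rule run_mono[OF S(1)]) (use k(1) K poly_mono_nat[OF K, of q] in simp)
      with S(2) show ?thesis by blast
    qed
    \<comment> \<open>The guessed suffix can be read off the store, so acceptance is a property of the store.\<close>
    define P where "P ts \<longleftrightarrow> (\<exists>v. length v \<le> ?N \<and> ts = ?s v \<and> f (u @ v) = Some y)" for ts
    have same: "v = v'" if "?s v = ?s v'" for v v'
    proof -
      have "zip_tape (rev (map Bit (u @ v))) [] = zip_tape (rev (map Bit (u @ v'))) []"
        using fun_cong[OF that, of "Blk 0 0"] by (simp add: ts3_def write_bits_zip)
      then have "u @ v = u @ v'" by (rule zip_tape_left_inject)
      then show ?thesis by simp
    qed
    have "\<exists>S. run (evaluates_to F 0 (Var 1)) ts ?t S \<and> (S \<noteq> {} \<longleftrightarrow> P ts)" if "ts \<in> extensions ts3 ?N" for ts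
    proof -
      from that obtain v where v: "length v \<le> ?N" "ts = ?s v" by (auto simp: extensions_def)
      have "P ts \<longleftrightarrow> f (u @ v) = Some y" using v same unfolding P_def by metis
      then show ?thesis using run_v[OF v(1)] v(2) by simp
    qed
    from run_Seq_ex[OF 4 this] obtain S where
      S: "run (Seq (guess d) (evaluates_to F 0 (Var 1))) ts3 (guess_time d (length y) + ?t + 1) S"
      "S \<noteq> {} \<longleftrightarrow> (\<exists>ts \<in> extensions ts3 ?N. P ts)" by blast
    have "run (search_extension F d) (input w) (2 * length w + 8 + (2 * length y + 5 +
        (2 * length u + 1 + (guess_time d (length y) + ?t + 1) + 1) + 1) + 1) S"
      unfolding search_extension_def by (intro run_then[OF 1] run_then[OF 2] run_then[OF 3] S(1))
    then have "run (search_extension F d) (input w) (T ?n) S"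
      by (rule run_mono) (use guess_time_mono[of "length y" ?n d] in \<open>simp add: T_def w length_pair\<close>)
    moreover have "S \<noteq> {} \<longleftrightarrow> w \<in> extension_language f"
    proof
      assume "S \<noteq> {}"
      then obtain v where "f (u @ v) = Some y" using S(2) by (auto simp: P_def)
      then show "w \<in> extension_language f" unfolding extension_language_def w by blast
    next
      assume "w \<in> extension_language f"
      then obtain v where v: "f (u @ v) = Some y" by (auto simp: extension_language_def w pair_inject)
      have "length v \<le> ?N" using r[OF v] d[of "length y"] by simp
      with v have "?s v \<in> extensions ts3 ?N" "P (?s v)" unfolding extensions_def P_def by blast+
      then show "S \<noteq> {}" using S(2) by blast
    qed
    ultimately show ?thesis by blast
  qed
  then show ?thesis
  proof (rule compile_acceptor[OF search_extension_wf[OF F(1)] T])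
    fix M assume "M \<in> NTM_poly" "language M = extension_language f"
    then show ?thesis unfolding class_NP_def by blast
  qed
qed

section \<open>Searching for a preimage\<close>

definition encode :: "tape_name \<Rightarrow> tape_name set \<Rightarrow> com" where
  "encode c J = While (\<lambda>s. is_bit (s c)) (Seq (stamp J (Bit True) MoveRight) (transfer c J))"

lemma encode_wf [simp]: "finite J \<Longrightarrow> finitary (encode c J)" "det (encode c J)"
  by (auto simp: encode_def)

lemma run_encode:
  assumes "c \<notin> J"
  shows "ts c = zip_tape l' (map Bit y) \<Longrightarrow> (\<And>j. j \<in> J \<Longrightarrow> ts j = zip_tape (l j) []) \<Longrightarrow>
    run (encode c J) ts (4 * length y + 1) {override_on (ts(c := zip_tape (rev (map Bit y) @ l') []))
      (\<lambda>j. zip_tape (rev (map Bit (concat (map (\<lambda>b. [True, b]) y))) @ l j) []) J}"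
proof (induction y arbitrary: ts l l')
  case Nil
  then have "ts(c := zip_tape l' []) = ts" by auto
  moreover have "override_on ts (\<lambda>j. zip_tape (l j) []) J = ts"
    using Nil by (auto simp: override_on_def)
  ultimately show ?case using Nil(1) by (simp add: encode_def run_exit)
next
  case (Cons b y)
  let ?ts = "\<lambda>i. if i = c then zip_tape (Bit b # l') (map Bit y)
    else if i \<in> J then zip_tape (Bit b # Bit True # l i) [] else ts i"
  have body: "run (Seq (stamp J (Bit True) MoveRight) (transfer c J)) ts (1 + 1 + 1) {?ts}"
    by (rule run_then[OF run_stamp], rule run_result[OF run_transfer], rule ext)
      (use Cons.prems assms in \<open>auto simp: override_on_def\<close>)
  have "run (encode c J) ?ts (4 * length y + 1) {override_on (?ts(c := zip_tape (rev (map Bit y) @ Bit b # l') []))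
      (\<lambda>j. zip_tape (rev (map Bit (concat (map (\<lambda>b. [True, b]) y))) @ Bit b # Bit True # l j) []) J}"
    by (rule Cons.IH) (use assms in auto)
  also have "override_on (?ts(c := zip_tape (rev (map Bit y) @ Bit b # l') []))
      (\<lambda>j. zip_tape (rev (map Bit (concat (map (\<lambda>b. [True, b]) y))) @ Bit b # Bit True # l j) []) J
    = override_on (ts(c := zip_tape (rev (map Bit (b # y)) @ l') []))
      (\<lambda>j. zip_tape (rev (map Bit (concat (map (\<lambda>b. [True, b]) (b # y)))) @ l j) []) J"
    by (auto simp: override_on_def)
  finally have "run (encode c J) ts (1 + 1 + 1 + (4 * length y + 1) + 1) {override_on (ts(c := zip_tape (rev (map Bit (b # y)) @ l') []))
      (\<lambda>j. zip_tape (rev (map Bit (concat (map (\<lambda>b. [True, b]) (b # y)))) @ l j) []) J}"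
    unfolding encode_def by (intro run_loop[OF _ body]) (use Cons.prems in simp_all)
  then show ?case by (rule run_mono) simp
qed

definition record_answer :: "nat tm \<Rightarrow> com" where
  "record_answer D = Prim (\<lambda>s. {[Var 2 \<mapsto> (Aux (if accepts D 0 s then 1 else 0), Stay), State 0 \<mapsto> (Blank, Stay)]})"

lemma record_answer_wf [simp]: "finitary (record_answer D)" "det (record_answer D)"
  by (auto simp: record_answer_def bounded_prim_def
      intro!: exI[of _ "{Aux 0, Aux 1, Blank}"] exI[of _ "{Var 2, State 0}"] split: if_splits)

text \<open>Asks \<open>D\<close> about the pair of the strings on \<open>Var 0\<close> and \<open>Var 1\<close> and puts the answer on \<open>Var 2\<close>. The question is also
written on \<open>Counter\<close>, so that the marks finally cover the length of the input of \<open>D\<close> plus the number of its steps,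
which is the distance needed by \<open>erase\<close>.\<close>

definition query :: "nat tm \<Rightarrow> com" where
  "query D =
    Seq (encode (Var 0) {Blk 0 0, Counter})
   (Seq (stamp {Blk 0 0, Counter} (Bit False) MoveRight)
   (Seq (rewind (Var 0) {Var 0})
   (Seq (rewind (Var 1) {Var 1})
   (Seq (copy (Var 1) {Blk 0 0, Counter})
   (Seq (rewind (Blk 0 0) {Blk 0 0})
   (Seq (call D 0)
   (Seq (record_answer D)
        (erase (Blk 0 ` {..<tapes D})))))))))"

lemma query_wf [simp]: "D \<in> DTM_poly \<Longrightarrow> finitary (query D)" "D \<in> DTM_poly \<Longrightarrow> det (query D)"
  by (simp_all add: query_def DTM_polyD)

text \<open>The head on \<open>Var 1\<close> stands behind the last letter of the current prefix \<open>u\<close>, ready to append a letter. All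
tapes used by a query are blank again after it, so queries can be repeated in a loop.\<close>

definition search_state :: "str \<Rightarrow> str \<Rightarrow> symbol \<Rightarrow> store" where
  "search_state y u a = (\<lambda>_. zip_tape [] [])(Var 0 := zip_tape [] (map Bit y),
     Var 1 := zip_tape (rev (map Bit u)) [], Var 2 := zip_tape [] [a])"

lemma search_state_simps [simp]:
  "search_state y u a (Var 0) = zip_tape [] (map Bit y)"
  "search_state y u a (Var (Suc 0)) = zip_tape (rev (map Bit u)) []"
  "search_state y u a (Var 2) = zip_tape [] [a]"
  "search_state y u a (Blk b j) = zip_tape [] []"
  "search_state y u a (State b) = zip_tape [] []"
  "search_state y u a Counter = zip_tape [] []"
  by (auto simp: search_state_def)

lemma input_search_state: "input y = search_state y [] Blank"
  by (auto simp: search_state_def input_def string_tape_zip zip_tape_Nil)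

definition answer :: "bool \<Rightarrow> symbol" where
  "answer p = Aux (if p then 1 else 0)"

lemma run_query:
  assumes "D \<in> DTM_poly"
  obtains p :: "nat poly" where
    "\<And>y u a. run (query D) (search_state y u a) (poly p (length y + length u))
      {search_state y u (answer (pair y u \<in> language D))}"
proof -
  obtain p :: "nat poly" where p: "\<And>x. \<exists>m \<le> poly p (length x). halts_after D x m"
    using DTM_poly_halts[OF assms] by blast
  define T where "T = (\<lambda>n. 30 * n + 8 * poly p (2 * n + 1) + 80)"
  have "run (query D) (search_state y u a) (T (length y + length u))
      {search_state y u (answer (pair y u \<in> language D))}" for y u a
  proof -
    let ?w = "pair y u" and ?J = "{Blk 0 0, Counter}"
    let ?e = "rev (map Bit (concat (map (\<lambda>b. [True, b]) y)))"
    let ?s = "search_state y u a"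
    from p[of ?w] obtain m where m: "m \<le> poly p (length ?w)" and halts: "halts_after D ?w m" by blast
    note len = final_tapes(1)[OF assms halts] and blank = final_tapes(2)[OF assms halts]
    have w: "rev (map Bit ?w) = rev (map Bit u) @ Bit False # ?e" by (simp add: pair_def)
    let ?X = "\<lambda>v0 v1 l. override_on (?s(Var 0 := v0, Var 1 := v1)) (\<lambda>_. zip_tape l []) ?J"
    let ?v0 = "zip_tape [] (map Bit y)" and ?v0' = "zip_tape (rev (map Bit y)) []"
    let ?v1 = "zip_tape [] (map Bit u)" and ?v1' = "zip_tape (rev (map Bit u)) []"
    have 1: "run (encode (Var 0) ?J) ?s (4 * length y + 1) {?X ?v0' ?v1' ?e}"
      by (rule run_result[OF run_encode[where l = "\<lambda>_. []" and l' = "[]"]])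
        (auto simp: override_on_def)
    have 2: "run (stamp ?J (Bit False) MoveRight) (?X ?v0' ?v1' ?e) 1 {?X ?v0' ?v1' (Bit False # ?e)}"
      by (rule run_result[OF run_stamp]) (auto simp: override_on_def)
    have 3: "run (rewind (Var 0) {Var 0}) (?X ?v0' ?v1' (Bit False # ?e)) (2 * length y + 5) {?X ?v0 ?v1' (Bit False # ?e)}"
      by (rule run_result[OF run_rewind]) (auto simp: override_on_def)
    have 4: "run (rewind (Var 1) {Var 1}) (?X ?v0 ?v1' (Bit False # ?e)) (2 * length u + 5) {?X ?v0 ?v1 (Bit False # ?e)}"
      by (rule run_result[OF run_rewind]) (auto simp: override_on_def)
    have 5: "run (copy (Var 1) ?J) (?X ?v0 ?v1 (Bit False # ?e)) (2 * length u + 1) {?X ?v0 ?v1' (rev (map Bit ?w))}"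
      unfolding w
      by (rule run_result[OF run_copy_zip[where l = "\<lambda>_. Bit False # ?e" and l' = "[]"]]) (auto simp: override_on_def)
    define ts6 where "ts6 = ?s(Blk 0 0 := zip_tape [] (map Bit ?w), Counter := zip_tape (rev (map Bit ?w)) [])"
    have 6: "run (rewind (Blk 0 0) {Blk 0 0}) (?X ?v0 ?v1' (rev (map Bit ?w))) (2 * length ?w + 5) {ts6}"
      by (rule run_result[OF run_rewind]) (auto simp: override_on_def ts6_def)
    let ?l = "replicate m (Aux 0) @ rev (map Bit ?w)"
    define ts7 where "ts7 = load 0 (final D ?w) (ts6(Counter := zip_tape ?l []))"
    have "ready D 0 ?w ts6" "ts6 Counter = zip_tape (rev (map Bit ?w)) []"
      by (auto simp: ready_def ts6_def)
    from run_call[OF assms halts this] have 7: "run (call D 0) ts6 (2 * m + 3) {ts7}" unfolding ts7_def .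
    define ts8 where "ts8 = ts7(Var 2 := zip_tape [] [answer (?w \<in> language D)], State 0 := zip_tape [] [])"
    have acc: "accepts D 0 (scanned ts7) \<longleftrightarrow> ?w \<in> language D"
      unfolding ts7_def accepts_load language_final[OF assms] ..
    have 8: "run (record_answer D) ts7 1 {ts8}"
      unfolding record_answer_def
    proof (rule run_Prim_single[OF refl])
      have "ts7 (Var 2) = zip_tape [] [a]" "ts7 (State 0) = zip_tape [] [Aux (fst (final D ?w))]"
        by (simp_all add: ts7_def ts6_def)
      then show "ts8 = upd [Var 2 \<mapsto> (Aux (if accepts D 0 (scanned ts7) then 1 else 0), Stay), State 0 \<mapsto> (Blank, Stay)] ts7"
        by (simp add: acc ts8_def answer_def)
    qed
    let ?B = "Blk 0 ` {..<tapes D}"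
    have 9: "run (erase ?B) ts8 (6 * length ?l + 14) {override_on ts8 (\<lambda>_. zip_tape [] []) (insert Counter ?B)}"
    proof (rule run_erase)
      show "ts8 Counter = zip_tape ?l []" by (simp add: ts8_def ts7_def)
      fix j i assume "j \<in> ?B" "\<bar>i\<bar> > int (length ?l)"
      then obtain k where k: "j = Blk 0 k" "k < tapes D" by auto
      then have "ts8 j = snd (final D ?w) ! k" using len by (simp add: ts8_def ts7_def)
      moreover have "snd (final D ?w) ! k \<in> set (snd (final D ?w))" using k len by simp
      ultimately show "ts8 j i = Blank" using blank \<open>\<bar>i\<bar> > int (length ?l)\<close> by simp
    qed auto
    have fin: "override_on ts8 (\<lambda>_. zip_tape [] []) (insert Counter ?B) = search_state y u (answer (?w \<in> language D))"
    proof
      fix i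
      show "override_on ts8 (\<lambda>_. zip_tape [] []) (insert Counter ?B) i = search_state y u (answer (?w \<in> language D)) i"
      proof (cases i)
        case (Blk b j)
        show ?thesis
        proof (cases "b = 0 \<and> j < tapes D")
          case False
          then have "j \<noteq> 0 \<or> b \<noteq> 0" using tapes_pos[OF assms] by auto
          then have "ts8 i = zip_tape [] []"
            using False len Blk by (cases "b = 0") (simp_all add: ts8_def ts7_def ts6_def)
          moreover have "i \<notin> insert Counter ?B" using False Blk by auto
          ultimately show ?thesis using Blk by simp
        qed (use Blk in auto)
      next
        case (State b)
        then show ?thesis by (cases "b = 0") (auto simp: ts8_def ts7_def ts6_def override_on_def)
      next
        case (Var n)
        then have "i \<notin> insert Counter ?B" by auto
        then show ?thesis using Var
          by (simp add: ts8_def ts7_def ts6_def search_state_def)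
      qed simp
    qed
    have "run (query D) ?s (4 * length y + 1 + (1 + (2 * length y + 5 + (2 * length u + 5 + (2 * length u + 1 +
        (2 * length ?w + 5 + (2 * m + 3 + (1 + (6 * length ?l + 14) + 1) + 1) + 1) + 1) + 1) + 1) + 1) + 1)
        {search_state y u (answer (?w \<in> language D))}"
      unfolding query_def fin[symmetric]
      by (intro run_then[OF 1] run_then[OF 2] run_then[OF 3] run_then[OF 4] run_then[OF 5] run_then[OF 6]
          run_then[OF 7] run_then[OF 8] 9)
    moreover have "m \<le> poly p (2 * (length y + length u) + 1)"
      using m poly_mono_nat[of "length ?w" "2 * (length y + length u) + 1" p] by (simp add: length_pair)
    ultimately show ?thesis by (elim run_mono) (simp add: T_def length_pair)
  qed
  moreover have "T n = poly ([:80, 30:] + smult 8 (pcompose p [:1, 2:])) n" for n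
    by (simp add: T_def poly_pcompose algebra_simps mult_2_right)
  ultimately show ?thesis by (intro that[of "[:80, 30:] + smult 8 (pcompose p [:1, 2:])"]) simp
qed

definition answered :: "scan \<Rightarrow> bool" where
  "answered s \<longleftrightarrow> s (Var 2) = answer True"

lemma answered_search_state [simp]: "answered (scanned (search_state y u (answer p))) \<longleftrightarrow> p"
  by (simp add: answered_def answer_def)

definition skip :: com where
  "skip = assertion (\<lambda>_. True)"

lemma skip_wf [simp]: "finitary skip" "det skip"
  by (simp_all add: skip_def)

lemma run_skip: "run skip ts 1 {ts}"
  unfolding skip_def by (rule run_assertion) simp

definition replace_last :: "bool \<Rightarrow> com" where
  "replace_last b = Seq (shift {Var 1} MoveLeft) (stamp {Var 1} (Bit b) MoveRight)"

definition drop_last :: com where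
  "drop_last = Seq (shift {Var 1} MoveLeft) (stamp {Var 1} Blank Stay)"

text \<open>Tries to extend the prefix by \<open>False\<close>, then by \<open>True\<close>. If neither works, the prefix is restored and the negative answer
ends the loop that contains this program.\<close>

definition extend_prefix :: "nat tm \<Rightarrow> com" where
  "extend_prefix D =
    Seq (stamp {Var 1} (Bit False) MoveRight)
   (Seq (query D)
   (Cond answered skip
      (Seq (replace_last True)
      (Seq (query D)
      (Cond answered skip drop_last)))))"

lemma extend_prefix_wf [simp]: "D \<in> DTM_poly \<Longrightarrow> finitary (extend_prefix D)" "D \<in> DTM_poly \<Longrightarrow> det (extend_prefix D)"
  by (simp_all add: extend_prefix_def replace_last_def drop_last_def)

lemma run_append_bit:
  "run (stamp {Var 1} (Bit b) MoveRight) (search_state y u a) 1 {search_state y (u @ [b]) a}"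
  by (rule run_result[OF run_stamp]) (auto simp: override_on_def search_state_def)

lemma run_back_up: "run (shift {Var 1} MoveLeft) (search_state y (u @ [b]) a) 1
    {(search_state y (u @ [b]) a)(Var 1 := zip_tape (rev (map Bit u)) [Bit b])}"
  by (rule run_result[OF run_shift]) (auto simp: override_on_def search_state_def move_head_zip)

lemma run_replace_last: "run (replace_last c) (search_state y (u @ [b]) a) 3 {search_state y (u @ [c]) a}"
proof -
  have "run (replace_last c) (search_state y (u @ [b]) a) (1 + 1 + 1) {search_state y (u @ [c]) a}"
    unfolding replace_last_def
    by (rule run_then[OF run_back_up], rule run_result[OF run_stamp])
      (auto simp: override_on_def search_state_def)
  then show ?thesis by (rule run_mono) simp
qed

lemma run_drop_last: "run drop_last (search_state y (u @ [b]) a) 3 {search_state y u a}"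
proof -
  have "run drop_last (search_state y (u @ [b]) a) (1 + 1 + 1) {search_state y u a}"
    unfolding drop_last_def
    by (rule run_then[OF run_back_up], rule run_result[OF run_stamp])
      (auto simp: override_on_def search_state_def)
  then show ?thesis by (rule run_mono) simp
qed

lemma run_extend_prefix:
  assumes p: "\<And>y u a. run (query D) (search_state y u a) (poly p (length y + length u))
      {search_state y u (answer (pair y u \<in> language D))}"
  shows "run (extend_prefix D) (search_state y u a) (2 * poly p (length y + length u + 1) + 20)
    {if pair y (u @ [False]) \<in> language D then search_state y (u @ [False]) (answer True)
     else if pair y (u @ [True]) \<in> language D then search_state y (u @ [True]) (answer True)
     else search_state y u (answer False)}"
proof -
  let ?p = "poly p (length y + length u + 1)"
  have q: "run (query D) (search_state y (u @ [b]) a) ?p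
      {search_state y (u @ [b]) (answer (pair y (u @ [b]) \<in> language D))}" for b a
    using p[of y "u @ [b]" a] by simp
  let ?s = "if pair y (u @ [True]) \<in> language D then search_state y (u @ [True]) (answer True)
     else search_state y u (answer False)"
  have inner: "run (Cond answered skip drop_last)
      (search_state y (u @ [True]) (answer (pair y (u @ [True]) \<in> language D))) (3 + 1) {?s}"
    by (rule run_Cond) (auto intro: run_drop_last run_mono[OF run_skip])
  have "run (Cond answered skip (Seq (replace_last True) (Seq (query D) (Cond answered skip drop_last))))
      (search_state y (u @ [False]) (answer (pair y (u @ [False]) \<in> language D))) (3 + (?p + (3 + 1) + 1) + 1 + 1)
      {if pair y (u @ [False]) \<in> language D then search_state y (u @ [False]) (answer True) else ?s}"
  proof (rule run_Cond, cases "pair y (u @ [False]) \<in> language D")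
    case True
    then show "run (if answered (scanned (search_state y (u @ [False]) (answer (pair y (u @ [False]) \<in> language D))))
        then skip else Seq (replace_last True) (Seq (query D) (Cond answered skip drop_last)))
      (search_state y (u @ [False]) (answer (pair y (u @ [False]) \<in> language D))) (3 + (?p + (3 + 1) + 1) + 1)
      {if pair y (u @ [False]) \<in> language D then search_state y (u @ [False]) (answer True) else ?s}"
      by (auto intro: run_mono[OF run_skip])
  next
    case False
    have "run (Seq (replace_last True) (Seq (query D) (Cond answered skip drop_last)))
      (search_state y (u @ [False]) (answer False)) (3 + (?p + (3 + 1) + 1) + 1) {?s}"
      by (rule run_then[OF run_replace_last run_then[OF q inner]])
    with False show "run (if answered (scanned (search_state y (u @ [False]) (answer (pair y (u @ [False]) \<in> language D))))
        then skip else Seq (replace_last True) (Seq (query D) (Cond answered skip drop_last)))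
      (search_state y (u @ [False]) (answer (pair y (u @ [False]) \<in> language D))) (3 + (?p + (3 + 1) + 1) + 1)
      {if pair y (u @ [False]) \<in> language D then search_state y (u @ [False]) (answer True) else ?s}"
      by simp
  qed
  from run_then[OF run_append_bit run_then[OF q this]]
  have "run (extend_prefix D) (search_state y u a) (1 + (?p + (3 + (?p + (3 + 1) + 1) + 1 + 1) + 1) + 1)
      {if pair y (u @ [False]) \<in> language D then search_state y (u @ [False]) (answer True) else ?s}"
    unfolding extend_prefix_def .
  then show ?thesis by (rule run_mono) simp
qed

lemma extension_language_pair: "pair y u \<in> extension_language f \<longleftrightarrow> (\<exists>v. f (u @ v) = Some y)"
  by (auto simp: extension_language_def pair_inject)

text \<open>A prefix of a preimage that cannot be extended by any letter is a preimage itself. As all preimages of \<open>y\<close> have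
length at most \<open>B\<close>, the difference \<open>k\<close> bounds the number of extensions still to come.\<close>

lemma run_search_loop:
  assumes p: "\<And>y u a. run (query D) (search_state y u a) (poly p (length y + length u))
      {search_state y u (answer (pair y u \<in> language D))}"
    and D: "language D = extension_language f"
    and bound: "\<And>x. f x = Some y \<Longrightarrow> length x \<le> B"
  shows "pair y u \<in> language D \<Longrightarrow> length u + k = B \<Longrightarrow>
    \<exists>x. f x = Some y \<and> run (While answered (extend_prefix D)) (search_state y u (answer True))
      (Suc k * (2 * poly p (length y + B + 1) + 22)) {search_state y x (answer False)}"
proof (induction k arbitrary: u)
  let ?W = "While answered (extend_prefix D)" and ?t = "2 * poly p (length y + B + 1) + 20"
  have longer: "length u < B" if "pair y (u @ [b]) \<in> language D" for u b
    using that bound unfolding D extension_language_pair by fastforce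
  have step: "run (extend_prefix D) (search_state y u a) ?t
    {if pair y (u @ [False]) \<in> language D then search_state y (u @ [False]) (answer True)
     else if pair y (u @ [True]) \<in> language D then search_state y (u @ [True]) (answer True)
     else search_state y u (answer False)}" if "length u \<le> B" for u a
    using that poly_mono_nat[of "length y + length u + 1" "length y + B + 1" p]
    by (intro run_mono[OF run_extend_prefix[OF p]]) simp
  have stop: "\<exists>x. f x = Some y \<and> run ?W (search_state y u (answer True)) (?t + 2) {search_state y x (answer False)}"
    if u: "pair y u \<in> language D" and no: "\<And>b. pair y (u @ [b]) \<notin> language D" and "length u \<le> B" for u
  proof -
    from u obtain v where v: "f (u @ v) = Some y" unfolding D extension_language_pair by blast
    have "v = []"
    proof (cases v)
      case (Cons b v')
      then have "pair y (u @ [b]) \<in> language D" using v unfolding D extension_language_pair by auto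
      with no show ?thesis by blast
    qed
    with v have "f u = Some y" by simp
    moreover have "run ?W (search_state y u (answer True)) (?t + 1 + 1) {search_state y u (answer False)}"
    proof (rule run_loop)
      show "run (extend_prefix D) (search_state y u (answer True)) ?t {search_state y u (answer False)}"
        using step[OF \<open>length u \<le> B\<close>, of "answer True"] no by simp
      show "run ?W (search_state y u (answer False)) 1 {search_state y u (answer False)}"
        by (rule run_While_False) simp
    qed simp
    ultimately show ?thesis by auto
  qed
  {
    case 0
    then have "pair y (u @ [b]) \<notin> language D" for b using longer[of u b] by auto
    with stop[OF 0(1)] 0(2) obtain x where x: "f x = Some y"
      "run ?W (search_state y u (answer True)) (?t + 2) {search_state y x (answer False)}" by auto
    have "run ?W (search_state y u (answer True)) (Suc 0 * (2 * poly p (length y + B + 1) + 22))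
          {search_state y x (answer False)}"
      by (rule run_mono[OF x(2)]) simp
    with x(1) show ?case by blast
  next
    case (Suc k)
    show ?case
    proof (cases "\<exists>b. pair y (u @ [b]) \<in> language D")
      case False
      then obtain x where x: "f x = Some y" "run ?W (search_state y u (answer True)) (?t + 2) {search_state y x (answer False)}"
        using stop[OF Suc.prems(1)] Suc.prems(2) by auto
      have "run ?W (search_state y u (answer True)) (Suc (Suc k) * (2 * poly p (length y + B + 1) + 22))
          {search_state y x (answer False)}"
        by (rule run_mono[OF x(2)]) simp
      with x(1) show ?thesis by blast
    next
      case True
      then obtain b where b: "pair y (u @ [b]) \<in> language D" and
        next_state: "run (extend_prefix D) (search_state y u (answer True)) ?t {search_state y (u @ [b]) (answer True)}"
      proof (cases "pair y (u @ [False]) \<in> language D")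
        case F: True
        then show thesis using step[of u "answer True"] Suc.prems(2) by (intro that[of False]) simp_all
      next
        case F: False
        with True have T: "pair y (u @ [True]) \<in> language D" by (metis (full_types))
        with F show thesis using step[of u "answer True"] Suc.prems(2) by (intro that[of True]) simp_all
      qed
      from Suc.IH[OF b] Suc.prems(2) obtain x where x: "f x = Some y"
        "run ?W (search_state y (u @ [b]) (answer True)) (Suc k * (2 * poly p (length y + B + 1) + 22))
          {search_state y x (answer False)}" by auto
      have "run ?W (search_state y u (answer True)) (?t + Suc k * (2 * poly p (length y + B + 1) + 22) + 1)
          {search_state y x (answer False)}"
        by (rule run_loop[OF _ next_state x(2)]) simp
      then have "run ?W (search_state y u (answer True)) (Suc (Suc k) * (2 * poly p (length y + B + 1) + 22))
          {search_state y x (answer False)}"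
        by (rule run_mono) simp
      with x(1) show ?thesis by blast
    qed
  }
qed

definition wipe :: "tape_name \<Rightarrow> com" where
  "wipe c = While (\<lambda>s. is_bit (s c)) (stamp {c} Blank MoveRight)"

lemma wipe_wf [simp]: "finitary (wipe c)" "det (wipe c)"
  by (simp_all add: wipe_def)

lemma run_wipe: "ts c = zip_tape [] (map Bit v) \<Longrightarrow> run (wipe c) ts (2 * length v + 1) {ts(c := zip_tape [] [])}"
proof (induction v arbitrary: ts)
  case Nil
  then have "ts(c := zip_tape [] []) = ts" by auto
  with Nil show ?case by (simp add: wipe_def run_exit)
next
  case (Cons b v)
  let ?ts = "ts(c := zip_tape [] (map Bit v))"
  have step: "run (stamp {c} Blank MoveRight) ts 1 {?ts}"
    by (rule run_result[OF run_stamp]) (use Cons.prems in \<open>auto simp: override_on_def\<close>)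
  have "run (wipe c) ?ts (2 * length v + 1) {ts(c := zip_tape [] [])}"
    by (rule run_result[OF Cons.IH]) auto
  then have "run (wipe c) ts (1 + (2 * length v + 1) + 1) {ts(c := zip_tape [] [])}"
    unfolding wipe_def by (intro run_loop[OF _ step]) (use Cons.prems in simp_all)
  then show ?case by (rule run_mono) simp
qed

text \<open>The first query asks about the empty prefix, so that the search is only entered if \<open>y\<close> has a preimage at all.\<close>

definition find_preimage :: "nat tm \<Rightarrow> com" where
  "find_preimage D =
    Seq (query D)
   (Seq (assertion answered)
   (Seq (While answered (extend_prefix D))
   (Seq (wipe (Var 0))
   (Seq (rewind (Var 1) {Var 1})
   (Seq (copy (Var 1) {Var 0})
        (rewind (Var 0) {Var 0}))))))"

lemma find_preimage_wf: "D \<in> DTM_poly \<Longrightarrow> finitary (find_preimage D)" "D \<in> DTM_poly \<Longrightarrow> det (find_preimage D)"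
  by (simp_all add: find_preimage_def)

lemma run_find_preimage_output:
  "\<exists>ts. ts (Var 0) = string_tape x \<and>
    run (Seq (wipe (Var 0)) (Seq (rewind (Var 1) {Var 1}) (Seq (copy (Var 1) {Var 0}) (rewind (Var 0) {Var 0}))))
      (search_state y x a) (2 * length y + 6 * length x + 20) {ts}"
proof -
  let ?s = "\<lambda>t0 t1. (search_state y x a)(Var 0 := t0, Var 1 := t1)"
  let ?l = "zip_tape (rev (map Bit x)) []" and ?r = "zip_tape [] (map Bit x)" and ?e = "zip_tape [] []"
  have 1: "run (wipe (Var 0)) (search_state y x a) (2 * length y + 1) {?s ?e ?l}"
    by (rule run_result[OF run_wipe]) auto
  have 2: "run (rewind (Var 1) {Var 1}) (?s ?e ?l) (2 * length x + 5) {?s ?e ?r}"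
    by (rule run_result[OF run_rewind]) (auto simp: override_on_def)
  have 3: "run (copy (Var 1) {Var 0}) (?s ?e ?r) (2 * length x + 1) {?s ?l ?l}"
    by (rule run_result[OF run_copy_zip[where l = "\<lambda>_. []" and l' = "[]"]]) (auto simp: override_on_def)
  have 4: "run (rewind (Var 0) {Var 0}) (?s ?l ?l) (2 * length x + 5) {?s ?r ?l}"
    by (rule run_result[OF run_rewind]) (auto simp: override_on_def)
  from run_then[OF 1 run_then[OF 2 run_then[OF 3 4]]]
  have "run (Seq (wipe (Var 0)) (Seq (rewind (Var 1) {Var 1}) (Seq (copy (Var 1) {Var 0}) (rewind (Var 0) {Var 0}))))
      (search_state y x a) (2 * length y + 6 * length x + 20) {?s ?r ?l}"
    by (rule run_mono) simp
  moreover have "?s ?r ?l (Var 0) = string_tape x" by (simp add: string_tape_zip)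
  ultimately show ?thesis by blast
qed

text \<open>The search gives a section \<open>g\<close> of \<open>f\<close> with domain \<open>ran f\<close>. The bounds that witness balancedness of \<open>f\<close> witness it
for \<open>g\<close> when they are exchanged.\<close>

theorem regular_if_P_eq_NP:
  assumes "class_P = class_NP" shows "regular fP"
  unfolding regular_def
proof
  fix f assume f: "f \<in> carrier fP"
  then have "extension_language f \<in> class_P" using extension_language_NP assms by simp
  then obtain D where D: "D \<in> DTM_poly" "language D = extension_language f" by (auto simp: class_P_def)
  obtain q r :: "nat poly" where balanced:
    "\<And>x y. f x = Some y \<Longrightarrow> length y \<le> poly q (length x) \<and> length x \<le> poly r (length y)"
    using f unfolding fP_def polynomially_balanced_def by auto
  obtain p :: "nat poly" where p: "\<And>y u a. run (query D) (search_state y u a) (poly p (length y + length u))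
      {search_state y u (answer (pair y u \<in> language D))}" using run_query[OF D(1)] by blast
  define T where "T = (\<lambda>n. poly p n + Suc (poly r n) * (2 * poly p (n + poly r n + 1) + 22) + 2 * n + 6 * poly r n + 30)"
  have "poly_bounded (\<lambda>n. 1 + poly r n)"
    by (intro poly_bounded_add poly_bounded_const poly_bounded_poly)
  then have "poly_bounded (\<lambda>n. Suc (poly r n))" by simp
  then have T: "poly_bounded T"
    unfolding T_def by (intro poly_bounded_add poly_bounded_mult poly_bounded_comp
        poly_bounded_const poly_bounded_id poly_bounded_poly)
  let ?out = "Seq (wipe (Var 0)) (Seq (rewind (Var 1) {Var 1}) (Seq (copy (Var 1) {Var 0}) (rewind (Var 0) {Var 0})))"
  let ?s = "\<lambda>y. search_state y [] (answer (pair y [] \<in> language D))"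
  have ask: "run (query D) (input y) (poly p (length y)) {?s y}" for y
    using p[of y "[]" Blank] by (simp add: input_search_state)
  have range: "pair y [] \<in> language D \<longleftrightarrow> y \<in> ran f" for y
    by (auto simp: D(2) extension_language_pair ran_def)
  have found: "\<exists>x. f x = Some y \<and> (\<exists>ts. ts (Var 0) = string_tape x \<and> run (find_preimage D) (input y) (T (length y)) {ts})"
    if y: "y \<in> ran f" for y
  proof -
    let ?B = "poly r (length y)"
    have start: "?s y = search_state y [] (answer True)" using range y by simp
    from run_search_loop[OF p D(2), of y ?B "[]" ?B] balanced range y obtain x where x: "f x = Some y" and
      loop: "run (While answered (extend_prefix D)) (?s y) (Suc ?B * (2 * poly p (length y + ?B + 1) + 22)) {search_state y x (answer False)}"
      by (auto simp: start)
    obtain ts where ts: "ts (Var 0) = string_tape x" and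
      out: "run ?out (search_state y x (answer False)) (2 * length y + 6 * length x + 20) {ts}"
      using run_find_preimage_output by blast
    have "run (find_preimage D) (input y) (poly p (length y) + (1 + (Suc ?B * (2 * poly p (length y + ?B + 1) + 22) +
        (2 * length y + 6 * length x + 20) + 1) + 1) + 1) {ts}"
      unfolding find_preimage_def
      by (rule run_then[OF ask run_then[OF run_assertion run_then[OF loop out]]]) (use start in simp)
    then have "run (find_preimage D) (input y) (T (length y)) {ts}"
      by (rule run_mono) (use balanced[OF x] in \<open>simp add: T_def\<close>)
    with x ts show ?thesis by blast
  qed
  have stuck: "run (find_preimage D) (input y) (T (length y)) {}" if "y \<notin> ran f" for y
  proof -
    have "run (find_preimage D) (input y) (poly p (length y) + (1 + 0 + 1) + 1) {}"
      unfolding find_preimage_def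
      by (rule run_then[OF ask run_stuck[OF run_assertion_fails]]) (use range that in simp)
    then show ?thesis by (rule run_mono) (simp add: T_def)
  qed
  define pre where "pre y = (SOME x. f x = Some y \<and>
    (\<exists>ts. ts (Var 0) = string_tape x \<and> run (find_preimage D) (input y) (T (length y)) {ts}))" for y
  have pre: "f (pre y) = Some y \<and>
    (\<exists>ts. ts (Var 0) = string_tape (pre y) \<and> run (find_preimage D) (input y) (T (length y)) {ts})"
    if "y \<in> ran f" for y
    unfolding pre_def by (rule someI_ex[OF found[OF that]])
  define g where "g y = (if y \<in> ran f then Some (pre y) else None)" for y
  have "\<exists>M \<in> DTM_poly. computes M g"
  proof (rule compile_function[OF find_preimage_wf[OF D(1)] T])
    fix y assume "g y = None"
    then show "run (find_preimage D) (input y) (T (length y)) {}"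
      by (intro stuck) (auto simp: g_def split: if_splits)
  next
    fix y x assume "g y = Some x"
    then have "y \<in> ran f" "x = pre y" by (auto simp: g_def split: if_splits)
    with pre show "\<exists>ts. ts (Var 0) = string_tape x \<and> run (find_preimage D) (input y) (T (length y)) {ts}" by blast
  qed
  moreover have "polynomially_balanced g"
    unfolding polynomially_balanced_def
  proof (intro exI allI impI)
    fix y x assume "g y = Some x"
    then have "y \<in> ran f" "x = pre y" by (auto simp: g_def split: if_splits)
    with pre balanced show "length x \<le> poly r (length y) \<and> length y \<le> poly q (length x)" by blast
  qed
  ultimately have "g \<in> carrier fP" by (simp add: fP_def)
  moreover have "f \<circ>\<^sub>m g \<circ>\<^sub>m f = f"
  proof
    fix x
    show "(f \<circ>\<^sub>m g \<circ>\<^sub>m f) x = f x"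
    proof (cases "f x")
      case (Some y)
      then have "y \<in> ran f" by (rule ranI)
      with Some pre show ?thesis by (simp add: map_comp_def g_def)
    qed (simp add: map_comp_def)
  qed
  ultimately show "\<exists>f' \<in> carrier fP. f \<otimes>\<^bsub>fP\<^esub> f' \<otimes>\<^bsub>fP\<^esub> f = f"
    by (intro bexI[of _ g]) (simp_all add: fP_def)
qed

theorem proposition1p8:
  "(regular fP \<longleftrightarrow> \<not> (\<exists>f. one_way f)) \<and> (\<not> (\<exists>f. one_way f) \<longleftrightarrow> class_P = class_NP)"
  using no_one_way_if_regular P_eq_NP_if_no_one_way regular_if_P_eq_NP by blast

end
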